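(* In the setting described in the context, fix the strategy set $\mathcal{S}$, let $S = \sup_{s\in\mathcal{S},\,\mathbf{z}\in\mathcal{D}_{\text{tr}}}|s(\mathbf{z})|$ and $L = k(\log b + 2S/\beta)$. Let $\mathbf{s}^*=(s_1^*,\dots,s_T^* )\in\mathcal{S}^T$ be any comparator sequence with at most $K$ switches, i.e. $|\{t\in\{1,\dots,T-1\} : s_{t+1}^*\ne s_t^*\}|\le K$. Running the posterior update with learning rate $$\lambda^* = \sqrt{\frac{8\bigl(K\log m + K\log(T/K)+\log m\bigr)}{L^2T}}$$ and mixing rate $\alpha^* = K/(T-1)$ yields $$\sum_{t=1}^T\mathbb{E}_{s\sim p_t}[\ell_t(s)]-\sum_{t=1}^T\ell_t(s_t^* )\;\le\; L\sqrt{\frac{T}{2}\bigl(K\log m+K\log(T/K)+\log m\bigr)}.$$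
   Context: Setting. $\mathcal{D}_{\text{tr}}$ is a finite nonempty training set. $m\ge 2$ is even, and the strategy set is the (indexed) family $\mathcal{S} = \{f_1,-f_1,\dots,f_{m/2},-f_{m/2}\}$ of $m$ real-valued functions on $\mathcal{D}_{\text{tr}}$. In the algorithm, the $f_j$ are drawn once at initialization from a Gaussian process prior; everything is conditional on the realization, so $\mathcal{S}$ is a fixed family. $T\ge 2$ is the number of iterations and $K\ge 0$ is an integer such that $\alpha^*=K/(T-1)$ lies in the admissible range $[0,1)$ for mixing rates; $K\log(T/K)$ is read as $0$ when $K=0$. It is assumed that $L>0$, so that $\lambda^*$ is defined. At each iteration $t\in\{1,\dots,T\}$ there is a batch $\mathcal{B}_t$ of $b$ elements of $\mathcal{D}_{\text{tr}}$ with observed real quality scores $q(\mathbf{z})$, $\mathbf{z}\in\mathcal{B}_t$. Both the batch and the scores may change arbitrarily with $t$ and may depend on the past and on the algorithm's random choices; the inequality concerns the realized trajectory. Let $\mathbf{z}_{(1)},\dots,\mathbf{z}_{(b)}$ be the elements of $\mathcal{B}_t$ sorted so that $q(\mathbf{z}_{(1)})\ge\dots\ge q(\mathbf{z}_{(b)})$ (ties broken in some fixed way). For an integer $1\le k\le b$ and a temperature $\beta>0$, the top-$k$ likelihood is $$p_{\text{top-}k}(q(\mathcal{B}_t)\mid s) = \prod_{j=1}^k \frac{\exp(s(\mathbf{z}_{(j)})/\beta)}{\sum_{i=1}^{b}\exp(s(\mathbf{z}_{(i)})/\beta)},\qquad s\in\mathcal{S},$$ and the loss is $\ell_t(s) =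 -\log p_{\text{top-}k}(q(\mathcal{B}_t)\mid s)$. Posterior update. With learning rate $\lambda>0$ and mixing rate $\alpha\in[0,1)$, set $p_1(s)=1/m$ for all $s\in\mathcal{S}$, and for $t\ge1$ $$\hat p_{t+1}(s) = \frac{p_t(s)\,p_{\text{top-}k}(q(\mathcal{B}_t)\mid s)^\lambda}{\sum_{s'\in\mathcal{S}}p_t(s')\,p_{\text{top-}k}(q(\mathcal{B}_t)\mid s')^\lambda},\qquad p_{t+1}(s) = \frac{\alpha}{m}+(1-\alpha)\,\hat p_{t+1}(s).$$ Thus $p_t$ is the distribution held at the start of iteration $t$, before $\mathcal{B}_t$ is observed. *)

theory Defs
  imports Complex_Main
begin

text \<open>
  The family \<open>{f\<^sub>1, -f\<^sub>1, \<dots>, f\<^sub>n, -f\<^sub>n}\<close> with \<open>n = m/2\<close> is indexed by pairs of a sign and a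
  number, so that it has \<open>m\<close> members even if some of the functions coincide.
\<close>

type_synonym strategy = "bool \<times> nat"

definition strategies :: "nat \<Rightarrow> strategy set" where
  "strategies m = UNIV \<times> {1..m div 2}"

definition strategy_fun :: "(nat \<Rightarrow> 'z \<Rightarrow> real) \<Rightarrow> strategy \<Rightarrow> 'z \<Rightarrow> real" where
  "strategy_fun f s z = (if fst s then f (snd s) z else - f (snd s) z)"

definition sup_norm :: "'z set \<Rightarrow> nat \<Rightarrow> (nat \<Rightarrow> 'z \<Rightarrow> real) \<Rightarrow> real" where
  "sup_norm D m f = (SUP (s, z) \<in> strategies m \<times> D. \<bar>strategy_fun f s z\<bar>)"

text \<open>
  A batch is a list. Its elements are ranked by decreasing score; sorting is stable, so ties
  are broken by the position in the batch. List indices start at 0: the element called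
  \<open>z\<^sub>(\<^sub>j\<^sub>)\<close> in informal notation is \<open>ranking q zs ! (j - 1)\<close>.
\<close>

definition ranking :: "('z \<Rightarrow> real) \<Rightarrow> 'z list \<Rightarrow> 'z list" where
  "ranking q zs = sort_key (\<lambda>z. - q z) zs"

definition topk_likelihood ::
    "nat \<Rightarrow> real \<Rightarrow> ('z \<Rightarrow> real) \<Rightarrow> 'z list \<Rightarrow> ('z \<Rightarrow> real) \<Rightarrow> real" where
  "topk_likelihood k \<beta> q zs g =
     (\<Prod>j<k. exp (g (ranking q zs ! j) / \<beta>) /
            (\<Sum>i<length zs. exp (g (ranking q zs ! i) / \<beta>)))"

definition topk_loss ::
    "nat \<Rightarrow> real \<Rightarrow> ('z \<Rightarrow> real) \<Rightarrow> 'z list \<Rightarrow> ('z \<Rightarrow> real) \<Rightarrow> real" where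
  "topk_loss k \<beta> q zs g = - ln (topk_likelihood k \<beta> q zs g)"

definition tempered_bayes ::
    "'s set \<Rightarrow> real \<Rightarrow> ('s \<Rightarrow> real) \<Rightarrow> ('s \<Rightarrow> real) \<Rightarrow> 's \<Rightarrow> real" where
  "tempered_bayes A lr lik p s =
     p s * lik s powr lr / (\<Sum>s'\<in>A. p s' * lik s' powr lr)"

text \<open>
  The distribution held at the start of iteration \<open>t\<close>, where \<open>lik t\<close> is the likelihood
  observed in iteration \<open>t\<close>. Iterations start at 1; the value at \<open>t = 0\<close> is irrelevant.
\<close>

fun posterior ::
    "'s set \<Rightarrow> real \<Rightarrow> real \<Rightarrow> (nat \<Rightarrow> 's \<Rightarrow> real) \<Rightarrow> nat \<Rightarrow> 's \<Rightarrow> real" where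
  "posterior A lr \<alpha> lik 0 s = 1 / real (card A)"
| "posterior A lr \<alpha> lik (Suc 0) s = 1 / real (card A)"
| "posterior A lr \<alpha> lik (Suc (Suc t)) s =
     \<alpha> / real (card A) +
     (1 - \<alpha>) * tempered_bayes A lr (lik (Suc t)) (posterior A lr \<alpha> lik (Suc t)) s"

definition loss_bound :: "nat \<Rightarrow> nat \<Rightarrow> real \<Rightarrow> real \<Rightarrow> real" where
  "loss_bound k b S \<beta> = real k * (ln (real b) + 2 * S / \<beta>)"

text \<open>
  For \<open>K = 0\<close> the middle summand is 0, which is the intended convention.
\<close>

definition complexity :: "nat \<Rightarrow> nat \<Rightarrow> nat \<Rightarrow> real" where
  "complexity K m T =
     real K * ln (real m) + real K * ln (real T / real K) + ln (real m)"

definition optimal_rate :: "real \<Rightarrow> nat \<Rightarrow> nat \<Rightarrow> nat \<Rightarrow> real" where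
  "optimal_rate L K m T = sqrt (8 * complexity K m T / (L\<^sup>2 * real T))"

definition mixing_rate :: "nat \<Rightarrow> nat \<Rightarrow> real" where
  "mixing_rate K T = real K / (real T - 1)"

end

theory Submission
  imports Defs
begin

text \<open>
  Put \<open>x = lr * L\<close> and scale the losses to \<open>[0, 1]\<close>; the claim becomes
  \<open>x * regret \<le> ln m + K ln m + K ln (T / K) + T x\<^sup>2 / 8\<close>. Telescoping \<open>- ln (p\<^sub>t (c\<^sub>t))\<close>, the usual
  analysis of a mixing update, is too weak by a summand \<open>K\<close>. Two effects that it ignores make up for
  this. Mixing keeps every weight above \<open>D \<alpha> / m\<close> with \<open>D = 1 / (1 - (1 - \<alpha>) e\<^bsup>-x\<^esup>) > 1\<close>, and an
  expectation can exceed the loss of \<open>c\<^sub>t\<close> by much only if the weight of \<open>c\<^sub>t\<close> is small. Both are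
  captured by telescoping \<open>- ln (p\<^sub>t (c\<^sub>t) + \<kappa> \<alpha> / m)\<close> instead. What is left is an inequality in
  \<open>x\<close> and \<open>\<alpha>\<close> only, with parameters such as \<open>\<kappa>\<close> at our disposal. For \<open>x \<le> 3 / 4\<close> the constant choice
  \<open>\<kappa> = 0.87\<close> works, for \<open>x \<ge> 4\<close> the claim is trivial, and the range between is divided into boxes
  on each of which fixed parameters are verified in integer arithmetic.
\<close>

text \<open>The missing \<open>K\<close> is the price of mixing. A step without a switch shrinks the
  Bayes weight of the comparator by 1 - \<alpha>. There are T - 1 - K such steps, K = \<alpha> * (T
  - 1), and (1 - \<alpha>) * (- ln (1 - \<alpha>)) is just below \<alpha> for small \<alpha>, so
  together they cost almost one unit per switch. Each switch has to earn that unit back. For small x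
  it does so through ln (D + \<kappa>), and \<kappa> is squeezed from two sides: a larger \<kappa>
  favours switches, but the offset takes no part in the Bayes update and therefore hurts the steps
  in which the comparator does well. For larger x two further reserves are used: a large excess loss
  makes the normaliser small and thereby lifts the weight of the next comparator, and the exact
  Hoeffding exponent is smaller than x^2 / 8. The tuned rate also ties \<alpha> to x by 8 * \<alpha>
  * ln (m / \<alpha>) \<le> x^2. This makes \<alpha> tiny when x is small, and it removes part of
  the (x, \<alpha>) rectangle from what has to be certified.\<close>

section \<open>Tangents of s * exp (1 - s)\<close>

text \<open>The right-hand side is the tangent at \<open>s = 1 - v\<close>. Since s + v \<le> exp (s
  - (1 - v)), the exponentials can be split off, and what is left is the square
  \<open>v * (s - (1 - v))^2\<close>. Tangents with positive slope bound the function on all of s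
  \<ge> 0, although it is not concave there.\<close>

lemma xexp_le_tangent:
  fixes s v :: real
  assumes "0 \<le> s" "0 < v" "v < 1"
  shows "s * exp (1 - s) \<le> exp v * ((1 - v)\<^sup>2 + v * s)"
proof -
  have pos: "0 < s + v" using assms by simp
  have "s \<le> (s + v) * ((1 - v)\<^sup>2 + v * s)"
  proof -
    have "(s + v) * ((1 - v)\<^sup>2 + v * s) - s = v * (s - (1 - v))\<^sup>2"
      by (simp add: power2_eq_square algebra_simps)
    also have "\<dots> \<ge> 0" using assms by simp
    finally show ?thesis by simp
  qed
  also have "\<dots> \<le> exp (s - (1 - v)) * ((1 - v)\<^sup>2 + v * s)"
    using exp_ge_add_one_self[of "s - (1 - v)"] assms by (intro mult_right_mono) auto
  finally have "s * exp (1 - s) \<le> exp (s - (1 - v)) * ((1 - v)\<^sup>2 + v * s) * exp (1 - s)"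
    by (intro mult_right_mono) auto
  also have "\<dots> = exp (s - (1 - v) + (1 - s)) * ((1 - v)\<^sup>2 + v * s)"
    unfolding exp_add by (simp add: mult.commute mult.left_commute)
  finally show ?thesis by simp
qed

lemma xexp_le_one: "s * exp (1 - s) \<le> 1" for s :: real
proof -
  have "s * exp (1 - s) \<le> exp (s - 1) * exp (1 - s)"
    using exp_ge_add_one_self[of "s - 1"] by (intro mult_right_mono) auto
  also have "\<dots> = 1" by (simp flip: exp_add)
  finally show ?thesis .
qed

section \<open>The exact Hoeffding exponent and its distance from x^2 / 8\<close>

definition slope :: "real \<Rightarrow> real" where
  "slope x = (1 - exp (- x)) / x"

text \<open>The maximum over \<open>E\<close> of
  \<open>x * E + ln (1 - (1 - exp (- x)) * E)\<close>, that is, the exact Hoeffding exponent for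
  losses in [0, 1]. It is attained where the argument of ln equals \<open>slope x\<close>.
  Hoeffding's lemma replaces it by x^2 / 8; the difference is a reserve on which the certificates
  draw.\<close>

definition hgap :: "real \<Rightarrow> real" where
  "hgap x = 1 / slope x - 1 + ln (slope x)"

lemma slope_pos: "0 < x \<Longrightarrow> 0 < slope x"
  by (simp add: slope_def)

lemma hgap_nonneg:
  assumes "0 < x" shows "0 \<le> hgap x"
  using ln_le_minus_one[of "1 / slope x"] slope_pos[OF assms]
  by (simp add: hgap_def ln_div)

text \<open>The bound on \<open>W\<close> turns \<open>x * E\<close> into at most
  \<open>(1 - W) / slope x\<close>. Replacing ln by its tangent at the maximiser
  \<open>slope x\<close> then cancels \<open>W\<close> altogether.\<close>

lemma mgf_le_hgap:
  fixes x E W :: real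
  assumes "0 < x" "0 < W" "W \<le> 1 - (1 - exp (- x)) * E"
  shows "x * E + ln W \<le> hgap x"
proof -
  let ?u = "slope x"
  have u: "0 < ?u" by (rule slope_pos) fact
  have q: "0 < 1 - exp (- x)" using assms by simp
  have "E \<le> (1 - W) / (1 - exp (- x))"
    using assms(3) q by (simp add: field_simps)
  then have "x * E \<le> x * ((1 - W) / (1 - exp (- x)))"
    using assms by (intro mult_left_mono) auto
  also have "\<dots> = (1 - W) / ?u" using assms q by (simp add: slope_def)
  finally have 1: "x * E \<le> (1 - W) / ?u" .
  have "ln W - ln ?u = ln (W / ?u)" using assms u by (simp add: ln_div)
  also have "\<dots> \<le> W / ?u - 1" using assms u by (intro ln_le_minus_one) auto
  finally show ?thesis using 1 by (simp add: hgap_def diff_divide_distrib)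
qed

text \<open>In half the argument the factor exp (- y) of \<open>slope\<close> cancels against a
  linear term. What remains is an even function of \<open>y\<close> with a derivative that
  factors.\<close>

lemma hgap_eq_coth:
  fixes y :: real
  assumes "0 < y"
  shows "hgap (2 * y) = y * cosh y / sinh y - 1 + ln (sinh y / y)"
proof -
  have s: "0 < sinh y" using assms by simp
  have sl: "slope (2 * y) = exp (- y) * (sinh y / y)"
  proof -
    have "1 - exp (- (2 * y)) = exp (- y) * (2 * sinh y)"
      by (simp add: sinh_def algebra_simps flip: exp_add)
    then show ?thesis by (simp add: slope_def)
  qed
  have "1 / slope (2 * y) = exp y * y / sinh y"
    unfolding sl using s assms by (simp add: exp_minus field_simps)
  also have "\<dots> = y * cosh y / sinh y + y"
  proof -
    have "exp y = cosh y + sinh y" by (simp add: cosh_def sinh_def field_simps)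
    then show ?thesis using s by (simp add: field_simps)
  qed
  finally have 1: "1 / slope (2 * y) = y * cosh y / sinh y + y" .
  have "ln (slope (2 * y)) = - y + ln (sinh y / y)"
    unfolding sl using s assms by (subst ln_mult) auto
  then show ?thesis unfolding hgap_def 1 by simp
qed

lemma tanh_le_self: 
  fixes y :: real assumes "0 \<le> y" shows "sinh y \<le> y * cosh y"
proof -
  have "\<exists>d. ((\<lambda>t. t * cosh t - sinh t) has_real_derivative d) (at t) \<and> 0 \<le> d" if "0 \<le> t" for t :: real
    by (intro exI[of _ "t * sinh t"] conjI) (auto intro!: derivative_eq_intros simp: that)
  from DERIV_nonneg_imp_nondecreasing[of 0 y "\<lambda>t. t * cosh t - sinh t"] this assms
  show ?thesis by auto
qed

text \<open>This is y coth y \<ge> 1 + y^2 / (3 + y^2 / 5), a convergent of the continued fraction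
  of y coth y, cleared of denominators. The derivative of the difference is \<open>r\<close> times
  the difference belonging to the preceding convergent 1 + y^2 / 3, and the derivative of that one
  leads to \<open>sinh y \<le> y * cosh y\<close>.\<close>

lemma coth_continued_fraction:
  fixes y :: real assumes "0 \<le> y"
  shows "(15 + 6 * y\<^sup>2) * sinh y \<le> y * (15 + y\<^sup>2) * cosh y"
proof -
  have 1: "0 \<le> (3 + t\<^sup>2) * sinh t - 3 * t * cosh t" if "0 \<le> t" for t :: real
  proof -
    have "\<exists>d. ((\<lambda>t. (3 + t\<^sup>2) * sinh t - 3 * t * cosh t) has_real_derivative d) (at r) \<and> 0 \<le> d"
      if "0 \<le> r" for r :: real
    proof (intro exI conjI)
      show "((\<lambda>t. (3 + t\<^sup>2) * sinh t - 3 * t * cosh t) has_real_derivative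
          r * (r * cosh r - sinh r)) (at r)"
        by (auto intro!: derivative_eq_intros simp: power2_eq_square algebra_simps)
      show "0 \<le> r * (r * cosh r - sinh r)" using tanh_le_self[OF that] that by simp
    qed
    from DERIV_nonneg_imp_nondecreasing[OF that, of "\<lambda>t. (3 + t\<^sup>2) * sinh t - 3 * t * cosh t"] this
    show ?thesis by auto
  qed
  have "\<exists>d. ((\<lambda>t. t * (15 + t\<^sup>2) * cosh t - (15 + 6 * t\<^sup>2) * sinh t) has_real_derivative d) (at r) \<and> 0 \<le> d"
    if "0 \<le> r" for r :: real
  proof (intro exI conjI)
    show "((\<lambda>t. t * (15 + t\<^sup>2) * cosh t - (15 + 6 * t\<^sup>2) * sinh t) has_real_derivative
        r * ((3 + r\<^sup>2) * sinh r - 3 * r * cosh r)) (at r)"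
      by (auto intro!: derivative_eq_intros simp: power2_eq_square algebra_simps)
    show "0 \<le> r * ((3 + r\<^sup>2) * sinh r - 3 * r * cosh r)" using 1[OF that] that by simp
  qed
  from DERIV_nonneg_imp_nondecreasing[OF assms, of "\<lambda>t. t * (15 + t\<^sup>2) * cosh t - (15 + 6 * t\<^sup>2) * sinh t"] this
  show ?thesis by auto
qed

text \<open>A truncated and integrated series. With y = x / 2 and w = y^2 / 15, the derivative of
  x^2 / 8 - hgap x in y is at least (y^3 / 9) / (1 + w)^2. Cutting 1 / (1 + w)^2 off after - 4 w^3
  and integrating from 0 gives these coefficients.\<close>

definition hslack :: "real \<Rightarrow> real" where
  "hslack x = x ^ 4 / 576 - x ^ 6 / 25920 + x ^ 8 / 1382400 - x ^ 10 / 77760000"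

text \<open>By cosh^2 = sinh^2 + 1 the terms combine into a square over \<open>y\<close>. Its sign
  gives the monotonicity of the slack, and a lower bound of y coth y - 1 gives the size of the
  slack.\<close>

lemma hgap_DERIV:
  fixes y :: real assumes "0 < y"
  shows "((\<lambda>y. y\<^sup>2 / 2 - hgap (2 * y)) has_real_derivative
           (y * cosh y / sinh y - 1)\<^sup>2 / y) (at y)"
proof -
  have s: "0 < sinh y" using assms by simp
  let ?f = "\<lambda>y::real. y\<^sup>2 / 2 - (y * cosh y / sinh y - 1 + ln (sinh y / y))"
  have cs: "(cosh y)\<^sup>2 = (sinh y)\<^sup>2 + 1" by (rule cosh_square_eq)
  have "(?f has_real_derivative
      y - (((cosh y + y * sinh y) * sinh y - y * cosh y * cosh y) / (sinh y * sinh y)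
           + inverse (sinh y / y) * ((cosh y * y - sinh y) / (y * y)))) (at y)"
    using assms s by (auto intro!: derivative_eq_intros simp: algebra_simps)
  also have "y - (((cosh y + y * sinh y) * sinh y - y * cosh y * cosh y) / (sinh y * sinh y)
           + inverse (sinh y / y) * ((cosh y * y - sinh y) / (y * y)))
     = (y * cosh y / sinh y - 1)\<^sup>2 / y"
    using assms s cs by (simp add: field_simps power2_eq_square)
  finally have D: "(?f has_real_derivative (y * cosh y / sinh y - 1)\<^sup>2 / y) (at y)" .
  show ?thesis
    by (rule has_field_derivative_transform_within_open[OF D, of "{0<..}"])
       (use assms in \<open>auto simp: hgap_eq_coth\<close>)
qed

text \<open>Allows a whole interval of \<open>x\<close> to use the slack at its left end.\<close>

lemma hgap_slack_mono:
  fixes x x' :: real assumes "0 < x" "x \<le> x'"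
  shows "x\<^sup>2 / 8 - hgap x \<le> x'\<^sup>2 / 8 - hgap x'"
proof -
  have "(x / 2)\<^sup>2 / 2 - hgap (2 * (x / 2)) \<le> (x' / 2)\<^sup>2 / 2 - hgap (2 * (x' / 2))"
  proof (rule DERIV_nonneg_imp_nondecreasing[where f = "\<lambda>y. y\<^sup>2 / 2 - hgap (2 * y)"])
    fix t :: real assume "x / 2 \<le> t"
    with assms have "0 < t" by simp
    with hgap_DERIV[OF this]
    show "\<exists>d. ((\<lambda>y. y\<^sup>2 / 2 - hgap (2 * y)) has_real_derivative d) (at t) \<and> 0 \<le> d"
      by (intro exI conjI) auto
  qed (use assms in auto)
  then show ?thesis by (simp add: power2_eq_square)
qed

text \<open>The difference of the two sides is nondecreasing by the continued fraction bound, so its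
  limit at 0 decides. \<open>hgap\<close> divides by its argument, hence its value at 0 says nothing
  about the limit; a continuous minorant takes its place.\<close>

lemma hslack_le:
  fixes x :: real assumes "0 < x"
  shows "hslack x \<le> x\<^sup>2 / 8 - hgap x"
proof -
  define F where "F y = y\<^sup>2 / 2 - hgap (2 * y) - hslack (2 * y)" for y
  define y where "y = x / 2"
  have y: "0 < y" using assms by (simp add: y_def)
  have incr: "F e \<le> F y" if e: "0 < e" "e \<le> y" for e
  proof (rule DERIV_nonneg_imp_nondecreasing[OF e(2)])
    fix t assume "e \<le> t"
    with e have t: "0 < t" by simp
    let ?d = "t ^ 3 / 9 * (1 - 2 * (t\<^sup>2 / 15) + 3 * (t\<^sup>2 / 15)\<^sup>2 - 4 * (t\<^sup>2 / 15) ^ 3)"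
    have D: "(F has_real_derivative (t * cosh t / sinh t - 1)\<^sup>2 / t - ?d) (at t)"
      unfolding F_def
      apply (rule DERIV_diff[OF hgap_DERIV[OF t]])
      unfolding hslack_def
      apply (auto intro!: derivative_eq_intros simp: field_simps power2_eq_square eval_nat_numeral)
      done
    have s: "0 < sinh t" using t by simp
    have "5 * t\<^sup>2 / (15 + t\<^sup>2) \<le> t * cosh t / sinh t - 1"
    proof -
      have "(15 + 6 * t\<^sup>2) / (15 + t\<^sup>2) \<le> t * cosh t / sinh t"
        using coth_continued_fraction[of t] t s
        by (subst divide_le_eq, simp add: add_pos_nonneg) (simp add: field_simps)
      moreover have "(15 + 6 * t\<^sup>2) / (15 + t\<^sup>2) = 1 + 5 * t\<^sup>2 / (15 + t\<^sup>2)"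
        using add_pos_nonneg[of 15 "t\<^sup>2"] by (simp add: field_simps)
      ultimately show ?thesis by simp
    qed
    then have "(5 * t\<^sup>2 / (15 + t\<^sup>2))\<^sup>2 \<le> (t * cosh t / sinh t - 1)\<^sup>2"
      by (rule power_mono) simp
    then have "(5 * t\<^sup>2 / (15 + t\<^sup>2))\<^sup>2 / t \<le> (t * cosh t / sinh t - 1)\<^sup>2 / t"
      using t by (simp add: divide_right_mono)
    moreover have "?d \<le> (5 * t\<^sup>2 / (15 + t\<^sup>2))\<^sup>2 / t"
    proof -
      define w where "w = t\<^sup>2 / 15"
      have w: "0 \<le> w" by (simp add: w_def)
      \<comment> \<open>The beginning of the series of 1 / (1 + w)^2. After multiplication by (1 +
        w)^2 everything up to w^3 cancels except 1, and the rest is negative.\<close>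
      have "(1 - 2 * w + 3 * w\<^sup>2 - 4 * w ^ 3) * (1 + w)\<^sup>2 = 1 - 5 * w ^ 4 - 4 * w ^ 5"
        by (simp add: algebra_simps power2_eq_square eval_nat_numeral)
      also have "\<dots> \<le> 1" using zero_le_power[OF w, of 4] zero_le_power[OF w, of 5] by linarith
      finally have "1 - 2 * w + 3 * w\<^sup>2 - 4 * w ^ 3 \<le> 1 / (1 + w)\<^sup>2"
        using w by (subst le_divide_eq) auto
      then have "?d \<le> t ^ 3 / 9 * (1 / (1 + w)\<^sup>2)"
        unfolding w_def[symmetric] using t by (intro mult_left_mono) auto
      also have "\<dots> = (5 * t\<^sup>2 / (15 + t\<^sup>2))\<^sup>2 / t"
      proof -
        have *: "15 + t\<^sup>2 = 15 * (1 + w)" by (simp add: w_def)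
        have "(5 * t\<^sup>2 / (15 * (1 + w)))\<^sup>2 = t ^ 4 / (9 * (1 + w)\<^sup>2)"
          by (simp add: power_divide power_mult_distrib del: distrib_left_numeral flip: power_mult)
        then show ?thesis unfolding * using t by (simp add: eval_nat_numeral)
      qed
      finally show ?thesis .
    qed
    ultimately have "0 \<le> (t * cosh t / sinh t - 1)\<^sup>2 / t - ?d" by linarith
    with D show "\<exists>d. (F has_real_derivative d) (at t) \<and> 0 \<le> d" by blast
  qed
  \<comment> \<open>Both e * coth e - 1 and ln (sinh e / e) are at most cosh e - 1, which yields a
    minorant of \<open>F\<close> that is continuous and zero at 0.\<close>
  define G where "G e = e\<^sup>2 / 2 - 2 * (cosh e - 1) - hslack (2 * e)" for e
  have G: "G e \<le> F e" if e: "0 < e" for e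
  proof -
    have s: "0 < sinh e" using e by simp
    have es: "e \<le> sinh e" 
      using real_le_x_sinh[of e] e by (simp add: sinh_def exp_minus)
    have "e * cosh e / sinh e \<le> cosh e"
      using s es by (simp add: field_simps mult_right_mono)
    moreover have "ln (sinh e / e) \<le> sinh e / e - 1"
      using s e by (intro ln_le_minus_one) auto
    moreover have "sinh e / e \<le> cosh e"
      using tanh_le_self[of e] e by (simp add: field_simps)
    ultimately show ?thesis using e by (simp add: F_def G_def hgap_eq_coth)
  qed
  have "isCont G 0" unfolding G_def hslack_def by (intro continuous_intros) auto
  then have "(G \<longlongrightarrow> G 0) (at_right 0)"
    unfolding continuous_at by (rule tendsto_within_subset) simp
  moreover have "G 0 = 0" by (simp add: G_def hslack_def)
  ultimately have lim: "(G \<longlongrightarrow> 0) (at_right 0)" by simp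
  have "\<forall>\<^sub>F e in at_right 0. G e \<le> F y"
    unfolding eventually_at_right_field
    by (rule exI[of _ y]) (use y in \<open>auto intro!: order_trans[OF G incr]\<close>)
  from tendsto_upperbound[OF lim this] have "0 \<le> F y" by simp
  then show ?thesis by (simp add: F_def y_def power2_eq_square)
qed

lemma hgap_le:
  assumes "0 < x" "x \<le> 4"
  shows "hgap x \<le> x\<^sup>2 / 8"
proof -
  have "x\<^sup>2 \<le> 4\<^sup>2" using assms by (intro power_mono) auto
  \<comment> \<open>The alternating polynomial is grouped into pairs; for x^2 \<le> 16 each bracket
    is non-negative.\<close>
  then have "0 \<le> x ^ 4 * (1 / 576 - x\<^sup>2 / 25920) + x ^ 8 * (1 / 1382400 - x\<^sup>2 / 77760000)"
    by (intro add_nonneg_nonneg mult_nonneg_nonneg) auto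
  also have "\<dots> = hslack x"
    by (simp add: hslack_def algebra_simps flip: power_add)
  also have "\<dots> \<le> x\<^sup>2 / 8 - hgap x" by (rule hslack_le) fact
  finally show ?thesis by simp
qed

text \<open>The tangents of \<open>s * exp (1 - s)\<close> at points beyond 1 only bound the function on an
  initial segment.\<close>

lemma xexp_le_tangent':
  fixes s y :: real
  assumes "0 \<le> y" "y \<le> 1" "y * s \<le> 1"
  shows "s * exp (1 - s) \<le> exp (- y) * ((1 + y)\<^sup>2 - y * s)"
proof -
  define \<delta> where "\<delta> = s - (1 + y)"
  have main: "1 + y + \<delta> \<le> exp \<delta> * (1 + y - y * \<delta>)"
  proof (cases "0 \<le> \<delta>")
    case True
    have y\<delta>: "y * \<delta> \<le> 1 - y"
    proof -
      have "y * \<delta> = y * s - y - y * y" by (simp add: \<delta>_def algebra_simps)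
      then show ?thesis using assms zero_le_square[of y] by linarith
    qed
    \<comment> \<open>Taylor's quadratic lower bound of exp suffices: its product with
      \<open>1 + y - y * \<delta>\<close> exceeds \<open>1 + y + \<delta>\<close> by exactly this
      term. The assumption \<open>y * s \<le> 1\<close> makes the bracket non-negative.\<close>
    have "0 \<le> \<delta>\<^sup>2 / 2 * (1 - y - y * \<delta>)" using y\<delta> by simp
    then have "1 + y + \<delta> \<le> (1 + \<delta> + \<delta>\<^sup>2 / 2) * (1 + y - y * \<delta>)"
      by (simp add: algebra_simps power2_eq_square)
    also have "\<dots> \<le> exp \<delta> * (1 + y - y * \<delta>)"
      using exp_lower_Taylor_quadratic[OF True] y\<delta> assms by (intro mult_right_mono) auto
    finally show ?thesis .
  next
    case False
    \<comment> \<open>To the left of the point of tangency the difference decreases towards its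
      value 0, because its derivative is at most exp ((1 - y) * t) - 1.\<close>
    have "exp 0 * (1 + y - y * 0) - (1 + y + 0) \<le> exp \<delta> * (1 + y - y * \<delta>) - (1 + y + \<delta>)"
    proof (rule DERIV_nonpos_imp_nonincreasing[where f = "\<lambda>t. exp t * (1 + y - y * t) - (1 + y + t)"])
      fix t :: real assume t: "t \<le> 0"
      have "exp t * (1 + - y * t) \<le> exp t * exp (- y * t)"
        by (intro mult_left_mono exp_ge_add_one_self) auto
      also have "\<dots> = exp ((1 - y) * t)" by (simp add: algebra_simps flip: exp_add)
      also have "\<dots> \<le> 1" using t assms by (simp add: mult_nonneg_nonpos)
      finally have "exp t * (1 - y * t) - 1 \<le> 0" by simp
      moreover have "((\<lambda>t. exp t * (1 + y - y * t) - (1 + y + t)) has_real_derivative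
          exp t * (1 - y * t) - 1) (at t)"
        by (auto intro!: derivative_eq_intros simp: algebra_simps)
      ultimately show "\<exists>d. ((\<lambda>t. exp t * (1 + y - y * t) - (1 + y + t)) has_real_derivative d) (at t) \<and> d \<le> 0"
        by blast
    qed (use False in simp)
    then show ?thesis by simp
  qed
  have "s * exp (1 - s) = (1 + y + \<delta>) * exp (- y - \<delta>)" by (simp add: \<delta>_def)
  also have "\<dots> \<le> exp \<delta> * (1 + y - y * \<delta>) * exp (- y - \<delta>)"
    using main by (intro mult_right_mono) auto
  also have "\<dots> = exp (- y) * (1 + y - y * \<delta>)" by (simp add: exp_diff exp_minus)
  also have "1 + y - y * \<delta> = (1 + y)\<^sup>2 - y * s" by (simp add: \<delta>_def algebra_simps power2_eq_square)
  finally show ?thesis .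
qed

section \<open>Change of the potential in one step\<close>

text \<open>Coefficientwise comparison of the line \<open>b + d * s\<close> with \<open>c\<close>
  times the tangent of \<open>s * exp (1 - s)\<close> at \<open>s = 1 - v\<close>. An inequality for
  all s \<ge> 0 is thereby reduced to two numerical ones, at the price of choosing
  \<open>v\<close>.\<close>

definition tangent_bound :: "real \<Rightarrow> real \<Rightarrow> real \<Rightarrow> real \<Rightarrow> bool" where
  "tangent_bound v c b d \<longleftrightarrow> exp v * (1 - v)\<^sup>2 * c \<le> b \<and> exp v * v * c \<le> d"

lemma tangent_boundD:
  assumes "tangent_bound v c b d" "0 < v" "v < 1" "0 \<le> c" "0 \<le> s"
  shows "c * (s * exp (1 - s)) \<le> b + d * s"
proof -
  have "c * (s * exp (1 - s)) \<le> c * (exp v * ((1 - v)\<^sup>2 + v * s))"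
    using assms by (intro mult_left_mono xexp_le_tangent) auto
  also have "\<dots> = exp v * (1 - v)\<^sup>2 * c + exp v * v * c * s" by (simp add: algebra_simps)
  also have "\<dots> \<le> b + d * s"
    using assms by (intro add_mono mult_right_mono) (auto simp: tangent_bound_def)
  finally show ?thesis .
qed

text \<open>\<open>P\<close> and \<open>a\<close> are weight and loss of the comparator,
  \<open>E\<close> is the mean loss and \<open>W\<close> the normaliser. Mixing alone would cost
  \<open>- ln (1 - \<alpha>)\<close>; crediting a fraction \<tau> of the share \<eta> that mixing
  returns to the comparator lowers this to \<open>- ln (1 - \<beta>)\<close>. After exponentiation
  the claim is affine in \<open>P\<close>, and the excess loss enters through a single expression s
  * exp (1 - s), so tangents finish. \<open>low\<close> and \<open>mid\<close> serve the weights
  between \<open>D * \<eta>\<close> and \<open>r * \<eta>\<close>, \<open>high\<close> the larger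
  ones.\<close>

lemma potential_stay:
  fixes x \<alpha> \<eta> \<kappa> \<tau> \<beta> r v\<^sub>1 v\<^sub>2 v\<^sub>3 D E W a P :: real
  defines "e \<equiv> exp (- x)" and "q \<equiv> 1 - exp (- x)"
  assumes x: "0 < x" and \<alpha>: "0 < \<alpha>" "\<alpha> < 1" and \<eta>: "0 < \<eta>" and \<kappa>: "0 \<le> \<kappa>"
    and \<tau>: "0 \<le> \<tau>" "\<tau> \<le> 1" and \<beta>: "\<beta> = \<alpha> - \<tau> * \<eta>" "\<beta> < 1"  and \<beta>0: "0 \<le> \<beta>"
    and v: "0 < v\<^sub>1" "v\<^sub>1 < 1" "0 < v\<^sub>2" "v\<^sub>2 < 1" "0 < v\<^sub>3" "v\<^sub>3 < 1"
    and D: "0 < D" "D * \<eta> \<le> P" and r: "0 \<le> r"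
    and low: "D \<le> r \<Longrightarrow> tangent_bound v\<^sub>1 ((1 - \<alpha>) * D + (1 - \<beta>) * \<kappa> + \<tau> * D * \<eta>)
                ((1 - \<alpha>) * D) ((1 + \<kappa>) * slope x)"
    and mid: "D \<le> r \<Longrightarrow> tangent_bound v\<^sub>2 ((1 - \<alpha>) * r + (1 - \<beta>) * \<kappa> + \<tau> * r * \<eta>)
                ((1 - \<alpha>) * r) ((1 + \<kappa>) * slope x)"
    and high: "tangent_bound v\<^sub>3 ((1 - \<alpha>) * r + (1 - \<beta>) * \<kappa>)
                ((1 - \<alpha>) * r + \<tau> * e / q) ((1 + \<kappa> - \<tau> / q) * slope x)"
    and a: "0 \<le> a" "a \<le> 1" and W: "0 < W" "W \<le> 1 - q * E" and P: "P \<le> 1"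
    and EP: "E - a \<le> (1 - a) * (1 - P)"
  shows "x * (E - a) + ln (P + \<kappa> * \<eta>)
           - ln (\<eta> + (1 - \<alpha>) * (P * exp (- x * a) / W) + \<kappa> * \<eta>)
         \<le> hgap x - ln (1 - \<beta>)"
proof -
  define Y where "Y = E - a"
  define y where "y = exp (x * Y - hgap x)"
  define X where "X = exp (- x * a) / W"
  have e: "0 < e" "e < 1" using x by (auto simp: e_def)
  have q: "0 < q" "q = 1 - e" using e by (auto simp: q_def e_def)
  define u where "u = slope x"
  have u: "0 < u" "x * u = q" using x slope_pos[OF x] by (auto simp: u_def slope_def q_def)
  have P0: "0 < P" using D \<eta> by (smt (verit) mult_pos_pos)
  have y0: "0 < y" by (simp add: y_def)
  have na: "1 - \<beta> = 1 - \<alpha> + \<tau> * \<eta>" using \<beta>(1) by simp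
  \<comment> \<open>\<open>X\<close> is the Bayes factor of the comparator, and \<open>y\<close> is
    the lower bound for it that the Hoeffding exponent provides.\<close>
  have yX: "y \<le> X"
  proof -
    have "x * E + ln W \<le> hgap x" using mgf_le_hgap[OF x W(1), of E] W(2) by (simp add: q_def)
    then have "x * Y - hgap x \<le> - x * a - ln W" by (simp add: Y_def algebra_simps)
    then have "y \<le> exp (- x * a - ln W)" by (simp add: y_def)
    also have "\<dots> = X" using W by (simp add: X_def exp_diff)
    finally show ?thesis .
  qed
  have main: "(1 - \<beta>) * (y * (P + \<kappa> * \<eta>)) \<le> \<eta> + (1 - \<alpha>) * (P * X) + \<kappa> * \<eta>"
  proof (cases "y \<le> 1")
    case True
    \<comment> \<open>If the excess loss does not exceed the Hoeffding exponent, the summands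
      compare one by one; the credited share is covered by \<open>\<eta>\<close> itself.\<close>
    have "(1 - \<beta>) * (y * (P + \<kappa> * \<eta>)) = (1 - \<alpha>) * (P * y) + \<tau> * \<eta> * (y * P) + (1 - \<beta>) * (y * \<kappa> * \<eta>)"
      unfolding na by (simp add: algebra_simps)
    also have "(1 - \<alpha>) * (P * y) \<le> (1 - \<alpha>) * (P * X)"
      using yX P0 \<alpha> by (intro mult_left_mono) auto
    also have "\<tau> * \<eta> * (y * P) \<le> 1 * \<eta> * (1 * 1)"
      using \<tau> \<eta> True y0 P P0 by (intro mult_mono) auto
    also have "(1 - \<beta>) * (y * \<kappa> * \<eta>) \<le> 1 * (1 * \<kappa> * \<eta>)"
      using \<beta>0 True y0 \<kappa> \<eta> \<beta> by (intro mult_mono) auto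
    finally show ?thesis by simp
  next
    case False
    then have "1 < y" by simp
    then have "0 < x * Y - hgap x" by (simp add: y_def)
    with hgap_nonneg[OF x] have "0 < x * Y" by simp
    then have Y0: "0 < Y" using x by (simp add: zero_less_mult_iff)
    have "(1 - a) * (1 - P) \<le> 1 * (1 - P)" using a P by (intro mult_right_mono) auto
    with EP have PY: "P \<le> 1 - Y" by (simp add: Y_def)
    \<comment> \<open>The bound on the normaliser as it would be for a comparator without loss and
      mean loss \<open>Y\<close>. Measured in units of \<open>slope x\<close>, it makes
      \<open>y * w\<close> a function of \<open>s\<close> alone.\<close>
    define w where "w = 1 - q * Y"
    have "q * Y < 1 * 1" using q e Y0 PY P0 by (intro mult_strict_mono') auto
    then have w: "0 < w" by (simp add: w_def)
    have wY: "1 - Y = (w - e) / q" using q by (simp add: w_def field_simps)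
    define s where "s = w / u"
    have s: "0 \<le> s" using w u by (simp add: s_def)
    have yw: "y * w = s * exp (1 - s)"
    proof -
      have "x * Y = 1 / u - s" 
      proof -
        have "x * Y * u = (x * u) * Y" by simp
        also have "\<dots> = 1 - w" using u by (simp add: w_def)
        also have "\<dots> = (1 / u - s) * u" using u by (simp add: s_def left_diff_distrib)
        finally show ?thesis using u by simp
      qed
      then have "x * Y - hgap x = 1 - s - ln u" by (simp add: hgap_def u_def)
      then have "y = exp (1 - s) / u" using u by (simp add: y_def exp_diff)
      then show ?thesis by (simp add: s_def)
    qed
    have yw1: "y * w \<le> 1" unfolding yw by (rule xexp_le_one)
    let ?L = "\<lambda>d. (1 - \<alpha>) * d" and ?R = "(1 - \<beta>) * \<kappa>"
    have R0: "0 \<le> ?R" using \<beta> \<kappa> by simp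
    have Lr0: "0 \<le> ?L r" using \<alpha> r by simp
    have tauY: "\<tau> * (1 - Y) = \<tau> / q * w - \<tau> * e / q"
      unfolding wY by (simp add: right_diff_distrib diff_divide_distrib)
    \<comment> \<open>What is left of the claim after removing
      \<open>(1 - \<alpha>) * (P * y)\<close> from both sides and dividing by
      \<open>\<eta>\<close>.\<close>
    have key: "(1 - \<beta>) * \<kappa> * y + \<tau> * y * P \<le> (1 - \<alpha>) * (X - y) * (P / \<eta>) + 1 + \<kappa>"
    proof (cases "w \<le> u")
      case True
      \<comment> \<open>For w \<le> u a positive loss \<open>a\<close> of the comparator only helps:
        the normaliser decreases at least as fast as \<open>exp (- x * a)\<close>. So
        \<open>w * X\<close> is at least 1 as in the case a = 0.\<close>
      have "w - q * a \<le> w * exp (- x * a)"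
      proof -
        have "w * (x * a) \<le> u * (x * a)" using True x a by (intro mult_right_mono) auto
        also have "\<dots> = q * a" by (simp flip: u(2))
        finally have "w - q * a \<le> w * (1 + - x * a)" by (simp add: algebra_simps)
        also have "\<dots> \<le> w * exp (- x * a)" using w by (intro mult_left_mono exp_ge_add_one_self) auto
        finally show ?thesis .
      qed
      moreover have "W \<le> w - q * a" using W by (simp add: w_def Y_def algebra_simps)
      ultimately have "W \<le> w * exp (- x * a)" by linarith
      then have wX: "1 \<le> w * X" using W by (simp add: X_def field_simps)
      have at: "?R * y + \<tau> * y * (d * \<eta>) \<le> ?L d * (X - y) + 1 + \<kappa>"
        if tb: "tangent_bound v (?L d + ?R + \<tau> * d * \<eta>) (?L d) ((1 + \<kappa>) * u)"
          and v: "0 < v" "v < 1" and d: "0 \<le> d" for v d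
      proof -
        have Ld: "0 \<le> ?L d" using \<alpha> d by simp
        have "(?L d + ?R + \<tau> * d * \<eta>) * (y * w) \<le> ?L d + (1 + \<kappa>) * u * s"
          unfolding yw using tb v s Ld R0 \<tau> d \<eta> by (intro tangent_boundD) auto
        also have "(1 + \<kappa>) * u * s = (1 + \<kappa>) * w" using u by (simp add: s_def)
        finally have "?R * (y * w) + \<tau> * d * \<eta> * (y * w) \<le> ?L d * (1 - y * w) + (1 + \<kappa>) * w"
          by (simp add: algebra_simps)
        also have "?L d * (1 - y * w) \<le> ?L d * (w * X - w * y)"
          using wX Ld by (intro mult_left_mono) (auto simp: mult.commute)
        finally have "w * (?R * y + \<tau> * y * (d * \<eta>)) \<le> w * (?L d * (X - y) + 1 + \<kappa>)"
          by (simp add: algebra_simps)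
        then show ?thesis using w by simp
      qed
      show ?thesis
      proof (cases "P \<le> r * \<eta>")
        case True
        define k where "k = P / \<eta>"
        have k: "D \<le> k" "k \<le> r" "P = k * \<eta>" using D True \<eta> by (auto simp: k_def field_simps)
        then have Dr: "D \<le> r" by simp
        \<comment> \<open>Affine in \<open>d\<close>, which stands for P / \<eta>; its sign on the
          interval from \<open>D\<close> to \<open>r\<close> is decided at the two ends.\<close>
        define f where "f d = ?L d * (X - y) + 1 + \<kappa> - (?R * y + \<tau> * y * (d * \<eta>))" for d
        have f: "0 \<le> f D" "0 \<le> f r"
          using at[OF low[OF Dr, folded u_def]] at[OF mid[OF Dr, folded u_def]] v D r by (auto simp: f_def)
        have "0 \<le> f k"
        proof (cases "D = r")
          case False
          have "(r - D) * f k = (r - k) * f D + (k - D) * f r" by (simp add: f_def algebra_simps)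
          also have "\<dots> \<ge> 0" using f k by simp
          finally show ?thesis using False Dr by (simp add: zero_le_mult_iff)
        qed (use f k in auto)
        then show ?thesis using \<eta> by (simp add: f_def k(3) algebra_simps)
      next
        case False
        have "(?L r + ?R) * (y * w) \<le> ?L r + \<tau> * e / q + (1 + \<kappa> - \<tau> / q) * u * s"
          unfolding yw using high v s Lr0 R0 by (intro tangent_boundD[of v\<^sub>3]) (auto simp: u_def)
        also have "(1 + \<kappa> - \<tau> / q) * u * s = (1 + \<kappa> - \<tau> / q) * w" using u by (simp add: s_def)
        finally have "(?L r + ?R) * (y * w) \<le> ?L r + \<tau> * e / q + (1 + \<kappa> - \<tau> / q) * w" .
        \<comment> \<open>For large weights the factor \<open>P\<close> of the credited share is
          replaced by its bound \<open>1 - Y\<close>, which is linear in \<open>w\<close> and fits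
          into the tangent bound.\<close>
        moreover have "\<tau> * (1 - Y) * (y * w) \<le> \<tau> * (1 - Y) * 1"
          using yw1 \<tau> PY P0 by (intro mult_left_mono) auto
        ultimately have "?R * (y * w) + \<tau> * (1 - Y) * (y * w) \<le> ?L r * (1 - y * w) + (1 + \<kappa>) * w"
          using tauY by (simp add: algebra_simps)
        also have "?L r * (1 - y * w) \<le> ?L r * (w * X - w * y)"
          using wX Lr0 by (intro mult_left_mono) (auto simp: mult.commute)
        finally have "w * (?R * y + \<tau> * (1 - Y) * y) \<le> w * (?L r * (X - y) + 1 + \<kappa>)"
          by (simp add: algebra_simps)
        then have 1: "?R * y + \<tau> * (1 - Y) * y \<le> ?L r * (X - y) + 1 + \<kappa>" using w by simp
        have "\<tau> * y * P \<le> \<tau> * y * (1 - Y)" using \<tau> y0 PY by (intro mult_left_mono) auto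
        moreover have "(1 - \<alpha>) * (X - y) * r \<le> (1 - \<alpha>) * (X - y) * (P / \<eta>)"
        proof (rule mult_left_mono)
          show "r \<le> P / \<eta>" using False \<eta> by (simp add: pos_le_divide_eq)
          show "0 \<le> (1 - \<alpha>) * (X - y)" using \<alpha> yX by simp
        qed
        ultimately show ?thesis using 1 by (simp add: algebra_simps)
      qed
    next
      case False
      have coef: "0 \<le> 1 + \<kappa> - \<tau> / q"
      proof -
        have "0 \<le> exp v\<^sub>3 * v\<^sub>3 * (?L r + ?R)" using v Lr0 R0 by simp
        also have "\<dots> \<le> (1 + \<kappa> - \<tau> / q) * u" using high by (simp add: tangent_bound_def u_def)
        finally show ?thesis using u by (simp add: zero_le_mult_iff)
      qed
      \<comment> \<open>For w > u the function s * exp (1 - s) is past its maximum. The bound is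
        taken at the peak s = 1, and since the coefficient of \<open>u\<close> is non-negative,
        \<open>u\<close> may then be raised to \<open>w\<close>.\<close>
      have "(?L r + ?R) * (1 * exp (1 - 1)) \<le> ?L r + \<tau> * e / q + (1 + \<kappa> - \<tau> / q) * u * 1"
        using high v Lr0 R0 by (intro tangent_boundD[of v\<^sub>3]) (auto simp: u_def)
      also have "(1 + \<kappa> - \<tau> / q) * u * 1 \<le> (1 + \<kappa> - \<tau> / q) * w"
        using False coef by (simp add: mult_left_mono)
      finally have 1: "?R \<le> \<tau> * e / q + (1 + \<kappa> - \<tau> / q) * w" by simp
      have "?R * (y * w) + \<tau> * (1 - Y) * (y * w) \<le> ?R * 1 + \<tau> * (1 - Y) * 1"
        using yw1 \<tau> PY P0 R0 by (intro add_mono mult_left_mono) auto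
      also have "\<dots> \<le> (1 + \<kappa>) * w" using 1 tauY by (simp add: algebra_simps)
      finally have "w * (?R * y + \<tau> * (1 - Y) * y) \<le> w * (1 + \<kappa>)"
        by (simp add: algebra_simps)
      then have 2: "?R * y + \<tau> * (1 - Y) * y \<le> 1 + \<kappa>" using w by simp
      have "\<tau> * y * P \<le> \<tau> * y * (1 - Y)" using \<tau> y0 PY by (intro mult_left_mono) auto
      moreover have "0 \<le> (1 - \<alpha>) * (X - y) * (P / \<eta>)" using \<alpha> yX P0 \<eta> by simp
      ultimately show ?thesis using 2 by (simp add: algebra_simps)
    qed
    have "(1 - \<beta>) * (y * (P + \<kappa> * \<eta>))
        = (1 - \<alpha>) * (P * y) + \<eta> * ((1 - \<beta>) * \<kappa> * y + \<tau> * y * P)"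
      unfolding na by (simp add: algebra_simps)
    also have "\<dots> \<le> (1 - \<alpha>) * (P * y) + \<eta> * ((1 - \<alpha>) * (X - y) * (P / \<eta>) + 1 + \<kappa>)"
      using key \<eta> by (intro add_left_mono mult_left_mono) auto
    also have "\<dots> = \<eta> + (1 - \<alpha>) * (P * X) + \<kappa> * \<eta>" using \<eta> by (simp add: field_simps)
    finally show ?thesis .
  qed
  have p1: "0 < P + \<kappa> * \<eta>" using P0 \<kappa> \<eta> by (simp add: add_pos_nonneg)
  have p2: "0 < 1 - \<beta>" using \<beta> by simp
  have "ln ((1 - \<beta>) * (y * (P + \<kappa> * \<eta>))) \<le> ln (\<eta> + (1 - \<alpha>) * (P * X) + \<kappa> * \<eta>)"
    using main p1 p2 y0 by (simp add: ln_mono)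
  moreover have "ln ((1 - \<beta>) * (y * (P + \<kappa> * \<eta>))) = ln (1 - \<beta>) + (x * Y - hgap x) + ln (P + \<kappa> * \<eta>)"
    using p1 p2 y0 by (simp add: ln_mult y_def)
  ultimately show ?thesis by (simp add: X_def Y_def)
qed

text \<open>The weight of the new comparator is not linked to \<open>P\<close>; it is only known to
  be at least \<open>\<eta> * (1 + d / W)\<close>. A large excess loss is expensive, but it also
  makes \<open>W\<close> small and thus raises this floor. \<open>ln C + y\<close> is the gain of a
  switch: \<open>y\<close> places the point of tangency at 1 + y, and \<mu> is the geometric mean
  that balances the terms in \<open>w\<close> and 1 / \<open>w\<close>.\<close>

lemma potential_switch:
  fixes x \<eta> \<kappa> d y \<mu> C E W a P :: real
  defines "e \<equiv> exp (- x)" and "q \<equiv> 1 - exp (- x)"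
  assumes x: "0 < x" and \<eta>: "0 < \<eta>" and \<kappa>: "0 \<le> \<kappa>" and d: "0 \<le> d"
    and y: "0 \<le> y" "y \<le> 1" "y * (x * (1 + \<kappa> * \<eta>)) \<le> 1" and \<mu>: "0 \<le> \<mu>" and C: "0 < C" "\<mu>\<^sup>2 * slope x \<le> C * y * d"
      "C * ((1 + y)\<^sup>2 + y * e / slope x) \<le> 1 + \<kappa> + 2 * \<mu>"
    and a: "0 \<le> a" "a \<le> 1" and E: "0 \<le> E" and W: "0 < W" "W \<le> 1 - q * E" and P: "0 < P" "P \<le> 1"
    and EP: "E - a \<le> (1 - a) * (1 - P)"
    and p': "\<eta> * (1 + d / W) \<le> p'"
  shows "x * (E - a) + ln (P + \<kappa> * \<eta>) - ln (p' + \<kappa> * \<eta>)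
         \<le> x - 1 - ln x + x * \<kappa> * \<eta> - (ln C + y) - ln \<eta>"
proof -
  define Y where "Y = max 0 (E - a)"
  have e: "0 < e" "e < 1" using x by (auto simp: e_def)
  have q: "0 < q" "q = 1 - e" using e by (auto simp: q_def e_def)
  define u where "u = slope x"
  have u: "0 < u" "x * u = q" using x slope_pos[OF x] by (auto simp: u_def slope_def q_def)
  have "(1 - a) * (1 - P) \<le> 1 * (1 - P)" using a P by (intro mult_right_mono) auto
  with EP P have PY: "P \<le> 1 - Y" by (auto simp: Y_def)
  have YE: "Y \<le> E" using E a by (simp add: Y_def)
  have EY: "x * (E - a) \<le> x * Y" using x by (intro mult_left_mono) (auto simp: Y_def)
  define \<psi> where "\<psi> = x * (1 - Y + \<kappa> * \<eta>)"
  have b0: "0 < 1 - Y + \<kappa> * \<eta>" using PY P \<kappa> \<eta> by (simp add: add_pos_nonneg)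
  then have \<psi>0: "0 < \<psi>" using x by (simp add: \<psi>_def)
  have WY: "W \<le> 1 - q * Y"
    using W mult_left_mono[OF YE, of q] q by linarith
  have "ln (P + \<kappa> * \<eta>) \<le> ln (1 - Y + \<kappa> * \<eta>)"
    using PY P \<kappa> \<eta> by (subst ln_le_cancel_iff) (auto intro: add_pos_nonneg b0)
  moreover have "ln \<psi> = ln x + ln (1 - Y + \<kappa> * \<eta>)" using x b0 by (simp add: \<psi>_def ln_mult)
  ultimately have 1: "x * (E - a) + ln (P + \<kappa> * \<eta>) \<le> x + x * \<kappa> * \<eta> - ln x + (ln \<psi> - \<psi>)"
    using EY by (simp add: \<psi>_def algebra_simps)
  have kd: "0 < 1 + \<kappa> + d / W" using \<kappa> d W by (simp add: add_pos_nonneg)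
  have "ln (\<eta> * (1 + \<kappa> + d / W)) \<le> ln (p' + \<kappa> * \<eta>)"
    using p' mult_pos_pos[OF \<eta> kd] by (intro ln_mono) (simp_all add: algebra_simps)
  then have 2: "ln \<eta> + ln (1 + \<kappa> + d / W) \<le> ln (p' + \<kappa> * \<eta>)" using \<eta> kd by (simp add: ln_mult)
  define \<theta> where "\<theta> = x * (1 - Y)"
  define w where "w = e + u * \<theta>"
  have \<theta>: "0 < \<theta>" using x PY P by (simp add: \<theta>_def)
  have \<theta>\<psi>: "\<theta> \<le> \<psi>" using x \<kappa> \<eta> by (simp add: \<theta>_def \<psi>_def algebra_simps)
  have "u * \<theta> = q * (1 - Y)" by (simp add: \<theta>_def mult.commute mult.left_commute flip: u(2))
  then have Ww: "W \<le> w" using WY q by (simp add: w_def algebra_simps)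
  have w: "0 < w" using W Ww by linarith
  have tangent: "\<psi> * exp (1 - \<psi>) \<le> exp (- y) * ((1 + y)\<^sup>2 - y * \<theta>)"
  proof -
    have "\<psi> * exp (1 - \<psi>) \<le> exp (- y) * ((1 + y)\<^sup>2 - y * \<psi>)"
    proof (rule xexp_le_tangent')
      have "0 \<le> Y" by (simp add: Y_def)
      then have "\<psi> \<le> x * (1 + \<kappa> * \<eta>)" using x by (auto simp: \<psi>_def)
      then have "y * \<psi> \<le> y * (x * (1 + \<kappa> * \<eta>))" using y by (intro mult_left_mono) auto
      then show "y * \<psi> \<le> 1" using y by simp
    qed (use y in auto)
    also have "\<dots> \<le> exp (- y) * ((1 + y)\<^sup>2 - y * \<theta>)"
      using y \<theta>\<psi> by (intro mult_left_mono) (auto intro: mult_left_mono)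
    finally show ?thesis .
  qed
  have "C * ((1 + y)\<^sup>2 - y * \<theta>) \<le> 1 + \<kappa> + d / w"
  proof -
    \<comment> \<open>The inequality between arithmetic and geometric mean: the product of the two
      summands is C * y * d / u, which is at least \<mu>^2. For y = 0 the hypothesis forces \<mu> =
      0.\<close>
    have "2 * \<mu> \<le> C * y / u * w + d / w"
    proof -
      have "2 * \<mu> * (u * w) \<le> C * y * w\<^sup>2 + d * u"
      proof (cases "y = 0")
        case True
        with C(2) u have "\<mu> = 0" by (simp add: u_def mult_le_0_iff)
        then show ?thesis using True d u by simp
      next
        case False
        then have cy: "0 < C * y" using C y by simp
        have "0 \<le> (C * y * w - \<mu> * u)\<^sup>2" by simp
        also have "\<dots> = C * y * (C * y * w\<^sup>2 - 2 * \<mu> * (u * w)) + u * (\<mu>\<^sup>2 * u)"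
          by (simp add: power2_eq_square algebra_simps)
        also have "u * (\<mu>\<^sup>2 * u) \<le> u * (C * y * d)"
          using C(2) u by (intro mult_left_mono) (auto simp: u_def)
        finally have "0 \<le> C * y * (C * y * w\<^sup>2 - 2 * \<mu> * (u * w) + d * u)" by (simp add: algebra_simps)
        then show ?thesis using cy by (simp add: zero_le_mult_iff)
      qed
      then have "2 * \<mu> * (u * w) / (u * w) \<le> (C * y * w\<^sup>2 + d * u) / (u * w)"
        using u w by (intro divide_right_mono) auto
      then show ?thesis using u w by (simp add: add_divide_distrib power2_eq_square)
    qed
    moreover have "C * y / u * w = C * (y * e / u) + C * y * \<theta>"
      using u by (simp add: w_def field_simps)
    ultimately show ?thesis using C(3) by (simp add: algebra_simps u_def)
  qed
  also have "d / w \<le> d / W" using d W Ww w by (intro divide_left_mono) auto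
  finally have "C * ((1 + y)\<^sup>2 - y * \<theta>) \<le> 1 + \<kappa> + d / W" by simp
  then have "exp (- y) * (C * ((1 + y)\<^sup>2 - y * \<theta>)) \<le> exp (- y) * (1 + \<kappa> + d / W)"
    by (intro mult_left_mono) auto
  moreover have "C * (\<psi> * exp (1 - \<psi>)) \<le> C * (exp (- y) * ((1 + y)\<^sup>2 - y * \<theta>))"
    using C tangent by (intro mult_left_mono) auto
  moreover have "C * (exp (- y) * ((1 + y)\<^sup>2 - y * \<theta>)) = exp (- y) * (C * ((1 + y)\<^sup>2 - y * \<theta>))"
    by simp
  ultimately have "C * (\<psi> * exp (1 - \<psi>)) \<le> exp (- y) * (1 + \<kappa> + d / W)" by linarith
  then have "ln (C * (\<psi> * exp (1 - \<psi>))) \<le> ln (exp (- y) * (1 + \<kappa> + d / W))"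
    using C \<psi>0 by (intro ln_mono) auto
  then have "ln C + ln \<psi> + (1 - \<psi>) \<le> - y + ln (1 + \<kappa> + d / W)"
    using C \<psi>0 kd by (simp add: ln_mult)
  with 1 2 show ?thesis by linarith
qed

text \<open>Maximises x * (1 - P) + ln (P + \<kappa> \<eta>) over \<open>P\<close>: in ln z \<le> z
  - 1 with z = x * (P + \<kappa> \<eta>) the two occurrences of x * P cancel.\<close>

lemma potential_end:
  fixes x \<eta> \<kappa> E a P :: real
  assumes x: "0 < x" and \<eta>: "0 < \<eta>" and \<kappa>: "0 \<le> \<kappa>" and a: "0 \<le> a" "a \<le> 1" and P: "0 < P" "P \<le> 1"
    and EP: "E - a \<le> (1 - a) * (1 - P)"
  shows "x * (E - a) + ln (P + \<kappa> * \<eta>) \<le> x - 1 - ln x + x * \<kappa> * \<eta>"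
proof -
  have "(1 - a) * (1 - P) \<le> 1 * (1 - P)" using a P by (intro mult_right_mono) auto
  with EP have "x * (E - a) \<le> x * (1 - P)" using x by (intro mult_left_mono) auto
  moreover have p: "0 < P + \<kappa> * \<eta>" using P \<kappa> \<eta> by (simp add: add_pos_nonneg)
  then have "ln (x * (P + \<kappa> * \<eta>)) \<le> x * (P + \<kappa> * \<eta>) - 1" using x by (intro ln_le_minus_one) auto
  moreover have "ln (x * (P + \<kappa> * \<eta>)) = ln x + ln (P + \<kappa> * \<eta>)"
    using x p by (simp add: ln_mult)
  moreover have "x * (1 - P) = x - x * P" "x * (P + \<kappa> * \<eta>) = x * P + x * \<kappa> * \<eta>"
    by (simp_all add: algebra_simps)
  ultimately show ?thesis by linarith
qed

text \<open>All that the one-step bounds know about an iteration: the convexity bound on the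
  normaliser \<open>W\<close>, the floor \<open>b\<close> under the weight \<open>P\<close> of the
  comparator with loss \<open>a\<close>, and the fact that the mean \<open>E\<close> is largest when
  all the other weight suffers loss 1.\<close>

definition feasible_step :: "real \<Rightarrow> real \<Rightarrow> real \<Rightarrow> real \<Rightarrow> real \<Rightarrow> real \<Rightarrow> bool" where
  "feasible_step x b E W a P \<longleftrightarrow>
     0 < W \<and> W \<le> 1 - (1 - exp (- x)) * E \<and> 0 \<le> E \<and> 0 \<le> a \<and> a \<le> 1 \<and>
     b \<le> P \<and> 0 < P \<and> P \<le> 1 \<and> E - a \<le> (1 - a) * (1 - P)"

text \<open>The tangent of exp at \<open>- x * l\<close>, evaluated at 0 and at \<open>- x\<close>,
  lies below exp; averaging the two inequalities with weights \<open>1 - l\<close> and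
  \<open>l\<close> gives back the value at the point of tangency.\<close>

lemma exp_neg_le_chord:
  fixes x l :: real assumes "0 \<le> l" "l \<le> 1"
  shows "exp (- x * l) \<le> 1 - (1 - exp (- x)) * l"
proof -
  define r where "r = exp (- x * l)"
  have "r * (1 + x * l) \<le> r * exp (x * l)" "r * (1 + (x * l - x)) \<le> r * exp (x * l - x)"
    unfolding r_def by (intro mult_left_mono exp_ge_add_one_self; simp)+
  moreover have "r * exp (x * l) = 1" "r * exp (x * l - x) = exp (- x)"
    by (simp_all add: r_def flip: exp_add)
  ultimately have "(1 - l) * (r * (1 + x * l)) + l * (r * (1 + (x * l - x))) \<le> (1 - l) * 1 + l * exp (- x)"
    using assms by (intro add_mono mult_left_mono) auto
  moreover have "(1 - l) * (r * (1 + x * l)) + l * (r * (1 + (x * l - x))) = r"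
    by (simp add: algebra_simps)
  ultimately show ?thesis by (simp add: r_def algebra_simps)
qed

section \<open>Telescoping the potential\<close>

text \<open>Pure bookkeeping: the costs \<rho> of a step without a switch, \<sigma> of a step with
  one and \<omega> of the last step, which has no successor weight, stay abstract. Hence the same
  summation serves the three regimes of x and \<alpha> with their different potentials.\<close>

lemma fixed_share_bound:
  fixes p l :: "nat \<Rightarrow> 's \<Rightarrow> real" and c :: "nat \<Rightarrow> 's" and A :: "'s set"
    and x \<alpha> \<eta> \<kappa> D \<rho> \<sigma> \<omega> :: real
  defines "W \<equiv> \<lambda>t. \<Sum>s\<in>A. p t s * exp (- x * l t s)" and "E \<equiv> \<lambda>t. \<Sum>s\<in>A. p t s * l t s"
  assumes A: "finite A" "A \<noteq> {}" and x: "0 < x" and \<alpha>: "0 \<le> \<alpha>" "\<alpha> < 1"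
    and \<eta>: "\<eta> = \<alpha> / card A" and D: "D = 1 / (1 - (1 - \<alpha>) * exp (- x))" and \<kappa>: "0 \<le> \<kappa>"
    and T: "1 \<le> T"
    and p1: "\<And>s. s \<in> A \<Longrightarrow> p 1 s = 1 / card A"
    and step: "\<And>t s. t \<in> {1..<T} \<Longrightarrow> s \<in> A \<Longrightarrow>
      p (Suc t) s = \<eta> + (1 - \<alpha>) * (p t s * exp (- x * l t s) / W t)"
    and l: "\<And>t s. t \<in> {1..T} \<Longrightarrow> s \<in> A \<Longrightarrow> 0 \<le> l t s \<and> l t s \<le> 1"
    and c: "\<And>t. t \<in> {1..T} \<Longrightarrow> c t \<in> A"
    and K: "card {t \<in> {1..T - 1}. c (t + 1) \<noteq> c t} \<le> K" "K \<le> T - 1"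
    and stay: "\<And>E W a P. feasible_step x (D * \<eta>) E W a P \<Longrightarrow>
      x * (E - a) + ln (P + \<kappa> * \<eta>) - ln (\<eta> + (1 - \<alpha>) * (P * exp (- x * a) / W) + \<kappa> * \<eta>) \<le> \<rho>"
    and switch: "\<And>E W a P p'. 0 < K \<Longrightarrow> feasible_step x (D * \<eta>) E W a P \<Longrightarrow>
      \<eta> * (1 + (1 - \<alpha>) * D * exp (- x) / W) \<le> p' \<Longrightarrow>
      x * (E - a) + ln (P + \<kappa> * \<eta>) - ln (p' + \<kappa> * \<eta>) \<le> \<sigma>"
    and last: "\<And>E W a P. feasible_step x (D * \<eta>) E W a P \<Longrightarrow>
      x * (E - a) + ln (P + \<kappa> * \<eta>) \<le> \<omega>"
  shows "x * ((\<Sum>t = 1..T. E t) - (\<Sum>t = 1..T. l t (c t)))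
         \<le> - ln (1 / card A + \<kappa> * \<eta>) + (real T - 1 - real K) * \<rho> + real K * \<sigma> + \<omega>"
proof -
  define m where "m = real (card A)"
  have m: "0 < m" using A by (simp add: m_def card_gt_0_iff)
  have \<eta>0: "0 \<le> \<eta>" using \<alpha> m by (simp add: \<eta> flip: m_def)
  define e where "e = exp (- x)"
  have e: "0 < e" "e < 1" using x by (auto simp: e_def)
  have ae: "(1 - \<alpha>) * e < 1" 
  proof -
    have "(1 - \<alpha>) * e \<le> 1 * e" using \<alpha> e by (intro mult_right_mono) auto
    then show ?thesis using e by linarith
  qed
  have D0: "0 < D" using ae by (simp add: D flip: e_def)
  \<comment> \<open>\<open>D\<close> is the fixed point of the floor, in units of \<eta>, under one
    update: the fresh share plus the old floor after the worst factor (1 - \<alpha>) * exp (-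
    x).\<close>
  have Deq: "1 + (1 - \<alpha>) * D * e = D"
    using ae by (simp add: D field_simps flip: e_def)
  have D\<alpha>: "D * \<alpha> \<le> 1"
  proof -
    have "0 \<le> (1 - \<alpha>) * (1 - e)" using \<alpha> e by simp
    then have "\<alpha> \<le> 1 - (1 - \<alpha>) * e" by (simp add: algebra_simps)
    then show ?thesis using ae by (simp add: D field_simps flip: e_def)
  qed
  \<comment> \<open>Positivity is carried along separately, because the floor
    \<open>D * \<eta>\<close> vanishes for \<alpha> = 0.\<close>
  have pt: "(\<forall>s\<in>A. 0 < p t s \<and> D * \<eta> \<le> p t s) \<and> (\<Sum>s\<in>A. p t s) = 1" if "t \<in> {1..T}" for t
    using that
  proof (induction t rule: nat_induct)
    case (Suc t)
    show ?case
    proof (cases "t = 0")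
      case True
      have "D * \<eta> \<le> 1 / m" using D\<alpha> m by (simp add: \<eta> field_simps flip: m_def)
      then show ?thesis using True p1 m A by (simp add: m_def)
    next
      case False
      with Suc have t: "t \<in> {1..T}" "t \<in> {1..<T}" by auto
      have IH: "\<And>s. s \<in> A \<Longrightarrow> 0 < p t s" "\<And>s. s \<in> A \<Longrightarrow> D * \<eta> \<le> p t s" "(\<Sum>s\<in>A. p t s) = 1"
        using Suc t by auto
      have W0: "0 < W t" unfolding W_def using A IH by (intro sum_pos) auto
      have "W t \<le> (\<Sum>s\<in>A. p t s * 1)" unfolding W_def using IH l[OF t(1)] x
        by (intro sum_mono mult_left_mono) (auto intro: less_imp_le)
      then have W1: "W t \<le> 1" using IH by simp
      have pS: "p (Suc t) s = \<eta> + (1 - \<alpha>) * (p t s * exp (- x * l t s) / W t)" if "s \<in> A" for s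
        using step[OF t(2) that] .
      have "0 < p (Suc t) s \<and> D * \<eta> \<le> p (Suc t) s" if s: "s \<in> A" for s
      proof -
        have pos: "0 < (1 - \<alpha>) * (p t s * exp (- x * l t s) / W t)" using \<alpha> IH(1)[OF s] W0 by simp
        have "exp (- x * 1) \<le> exp (- x * l t s)" using l[OF t(1) s] x by simp
        then have "D * \<eta> * e \<le> p t s * exp (- x * l t s)"
          using IH(1,2)[OF s] D0 \<eta>0 e by (intro mult_mono) (auto simp: e_def)
        moreover have "p t s * exp (- x * l t s) \<le> p t s * exp (- x * l t s) / W t"
          using W0 W1 IH(1)[OF s] by (simp add: le_divide_eq mult_left_le)
        ultimately have "(1 - \<alpha>) * (D * \<eta> * e) \<le> (1 - \<alpha>) * (p t s * exp (- x * l t s) / W t)"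
          using \<alpha> by (intro mult_left_mono) auto
        moreover have "D * \<eta> = \<eta> + (1 - \<alpha>) * (D * \<eta> * e)"
          by (subst Deq[symmetric]) (simp add: algebra_simps)
        ultimately show ?thesis using pS[OF s] pos \<eta>0 by simp
      qed
      moreover have "(\<Sum>s\<in>A. p (Suc t) s) = 1"
      proof -
        have "(\<Sum>s\<in>A. p (Suc t) s) = m * \<eta> + (1 - \<alpha>) * (W t / W t)"
          by (simp add: pS sum.distrib m_def W_def flip: sum_distrib_left sum_divide_distrib)
        then show ?thesis using W0 m by (simp add: \<eta> flip: m_def)
      qed
      ultimately show ?thesis by blast
    qed
  qed simp
  have feas: "feasible_step x (D * \<eta>) (E t) (W t) (l t s) (p t s)" if t: "t \<in> {1..T}" and s: "s \<in> A" for t s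
  proof -
    have P: "\<And>s. s \<in> A \<Longrightarrow> 0 < p t s" "\<And>s. s \<in> A \<Longrightarrow> D * \<eta> \<le> p t s" "(\<Sum>s\<in>A. p t s) = 1"
      using pt[OF t] by auto
    note lt = l[OF t]
    have "0 < W t" unfolding W_def using A P by (intro sum_pos) auto
    moreover have "W t \<le> 1 - (1 - exp (- x)) * E t"
    proof -
      have "W t \<le> (\<Sum>s\<in>A. p t s * (1 - (1 - exp (- x)) * l t s))"
        unfolding W_def using P lt by (intro sum_mono mult_left_mono exp_neg_le_chord) (auto intro: less_imp_le)
      also have "\<dots> = (\<Sum>s\<in>A. p t s) - (1 - exp (- x)) * E t"
        unfolding E_def sum_distrib_left sum_subtractf[symmetric] by (intro sum.cong) (auto simp: algebra_simps)
      finally show ?thesis using P by simp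
    qed
    moreover have "0 \<le> E t" unfolding E_def using P lt by (intro sum_nonneg) (auto intro: less_imp_le mult_nonneg_nonneg)
    moreover have "p t s \<le> 1" 
      using member_le_sum[of s A "p t"] s A P by (auto intro: less_imp_le)
    moreover have "E t - l t s \<le> (1 - l t s) * (1 - p t s)"
    proof -
      have "E t = p t s * l t s + (\<Sum>r\<in>A - {s}. p t r * l t r)"
        unfolding E_def using A s by (intro sum.remove)
      also have "(\<Sum>r\<in>A - {s}. p t r * l t r) \<le> (\<Sum>r\<in>A - {s}. p t r)"
        using P lt by (intro sum_mono) (auto simp: mult_left_le intro: less_imp_le)
      also have "\<dots> = 1 - p t s" using P(3) A s by (simp add: sum_diff1)
      finally show ?thesis by (simp add: algebra_simps)
    qed
    ultimately show ?thesis using P s lt by (simp add: feasible_step_def)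
  qed
  let ?S = "{t \<in> {1..T - 1}. c (t + 1) \<noteq> c t}"
  \<comment> \<open>The set of switches is padded to exactly \<open>K\<close> steps. The bound for a
    switch also holds where the comparator stays, so the padding is sound whichever of \<sigma> and
    \<rho> is larger.\<close>
  have "\<exists>J. ?S \<subseteq> J \<and> J \<subseteq> {1..T - 1} \<and> card J = K"
    by (rule exists_subset_between[OF K(1)]) (use K(2) in auto)
  then obtain J where J: "?S \<subseteq> J" "J \<subseteq> {1..T - 1}" "card J = K" by blast
  define h where "h t = - ln (p t (c t) + \<kappa> * \<eta>)" for t
  define r where "r t = (if t \<in> J then \<sigma> else \<rho>)" for t
  have one: "x * (E t - l t (c t)) \<le> r t + h t - h (Suc t)" if t: "t \<in> {1..T - 1}" for t
  proof -
    have t': "t \<in> {1..T}" "Suc t \<in> {1..T}" "t \<in> {1..<T}" using t T by auto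
    note f = feas[OF t'(1) c[OF t'(1)]]
    show ?thesis
    proof (cases "t \<in> J")
      case True
      then have "0 < K" using J by (metis card_gt_0_iff empty_iff finite_atLeastAtMost finite_subset)
      let ?s = "c (Suc t)"
      have s: "?s \<in> A" using c t' by simp
      have W0: "0 < W t" using f by (simp add: feasible_step_def)
      \<comment> \<open>The new comparator enters with no history that could be used: floor weight
        and the worst possible loss are assumed.\<close>
      have "D * \<eta> * e \<le> p t ?s * exp (- x * l t ?s)"
      proof (rule mult_mono)
        show "D * \<eta> \<le> p t ?s" using pt[OF t'(1)] s by simp
        show "e \<le> exp (- x * l t ?s)" using l[OF t'(1) s] x by (simp add: e_def mult_left_le)
        show "0 \<le> p t ?s" using pt[OF t'(1)] s by (simp add: less_imp_le)
      qed (use e in simp)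
      then have "(1 - \<alpha>) * (D * \<eta> * e / W t) \<le> (1 - \<alpha>) * (p t ?s * exp (- x * l t ?s) / W t)"
        using \<alpha> W0 by (intro mult_left_mono divide_right_mono) auto
      then have "\<eta> * (1 + (1 - \<alpha>) * D * exp (- x) / W t) \<le> p (Suc t) ?s"
        unfolding step[OF t'(3) s] by (simp add: e_def algebra_simps)
      from switch[OF \<open>0 < K\<close> f this] show ?thesis using True by (simp add: r_def h_def)
    next
      case False
      with J t have "c (Suc t) = c t" by auto
      with stay[OF f] step[OF t'(3) c[OF t'(1)]] False show ?thesis
        by (simp add: r_def h_def)
    qed
  qed
  have "x * (\<Sum>t = 1..N. E t - l t (c t)) \<le> (\<Sum>t = 1..N. r t) + h 1 - h (Suc N)" if "N \<le> T - 1" for N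
    using that
  proof (induction N)
    case (Suc N)
    then show ?case using one[of "Suc N"] by (simp add: distrib_left)
  qed simp
  from this[of "T - 1"] T
  have 1: "x * (\<Sum>t = 1..T - 1. E t - l t (c t)) \<le> (\<Sum>t = 1..T - 1. r t) + h 1 - h T" by simp
  have "(\<Sum>t = 1..T - 1. r t) = real K * \<sigma> + (real T - 1 - real K) * \<rho>"
  proof -
    have "(\<Sum>t = 1..T - 1. r t) = (\<Sum>t\<in>{1..T - 1} \<inter> J. \<sigma>) + (\<Sum>t\<in>{1..T - 1} - J. \<rho>)"
      unfolding r_def by (subst sum.If_cases) (auto simp: Diff_eq)
    moreover have "{1..T - 1} \<inter> J = J" using J by auto
    moreover have "card ({1..T - 1} - J) = T - 1 - K" using J by (simp add: card_Diff_subset finite_subset)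
    ultimately show ?thesis using J K T by (simp add: of_nat_diff)
  qed
  moreover have "x * (E T - l T (c T)) \<le> \<omega> + h T"
    using last[OF feas[of T "c T"]] c T by (simp add: h_def)
  moreover have "(\<Sum>t = 1..T. E t - l t (c t)) = (\<Sum>t = 1..T - 1. E t - l t (c t)) + (E T - l T (c T))"
    using T by (cases T) auto
  moreover have "h 1 = - ln (1 / card A + \<kappa> * \<eta>)" using p1 c T by (simp add: h_def)
  ultimately show ?thesis using 1 by (simp add: sum_subtractf distrib_left)
qed

text \<open>
  The parameters \<open>\<kappa>, \<tau>\<close> shape the potential and its decrease in a step without a switch; the weights are
  split at \<open>r \<eta>\<close>, and \<open>v\<^sub>1, v\<^sub>2, v\<^sub>3\<close> are the points of tangency at \<open>D \<eta>\<close> and on the two sides of the split.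
  The parameters \<open>y, \<mu>, C\<close> bound a step with a switch. The last two conjuncts are the balance of all costs.
\<close>

definition trackable :: "real \<Rightarrow> real \<Rightarrow> real \<Rightarrow> bool" where
  "trackable x \<alpha> \<eta> \<longleftrightarrow> (\<exists>\<kappa> \<tau> \<beta> r v\<^sub>1 v\<^sub>2 v\<^sub>3 y \<mu> C.
     let e = exp (- x); q = 1 - e; D = 1 / (1 - (1 - \<alpha>) * e); d = (1 - \<alpha>) * D * e in
     0 \<le> \<kappa> \<and> 0 \<le> \<tau> \<and> \<tau> \<le> 1 \<and> \<beta> = \<alpha> - \<tau> * \<eta> \<and> \<beta> < 1 \<and> 0 \<le> \<beta> \<and> 0 \<le> r \<and>
     0 < v\<^sub>1 \<and> v\<^sub>1 < 1 \<and> 0 < v\<^sub>2 \<and> v\<^sub>2 < 1 \<and> 0 < v\<^sub>3 \<and> v\<^sub>3 < 1 \<and>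
     (D \<le> r \<longrightarrow> tangent_bound v\<^sub>1 ((1 - \<alpha>) * D + (1 - \<beta>) * \<kappa> + \<tau> * D * \<eta>)
                ((1 - \<alpha>) * D) ((1 + \<kappa>) * slope x)) \<and>
     (D \<le> r \<longrightarrow> tangent_bound v\<^sub>2 ((1 - \<alpha>) * r + (1 - \<beta>) * \<kappa> + \<tau> * r * \<eta>)
                ((1 - \<alpha>) * r) ((1 + \<kappa>) * slope x)) \<and>
     tangent_bound v\<^sub>3 ((1 - \<alpha>) * r + (1 - \<beta>) * \<kappa>)
                ((1 - \<alpha>) * r + \<tau> * e / q) ((1 + \<kappa> - \<tau> / q) * slope x) \<and>
     0 \<le> y \<and> y \<le> 1 \<and> y * (x * (1 + \<kappa> * \<eta>)) \<le> 1 \<and> 0 \<le> \<mu> \<and> 0 < C \<and> \<mu>\<^sup>2 * slope x \<le> C * y * d \<and>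
     C * ((1 + y)\<^sup>2 + y * e / slope x) \<le> 1 + \<kappa> + 2 * \<mu> \<and>
     x - 1 - ln x + x * \<kappa> * \<eta> \<le> x\<^sup>2 / 8 \<and>
     (1 - \<alpha>) * (hgap x - ln (1 - \<beta>) - x\<^sup>2 / 8)
       \<le> \<alpha> * (x\<^sup>2 / 8 - (x - 1 - ln x + x * \<kappa> * \<eta> - (ln C + y))))"

text \<open>Since K = \<alpha> * (T - 1), switches and other steps occur in the ratio \<alpha> to 1
  - \<alpha>. The last conjunct of \<open>trackable\<close>, multiplied by T - 1, therefore balances
  all of them at once, and the conjunct before it pays for the final step out of the one x^2 / 8
  that is left. Only \<open>- ln \<eta>\<close> per switch remains visible.\<close>

lemma fixed_share_trackable:
  fixes p l :: "nat \<Rightarrow> 's \<Rightarrow> real" and c :: "nat \<Rightarrow> 's" and A :: "'s set" and x \<alpha> \<eta> :: real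
  defines "W \<equiv> \<lambda>t. \<Sum>s\<in>A. p t s * exp (- x * l t s)" and "E \<equiv> \<lambda>t. \<Sum>s\<in>A. p t s * l t s"
  assumes A: "finite A" "A \<noteq> {}" and x: "0 < x" and \<alpha>: "0 < \<alpha>" "\<alpha> < 1"
    and \<eta>: "\<eta> = \<alpha> / card A" and T: "1 \<le> T"
    and p1: "\<And>s. s \<in> A \<Longrightarrow> p 1 s = 1 / card A"
    and step: "\<And>t s. t \<in> {1..<T} \<Longrightarrow> s \<in> A \<Longrightarrow>
      p (Suc t) s = \<eta> + (1 - \<alpha>) * (p t s * exp (- x * l t s) / W t)"
    and l: "\<And>t s. t \<in> {1..T} \<Longrightarrow> s \<in> A \<Longrightarrow> 0 \<le> l t s \<and> l t s \<le> 1"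
    and c: "\<And>t. t \<in> {1..T} \<Longrightarrow> c t \<in> A"
    and K: "card {t \<in> {1..T - 1}. c (t + 1) \<noteq> c t} \<le> K" "real K = \<alpha> * (real T - 1)"
    and tr: "trackable x \<alpha> \<eta>"
  shows "x * ((\<Sum>t = 1..T. E t) - (\<Sum>t = 1..T. l t (c t)))
         \<le> ln (card A) - real K * ln \<eta> + real T * x\<^sup>2 / 8"
proof -
  define e where "e = exp (- x)"
  define D where "D = 1 / (1 - (1 - \<alpha>) * e)"
  define d where "d = (1 - \<alpha>) * D * e"
  from tr[unfolded trackable_def Let_def, folded e_def, folded D_def, folded d_def]
  obtain \<kappa> \<tau> \<beta> r v\<^sub>1 v\<^sub>2 v\<^sub>3 y \<mu> C where
    \<kappa>: "0 \<le> \<kappa>" and \<tau>: "0 \<le> \<tau>" "\<tau> \<le> 1" and \<beta>: "\<beta> = \<alpha> - \<tau> * \<eta>" "\<beta> < 1" "0 \<le> \<beta>" and r: "0 \<le> r"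
    and v: "0 < v\<^sub>1" "v\<^sub>1 < 1" "0 < v\<^sub>2" "v\<^sub>2 < 1" "0 < v\<^sub>3" "v\<^sub>3 < 1"
    and tb: "D \<le> r \<longrightarrow> tangent_bound v\<^sub>1 ((1 - \<alpha>) * D + (1 - \<beta>) * \<kappa> + \<tau> * D * \<eta>)
                ((1 - \<alpha>) * D) ((1 + \<kappa>) * slope x)"
      "D \<le> r \<longrightarrow> tangent_bound v\<^sub>2 ((1 - \<alpha>) * r + (1 - \<beta>) * \<kappa> + \<tau> * r * \<eta>)
                ((1 - \<alpha>) * r) ((1 + \<kappa>) * slope x)"
      "tangent_bound v\<^sub>3 ((1 - \<alpha>) * r + (1 - \<beta>) * \<kappa>)
                ((1 - \<alpha>) * r + \<tau> * e / (1 - e)) ((1 + \<kappa> - \<tau> / (1 - e)) * slope x)"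
    and y: "0 \<le> y" "y \<le> 1" "y * (x * (1 + \<kappa> * \<eta>)) \<le> 1" and \<mu>: "0 \<le> \<mu>"
    and C: "0 < C" "\<mu>\<^sup>2 * slope x \<le> C * y * d" "C * ((1 + y)\<^sup>2 + y * e / slope x) \<le> 1 + \<kappa> + 2 * \<mu>"
    and last: "x - 1 - ln x + x * \<kappa> * \<eta> \<le> x\<^sup>2 / 8"
    and fin: "(1 - \<alpha>) * (hgap x - ln (1 - \<beta>) - x\<^sup>2 / 8)
       \<le> \<alpha> * (x\<^sup>2 / 8 - (x - 1 - ln x + x * \<kappa> * \<eta> - (ln C + y)))"
    apply (elim exE conjE)
    subgoal for \<kappa> \<tau> \<beta> r v\<^sub>1 v\<^sub>2 v\<^sub>3 y \<mu> C
      by (rule that[of \<kappa> \<tau> \<beta> r v\<^sub>1 v\<^sub>2 v\<^sub>3 y \<mu> C])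
    done
  have m: "0 < real (card A)" using A by (simp add: card_gt_0_iff)
  have \<eta>0: "0 < \<eta>" using \<alpha> m by (simp add: \<eta>)
  have ae: "(1 - \<alpha>) * e < 1" 
  proof -
    have "(1 - \<alpha>) * e \<le> 1 * e" using \<alpha> by (intro mult_right_mono) (auto simp: e_def)
    moreover have "e < 1" using x by (simp add: e_def)
    ultimately show ?thesis by linarith
  qed
  have D: "0 < D" using ae by (simp add: D_def)
  have d: "0 \<le> d" using D \<alpha> by (simp add: d_def e_def)
  define \<rho> where "\<rho> = hgap x - ln (1 - \<beta>)"
  define S where "S = x - 1 - ln x + x * \<kappa> * \<eta> - (ln C + y)"
  have KT: "real K \<le> real T - 1" 
    using K(2) \<alpha> T by (simp add: mult_left_le_one_le)
  have "x * ((\<Sum>t = 1..T. E t) - (\<Sum>t = 1..T. l t (c t)))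
         \<le> - ln (1 / card A + \<kappa> * \<eta>) + (real T - 1 - real K) * \<rho> + real K * (S - ln \<eta>)
           + (x - 1 - ln x + x * \<kappa> * \<eta>)"
    unfolding E_def
  proof (rule fixed_share_bound[where \<alpha> = \<alpha> and D = D])
    show "D = 1 / (1 - (1 - \<alpha>) * exp (- x))" by (simp add: D_def e_def)
    show "K \<le> T - 1" using KT T by linarith
    fix E W a P assume f: "feasible_step x (D * \<eta>) E W a P"
    show "x * (E - a) + ln (P + \<kappa> * \<eta>)
          - ln (\<eta> + (1 - \<alpha>) * (P * exp (- x * a) / W) + \<kappa> * \<eta>) \<le> \<rho>"
      unfolding \<rho>_def
      by (rule potential_stay[where \<tau> = \<tau> and r = r and v\<^sub>1 = v\<^sub>1 and v\<^sub>2 = v\<^sub>2 and v\<^sub>3 = v\<^sub>3 and D = D and E = E])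
         (use f x \<alpha> \<eta>0 \<kappa> \<tau> \<beta> v D r tb in \<open>auto simp: feasible_step_def e_def\<close>)
    show "x * (E - a) + ln (P + \<kappa> * \<eta>) \<le> x - 1 - ln x + x * \<kappa> * \<eta>"
      by (rule potential_end) (use f x \<eta>0 \<kappa> in \<open>auto simp: feasible_step_def\<close>)
    fix p' assume "\<eta> * (1 + (1 - \<alpha>) * D * exp (- x) / W) \<le> p'"
    then have p': "\<eta> * (1 + d / W) \<le> p'" by (simp add: d_def e_def)
    show "x * (E - a) + ln (P + \<kappa> * \<eta>) - ln (p' + \<kappa> * \<eta>) \<le> S - ln \<eta>"
      unfolding S_def
      by (rule potential_switch[where \<mu> = \<mu> and E = E, OF x \<eta>0 \<kappa> d y \<mu> C(1,2) _ _ _ _ _ _ _ _ _ p'])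
         (use f C in \<open>auto simp: feasible_step_def e_def\<close>)
  qed (use A x \<alpha> \<eta> \<kappa> T p1 step l c K in \<open>auto simp: W_def\<close>)
  moreover have "- ln (1 / card A + \<kappa> * \<eta>) \<le> ln (card A)"
  proof -
    have "ln (1 / card A) \<le> ln (1 / card A + \<kappa> * \<eta>)" using m \<kappa> \<eta>0 by (intro ln_mono) auto
    then show ?thesis using m by (simp add: ln_div)
  qed
  moreover have "(real T - 1 - real K) * \<rho> + real K * (S - ln \<eta>) \<le> (real T - 1) * (x\<^sup>2 / 8) - real K * ln \<eta>"
  proof -
    define h where "h = x\<^sup>2 / 8"
    have "(real T - 1) * ((1 - \<alpha>) * (\<rho> - h)) \<le> (real T - 1) * (\<alpha> * (h - S))"
      using fin T by (intro mult_left_mono) (auto simp: \<rho>_def S_def h_def)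
    then show ?thesis unfolding K(2) h_def[symmetric] by (simp add: algebra_simps)
  qed
  moreover have "(real T - 1) * (x\<^sup>2 / 8) = real T * x\<^sup>2 / 8 - x\<^sup>2 / 8" by (simp add: left_diff_distrib)
  ultimately show ?thesis using last by linarith
qed

section \<open>Rational bounds and monotonicity for exp and ln\<close>

text \<open>Taylor's polynomial of degree 5 with last coefficient 1/100 instead of 1/120; the
  surplus covers the entire tail on [0, 1].\<close>

definition exp_poly :: "real \<Rightarrow> real" where
  "exp_poly h = 1 + h + h\<^sup>2 / 2 + h ^ 3 / 6 + h ^ 4 / 24 + h ^ 5 / 100"

lemma exp_le_exp_poly:
  assumes "0 \<le> h" "h \<le> 1" shows "exp h \<le> exp_poly h"
proof -
  obtain t where t: "\<bar>t\<bar> \<le> \<bar>h\<bar>" "exp h = (\<Sum>m<8. h ^ m / fact m) + exp t / fact 8 * h ^ 8"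
    using Maclaurin_exp_le[of h 8] by blast
  have "exp t \<le> 3" using t(1) assms exp_le by (smt (verit) exp_le_cancel_iff)
  then have "exp t / 40320 * h ^ 8 \<le> 3 / 40320 * h ^ 8"
    using assms by (intro mult_right_mono divide_right_mono) auto
  moreover have "h ^ 6 \<le> h ^ 5" "h ^ 7 \<le> h ^ 5" "h ^ 8 \<le> h ^ 5"
    using assms by (auto intro!: power_decreasing)
  moreover have "0 \<le> h ^ 5" using assms by simp
  moreover have "(\<Sum>m<8. h ^ m / fact m)
      = 1 + h + h\<^sup>2 / 2 + h ^ 3 / 6 + h ^ 4 / 24 + h ^ 5 / 120 + h ^ 6 / 720 + h ^ 7 / 5040"
    by (simp add: numeral_eq_Suc fact_numeral)
  moreover have "exp h = (\<Sum>m<8. h ^ m / fact m) + exp t / 40320 * h ^ 8"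
    using t(2) by (simp add: fact_numeral)
  ultimately show ?thesis unfolding exp_poly_def by linarith
qed

lemma exp_minus_bounds:
  fixes d :: real
  assumes "0 \<le> d" "d \<le> 1"
  shows "1 - d + d\<^sup>2 / 2 - d ^ 3 / 6 + d ^ 4 / 24 - d ^ 5 / 120 \<le> exp (- d)"
    and "exp (- d) \<le> 1 - d + d\<^sup>2 / 2 - d ^ 3 / 6 + d ^ 4 / 24"
proof -
  obtain t where "exp (- d) = (\<Sum>m<6. (- d) ^ m / fact m) + exp t / fact 6 * (- d) ^ 6"
    using Maclaurin_exp_le[of "- d" 6] by blast
  then show "1 - d + d\<^sup>2 / 2 - d ^ 3 / 6 + d ^ 4 / 24 - d ^ 5 / 120 \<le> exp (- d)"
    using assms by (simp add: numeral_eq_Suc fact_numeral)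
  obtain t where "exp (- d) = (\<Sum>m<5. (- d) ^ m / fact m) + exp t / fact 5 * (- d) ^ 5"
    using Maclaurin_exp_le[of "- d" 5] by blast
  then show "exp (- d) \<le> 1 - d + d\<^sup>2 / 2 - d ^ 3 / 6 + d ^ 4 / 24"
    using assms by (simp add: numeral_eq_Suc fact_numeral)
qed

text \<open>\<open>slope\<close> is the slope of the chord of the concave function 1 - exp (- t)
  that starts at 0.\<close>

lemma slope_antimono:
  assumes "0 < x" "x \<le> x'" shows "slope x' \<le> slope x"
proof -
  have "exp (- x' * (x / x')) \<le> 1 - (1 - exp (- x')) * (x / x')"
    using assms by (intro exp_neg_le_chord) auto
  then show ?thesis using assms by (simp add: slope_def field_simps)
qed

text \<open>Both sides have the form x / (exp x - 1), the reciprocal of the slope of a chord of exp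
  starting at 0, which increases by convexity.\<close>

lemma exp_div_slope_antimono:
  assumes "0 < x" "x \<le> x'" shows "exp (- x') / slope x' \<le> x * exp (- x) / (1 - exp (- x))"
proof -
  have "exp (- (- x') * (x / x')) \<le> 1 - (1 - exp (- (- x'))) * (x / x')"
    using assms by (intro exp_neg_le_chord) auto
  then have 1: "x' * (exp x - 1) \<le> x * (exp x' - 1)"
    using assms by (simp add: field_simps)
  have "exp (- z) / (1 - exp (- z)) = 1 / (exp z - 1)" if "0 < z" for z :: real
    using that by (simp add: exp_minus field_simps)
  from this[of x] this[of x'] assms
  have "exp (- x) / (1 - exp (- x)) = 1 / (exp x - 1)"
    "exp (- x') / (1 - exp (- x')) = 1 / (exp x' - 1)" by auto
  moreover have "exp (- x') / slope x' = x' * (exp (- x') / (1 - exp (- x')))"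
    by (simp add: slope_def)
  moreover have "x * exp (- x) / (1 - exp (- x)) = x * (exp (- x) / (1 - exp (- x)))" by simp
  ultimately have 2: "exp (- x') / slope x' = x' / (exp x' - 1)"
    "x * exp (- x) / (1 - exp (- x)) = x / (exp x - 1)" by simp_all
  have "0 < exp x - 1" "0 < exp x' - 1" using assms by auto
  then show ?thesis unfolding 2 using 1 by (simp add: divide_le_eq pos_le_divide_eq mult.commute)
qed

text \<open>The derivative is the square (t / 2 - 1)^2 over \<open>t\<close>. The expression is the
  budget x^2 / 8 minus the cost of the final step for \<kappa> = 0; on an interval of
  \<open>x\<close> it is smallest at the left end.\<close>

lemma ln_quad_mono:
  fixes x x' :: real
  assumes "0 < x" "x \<le> x'"
  shows "x\<^sup>2 / 8 - x + 1 + ln x \<le> x'\<^sup>2 / 8 - x' + 1 + ln x'"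
proof (rule DERIV_nonneg_imp_nondecreasing[OF assms(2)])
  fix t assume "x \<le> t"
  with assms have t: "0 < t" by simp
  have "((\<lambda>x. x\<^sup>2 / 8 - x + 1 + ln x) has_real_derivative (t / 2 - 1)\<^sup>2 / t) (at t)"
    using t by (auto intro!: derivative_eq_intros simp: field_simps power2_eq_square)
  then show "\<exists>d. ((\<lambda>x. x\<^sup>2 / 8 - x + 1 + ln x) has_real_derivative d) (at t) \<and> 0 \<le> d"
    using t by (intro exI conjI) auto
qed

lemma exp_times_square_le_1:
  fixes v :: real assumes "0 \<le> v" "v \<le> 1" shows "exp v * (1 - v)\<^sup>2 \<le> 1"
proof -
  have "(1 - v) * exp v \<le> 1" 
    using xexp_le_one[of "1 - v"] by simp
  then have "(1 - v) * ((1 - v) * exp v) \<le> 1 * 1" using assms by (intro mult_mono) auto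
  then show ?thesis by (simp add: power2_eq_square mult_ac)
qed

lemma ln_ge_pade:
  fixes x :: real assumes "1 \<le> x" shows "2 * (x - 1) / (x + 1) \<le> ln x"
proof -
  have "ln 1 - 2 * (1 - 1) / (1 + 1) \<le> ln x - 2 * (x - 1) / (x + 1)"
  proof (rule DERIV_nonneg_imp_nondecreasing[OF assms, of "\<lambda>x. ln x - 2 * (x - 1) / (x + 1)"])
    fix t :: real assume t: "1 \<le> t"
    have "((\<lambda>x. ln x - 2 * (x - 1) / (x + 1)) has_real_derivative 1 / t - 4 / (t + 1)\<^sup>2) (at t)"
      using t by (auto intro!: derivative_eq_intros simp: power2_eq_square algebra_simps)
    moreover have "0 \<le> (t - 1)\<^sup>2" by simp
    then have "4 * t \<le> (t + 1)\<^sup>2" by (simp add: power2_eq_square algebra_simps)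
    then have "4 / (t + 1)\<^sup>2 \<le> 1 / t" using t by (simp add: divide_le_eq pos_le_divide_eq mult.commute)
    ultimately show "\<exists>d. ((\<lambda>x. ln x - 2 * (x - 1) / (x + 1)) has_real_derivative d) (at t) \<and> 0 \<le> d"
      by (intro exI conjI) auto
  qed
  then show ?thesis by simp
qed

text \<open>The [2/1] Pade approximant of ln (1 + t) at 0. The derivative of the difference has the
  numerator 4 s^3, which shows both the sign and the order of the error.\<close>

lemma ln_le_pade:
  fixes t :: real assumes "0 \<le> t" shows "ln (1 + t) \<le> t * (6 + t) / (6 + 4 * t)"
proof -
  have "0 * (6 + 0) / (6 + 4 * 0) - ln (1 + 0) \<le> t * (6 + t) / (6 + 4 * t) - ln (1 + t)"
  proof (rule DERIV_nonneg_imp_nondecreasing[OF assms, of "\<lambda>t. t * (6 + t) / (6 + 4 * t) - ln (1 + t)"])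
    fix s :: real assume s: "0 \<le> s"
    have nz: "6 + 4 * s \<noteq> 0" "1 + s \<noteq> 0" using s by auto
    have "((\<lambda>t. t * (6 + t) / (6 + 4 * t) - ln (1 + t)) has_real_derivative
        ((6 + 2 * s) * (6 + 4 * s) - s * (6 + s) * 4) / ((6 + 4 * s) * (6 + 4 * s)) - 1 / (1 + s)) (at s)"
      using s nz by (auto intro!: derivative_eq_intros simp: algebra_simps)
    moreover have "1 / (1 + s) \<le> ((6 + 2 * s) * (6 + 4 * s) - s * (6 + s) * 4) / ((6 + 4 * s) * (6 + 4 * s))"
    proof (subst frac_le_eq)
      have "1 * ((6 + 4 * s) * (6 + 4 * s)) - ((6 + 2 * s) * (6 + 4 * s) - s * (6 + s) * 4) * (1 + s) = - (4 * s ^ 3)"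
        by (simp add: algebra_simps power3_eq_cube)
      also have "\<dots> \<le> 0" using s by simp
      finally have "1 * ((6 + 4 * s) * (6 + 4 * s)) - ((6 + 2 * s) * (6 + 4 * s) - s * (6 + s) * 4) * (1 + s) \<le> 0" .
      then show "(1 * ((6 + 4 * s) * (6 + 4 * s)) - ((6 + 2 * s) * (6 + 4 * s) - s * (6 + s) * 4) * (1 + s))
          / ((1 + s) * ((6 + 4 * s) * (6 + 4 * s))) \<le> 0"
        using s by (intro divide_nonpos_nonneg) auto
    qed (use nz in auto)
    ultimately show "\<exists>d. ((\<lambda>t. t * (6 + t) / (6 + 4 * t) - ln (1 + t)) has_real_derivative d) (at s) \<and> 0 \<le> d"
      by (intro exI conjI) auto
  qed
  then show ?thesis by simp
qed

text \<open>The same approximant after t = z / (1 - z). The factor z / (1 - z) is kept apart so that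
  it can be balanced against a factor 1 - \<alpha>.\<close>

lemma minus_ln_le_pade:
  fixes z :: real assumes "0 \<le> z" "z < 1"
  shows "- ln (1 - z) \<le> z / (1 - z) * ((6 - 5 * z) / (6 - 2 * z))"
proof -
  define t where "t = z / (1 - z)"
  have t: "0 \<le> t" "1 + t = 1 / (1 - z)" using assms by (auto simp: t_def field_simps)
  have "- ln (1 - z) = ln (1 + t)" using assms t by (simp add: ln_div)
  also have "\<dots> \<le> t * (6 + t) / (6 + 4 * t)" using t by (intro ln_le_pade)
  also have "\<dots> = t * ((6 - 5 * z) / (6 - 2 * z))"
  proof -
    have "(6 + t) / (6 + 4 * t) = ((6 + t) * (1 - z)) / ((6 + 4 * t) * (1 - z))" using assms by simp
    also have "(6 + t) * (1 - z) = 6 - 5 * z" using assms by (simp add: t_def field_simps)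
    also have "(6 + 4 * t) * (1 - z) = 6 - 2 * z" using assms by (simp add: t_def field_simps)
    finally show ?thesis by (simp flip: times_divide_eq_right)
  qed
  finally show ?thesis by (simp add: t_def)
qed

section \<open>Boxes\<close>

text \<open>A rational substitute for x^2 / 8 - x + 1 + ln x: below 1 a constant that undercuts the
  value at 3/4, from 1 on a Pade bound of ln.\<close>

definition ln_quad_lower :: "real \<Rightarrow> real" where
  "ln_quad_lower x = (if x < 1 then 28 / 1000 else x\<^sup>2 / 8 - x + 1 + 2 * (x - 1) / (x + 1))"

lemma ln_quad_lower_le:
  assumes "3 / 4 \<le> x"
  shows "ln_quad_lower x \<le> x\<^sup>2 / 8 - x + 1 + ln x"
proof (cases "x < 1")
  case True
  have "- ln (1 - 1 / 4) \<le> (1 / 4) / (1 - 1 / 4) * ((6 - 5 * (1 / 4)) / (6 - 2 * (1 / 4)) :: real)"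
    by (rule minus_ln_le_pade) auto
  moreover have "(3 / 4)\<^sup>2 / 8 - 3 / 4 + 1 + ln (3 / 4) \<le> x\<^sup>2 / 8 - x + 1 + ln x"
    using assms by (intro ln_quad_mono) auto
  ultimately show ?thesis using True by (simp add: ln_quad_lower_def power2_eq_square)
next
  case False
  then show ?thesis using ln_ge_pade[of x] by (simp add: ln_quad_lower_def)
qed

text \<open>Interval arithmetic for x between \<open>l\<^sub>1\<close> and \<open>l\<^sub>2\<close>
  and \<alpha> between \<open>a\<^sub>1\<close> and \<open>a\<^sub>2\<close>: each quantity is
  replaced by the end of its range that makes the inequality harder. Conditions are stated without
  the denominators \<open>q\<^sub>1\<close>, \<open>q\<^sub>2\<close>, \<open>den\<close> and
  \<open>a\<^sub>2\<close>, so that integers can check them. A credit \<tau> makes \<beta> depend on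
  the exact \<open>m\<close> through \<open>\<nu>\<close>, whence
  \<open>\<tau> = 0 \<or> m = M\<close>. The choice r = 0 turns off the conditions for small
  weights.\<close>

lemma box_trackable:
  fixes x \<alpha> m M l\<^sub>1 l\<^sub>2 e\<^sub>u e\<^sub>l s w g j t\<^sub>e t\<^sub>q h a\<^sub>1 a\<^sub>2 \<kappa> \<tau> r v\<^sub>1 v\<^sub>2 v\<^sub>3 c\<^sub>1 c\<^sub>2 c\<^sub>3 f\<^sub>1 f\<^sub>2 f\<^sub>3 y \<mu> b B :: real
  defines "\<nu> \<equiv> 1 - \<tau> / M" and "H \<equiv> a\<^sub>2 / M"
  defines "k \<equiv> (1 - \<nu> * a\<^sub>1) * \<kappa>" and "q\<^sub>1 \<equiv> 1 - (1 - a\<^sub>1) * e\<^sub>u" and "q\<^sub>2 \<equiv> 1 - (1 - a\<^sub>2) * e\<^sub>l"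
    and "den \<equiv> (1 + y)\<^sup>2 + y * w"
  assumes l: "3 / 4 \<le> l\<^sub>1" "l\<^sub>1 \<le> x" "x \<le> l\<^sub>2" "l\<^sub>2 \<le> 4"
    and e: "exp (- l\<^sub>1) \<le> e\<^sub>u" "e\<^sub>u < 1" "0 \<le> e\<^sub>l" "e\<^sub>l \<le> exp (- l\<^sub>2)"
    and s: "0 < s" "s \<le> slope l\<^sub>2" and w: "l\<^sub>1 * e\<^sub>u / (1 - e\<^sub>u) \<le> w" and g: "slope l\<^sub>1 \<le> g"
    and j: "j \<le> ln_quad_lower l\<^sub>1" and t\<^sub>e: "t\<^sub>e \<le> e\<^sub>l / (1 - e\<^sub>l)" and t\<^sub>q: "1 / (1 - e\<^sub>u) \<le> t\<^sub>q"
    and h: "h \<le> hslack l\<^sub>1"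
    and a: "0 \<le> a\<^sub>1" "a\<^sub>1 \<le> \<alpha>" "\<alpha> \<le> a\<^sub>2" "a\<^sub>2 \<le> 1" "0 < \<alpha>" "\<alpha> < 1"
    and m: "2 \<le> M" "M \<le> m" "\<tau> = 0 \<or> m = M"
    and v: "0 < v\<^sub>1" "v\<^sub>1 < 1" "0 < v\<^sub>2" "v\<^sub>2 < 1" "0 < v\<^sub>3" "v\<^sub>3 < 1"
    and cf: "exp v\<^sub>1 * (1 - v\<^sub>1)\<^sup>2 \<le> c\<^sub>1" "exp v\<^sub>2 * (1 - v\<^sub>2)\<^sup>2 \<le> c\<^sub>2" "exp v\<^sub>3 * (1 - v\<^sub>3)\<^sup>2 \<le> c\<^sub>3"
      "exp v\<^sub>1 * v\<^sub>1 \<le> f\<^sub>1" "exp v\<^sub>2 * v\<^sub>2 \<le> f\<^sub>2" "exp v\<^sub>3 * v\<^sub>3 \<le> f\<^sub>3"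
    and B: "exp b \<le> B"
    and \<kappa>: "0 \<le> \<kappa>" and \<tau>: "0 \<le> \<tau>" "\<tau> \<le> 1" and r: "0 \<le> r" and y: "0 \<le> y" "y \<le> 1" and \<mu>: "0 \<le> \<mu>"
    and low0: "r \<noteq> 0 \<Longrightarrow> a\<^sub>2 < 1"
      "r \<noteq> 0 \<Longrightarrow> c\<^sub>1 * (1 - a\<^sub>2 + \<kappa> * (1 - \<nu> * a\<^sub>2) * q\<^sub>2 + \<tau> * H) \<le> 1 - a\<^sub>2"
      "r \<noteq> 0 \<Longrightarrow> f\<^sub>1 * (1 - a\<^sub>1 + \<tau> * H + k * q\<^sub>1) \<le> (1 + \<kappa>) * s * q\<^sub>1"
    and mid: "r \<noteq> 0 \<Longrightarrow> c\<^sub>2 * (k + \<tau> * r * H) \<le> (1 - c\<^sub>2) * ((1 - a\<^sub>2) * r)"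
      "r \<noteq> 0 \<Longrightarrow> f\<^sub>2 * (((1 - a\<^sub>1) + \<tau> * H) * r + k) \<le> (1 + \<kappa>) * s"
    and high: "c\<^sub>3 * k \<le> (1 - c\<^sub>3) * ((1 - a\<^sub>2) * r) + \<tau> * t\<^sub>e"
      "f\<^sub>3 * ((1 - a\<^sub>1) * r + k) \<le> (1 + \<kappa> - \<tau> * t\<^sub>q) * s"
    and yc: "y * (l\<^sub>2 * (1 + \<kappa> * H)) \<le> 1"
    and mu0: "\<mu>\<^sup>2 * g * den * q\<^sub>2 \<le> (1 + \<kappa> + 2 * \<mu>) * y * ((1 - a\<^sub>2) * e\<^sub>l)"
    and bC0: "B * den \<le> l\<^sub>1 * (1 + \<kappa> + 2 * \<mu>) * (1 + y + y\<^sup>2 / 2)"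
    and last: "l\<^sub>2 * \<kappa> * H \<le> j"
    and fin0: "\<nu> * (1 - a\<^sub>1) * (6 - 5 * (\<nu> * a\<^sub>1)) * a\<^sub>2
      \<le> ((1 - a\<^sub>2) * h + a\<^sub>2 * (l\<^sub>1\<^sup>2 / 8 - l\<^sub>1 + 1 + b - l\<^sub>2 * \<kappa> * H)) * ((1 - \<nu> * a\<^sub>1) * (6 - 2 * (\<nu> * a\<^sub>1)))"
  shows "trackable x \<alpha> (\<alpha> / m)"
proof -
  define D\<^sub>u where "D\<^sub>u = 1 / q\<^sub>1"
  define Q where "Q = 1 / (1 - a\<^sub>2)"
  \<comment> \<open>The largest \<open>C\<close> that the quadratic condition on \<open>y\<close>
    admits once exp (- x) / slope x is replaced by its upper bound \<open>w\<close>.\<close>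
  define C where "C = (1 + \<kappa> + 2 * \<mu>) / den"
  define d\<^sub>l where "d\<^sub>l = (1 - a\<^sub>2) * e\<^sub>l / q\<^sub>2"
  define G\<^sub>1 where "G\<^sub>1 = (1 - a\<^sub>1) / (1 - \<nu> * a\<^sub>1)"
  define G\<^sub>2 where "G\<^sub>2 = (6 - 5 * (\<nu> * a\<^sub>1)) / (6 - 2 * (\<nu> * a\<^sub>1))"
  define R\<^sub>a where "R\<^sub>a = 1 / a\<^sub>2"
  have f0: "0 < f\<^sub>1" "0 < f\<^sub>2" "0 < f\<^sub>3"
    using cf v by (auto intro: less_le_trans[OF mult_pos_pos[OF exp_gt_zero]])
  define e where "e = exp (- x)"
  define q where "q = 1 - e"
  define D where "D = 1 / (1 - (1 - \<alpha>) * e)"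
  define d where "d = (1 - \<alpha>) * D * e"
  define \<eta> where "\<eta> = \<alpha> / m"
  define \<beta> where "\<beta> = \<alpha> - \<tau> * \<eta>"
  have x: "0 < x" "0 < l\<^sub>1" "0 < l\<^sub>2" using l by auto
  have "exp (- l\<^sub>2) \<le> e" "e \<le> exp (- l\<^sub>1)" using l by (auto simp: e_def)
  with e have eb: "e\<^sub>l \<le> e" "e \<le> e\<^sub>u" by auto
  have e0: "0 < e" "e < 1" using x by (auto simp: e_def)
  have el1: "e\<^sub>l < 1" using eb e0 by simp
  have q0: "0 < q" using e0 by (simp add: q_def)
  have sl: "s \<le> slope x" "slope x \<le> g" "0 < slope x"
  proof -
    have "slope l\<^sub>2 \<le> slope x" using l x by (intro slope_antimono) auto
    with s show "s \<le> slope x" by simp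
    have "slope x \<le> slope l\<^sub>1" using l x by (intro slope_antimono) auto
    with g show "slope x \<le> g" by simp
    show "0 < slope x" using x(1) by (rule slope_pos)
  qed
  have \<eta>: "0 < \<eta>" "\<eta> \<le> H" using a m by (auto simp: \<eta>_def H_def intro!: frac_le)
  have \<nu>: "0 < \<nu>" "\<nu> \<le> 1" using \<tau> m by (auto simp: \<nu>_def field_simps)
  have \<beta>: "\<beta> = \<nu> * \<alpha>" using m by (auto simp: \<beta>_def \<nu>_def \<eta>_def algebra_simps)
  have \<beta>b: "\<nu> * a\<^sub>1 \<le> \<beta>" "\<beta> \<le> \<nu> * a\<^sub>2" "0 < \<beta>" "\<beta> < 1" "\<beta> \<le> \<alpha>"
  proof -
    show "\<nu> * a\<^sub>1 \<le> \<beta>" "\<beta> \<le> \<nu> * a\<^sub>2" "0 < \<beta>" using a \<nu> by (simp_all add: \<beta>)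
    show "\<beta> \<le> \<alpha>" using mult_right_mono[OF \<nu>(2), of \<alpha>] a by (simp add: \<beta>)
    then show "\<beta> < 1" using a by linarith
  qed
  have kb: "(1 - \<beta>) * \<kappa> \<le> k"
    unfolding k_def using \<beta>b \<kappa> by (intro mult_right_mono) auto
  have ae: "(1 - \<alpha>) * e < 1"
  proof -
    have "(1 - \<alpha>) * e \<le> 1 * e" using a e0 by (intro mult_right_mono) auto
    then show ?thesis using e0 by linarith
  qed
  have ae2: "(1 - a\<^sub>1) * e\<^sub>u < 1"
  proof -
    have "(1 - a\<^sub>1) * e\<^sub>u \<le> 1 * e\<^sub>u" using a e0 eb by (intro mult_right_mono) auto
    then show ?thesis using e by linarith
  qed
  have aem: "(1 - \<alpha>) * e \<le> (1 - a\<^sub>1) * e\<^sub>u" using a e0 eb by (intro mult_mono) auto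
  have aem2: "(1 - a\<^sub>2) * e\<^sub>l \<le> (1 - \<alpha>) * e" using a e0 e eb by (intro mult_mono) auto
  have q12: "0 < q\<^sub>1" "0 < q\<^sub>2"
    using ae2 aem2 ae unfolding q\<^sub>1_def q\<^sub>2_def by linarith+
  have low: "a\<^sub>2 < 1" "c\<^sub>1 * (1 + \<kappa> * (1 - \<nu> * a\<^sub>2) * (Q - e\<^sub>l) + \<tau> * H * Q) \<le> 1"
    "f\<^sub>1 * (((1 - a\<^sub>1) + \<tau> * H) * D\<^sub>u + k) \<le> (1 + \<kappa>) * s" if "r \<noteq> 0"
  proof -
    show a2: "a\<^sub>2 < 1" by (rule low0(1)[OF that])
    have Q1: "Q * (1 - a\<^sub>2) = 1" using a2 by (simp add: Q_def)
    then have "c\<^sub>1 * (1 + \<kappa> * (1 - \<nu> * a\<^sub>2) * (Q - e\<^sub>l) + \<tau> * H * Q)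
        = Q * (c\<^sub>1 * (1 - a\<^sub>2 + \<kappa> * (1 - \<nu> * a\<^sub>2) * q\<^sub>2 + \<tau> * H))"
      unfolding q\<^sub>2_def by algebra
    also have "\<dots> \<le> Q * (1 - a\<^sub>2)"
      using low0(2)[OF that] a2 by (intro mult_left_mono) (auto simp: Q_def)
    finally show "c\<^sub>1 * (1 + \<kappa> * (1 - \<nu> * a\<^sub>2) * (Q - e\<^sub>l) + \<tau> * H * Q) \<le> 1"
      unfolding Q1 .
    have Dq: "D\<^sub>u * q\<^sub>1 = 1" using q12 by (simp add: D\<^sub>u_def)
    have "D\<^sub>u * (f\<^sub>1 * (1 - a\<^sub>1 + \<tau> * H + k * q\<^sub>1)) \<le> D\<^sub>u * ((1 + \<kappa>) * s * q\<^sub>1)"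
      using low0(3)[OF that] q12 by (intro mult_left_mono) (auto simp: D\<^sub>u_def)
    moreover have "D\<^sub>u * (f\<^sub>1 * (1 - a\<^sub>1 + \<tau> * H + k * q\<^sub>1)) = f\<^sub>1 * (((1 - a\<^sub>1) + \<tau> * H) * D\<^sub>u + k * (D\<^sub>u * q\<^sub>1))"
      by (simp add: algebra_simps)
    moreover have "D\<^sub>u * ((1 + \<kappa>) * s * q\<^sub>1) = (1 + \<kappa>) * s * (D\<^sub>u * q\<^sub>1)" by simp
    ultimately show "f\<^sub>1 * (((1 - a\<^sub>1) + \<tau> * H) * D\<^sub>u + k) \<le> (1 + \<kappa>) * s" by (simp add: Dq)
  qed
  have w0: "0 \<le> w"
    using w x e eb e0 by (intro order_trans[OF _ w] divide_nonneg_nonneg mult_nonneg_nonneg) auto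
  have den: "0 < den" unfolding den_def using y w0 by (intro add_pos_nonneg) auto
  have C0: "0 < C" unfolding C_def using \<kappa> \<mu> den by (intro divide_pos_pos) auto
  have Cden: "C * den = 1 + \<kappa> + 2 * \<mu>" using den by (simp add: C_def)
  have mu: "\<mu>\<^sup>2 * g \<le> C * y * d\<^sub>l"
  proof -
    have "\<mu>\<^sup>2 * g * (den * q\<^sub>2) \<le> (C * den) * y * (d\<^sub>l * q\<^sub>2)"
      using mu0 q12 unfolding Cden by (simp add: d\<^sub>l_def mult.assoc)
    then have "\<mu>\<^sup>2 * g * (den * q\<^sub>2) \<le> C * y * d\<^sub>l * (den * q\<^sub>2)" by (simp add: mult_ac)
    then show ?thesis using den q12 by simp
  qed
  have bC: "B \<le> l\<^sub>1 * (C * (1 + y + y\<^sup>2 / 2))"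
  proof -
    have "B * den \<le> l\<^sub>1 * (C * (1 + y + y\<^sup>2 / 2)) * den"
      using bC0 unfolding Cden[symmetric] by (simp only: mult_ac)
    then show ?thesis using den by simp
  qed
  have fin: "\<nu> * (G\<^sub>1 * G\<^sub>2) \<le> (R\<^sub>a - 1) * h + (l\<^sub>1\<^sup>2 / 8 - l\<^sub>1 + 1) + b - l\<^sub>2 * \<kappa> * H"
  proof -
    define z where "z = \<nu> * a\<^sub>1"
    define Z where "Z = l\<^sub>1\<^sup>2 / 8 - l\<^sub>1 + 1 + b - l\<^sub>2 * \<kappa> * H"
    have z: "0 < 1 - z" "0 < 6 - 2 * z" using \<beta>b by (auto simp: z_def)
    have a2: "0 < a\<^sub>2" using a by simp
    have "\<nu> * (1 - a\<^sub>1) * (6 - 5 * z) * a\<^sub>2 / (a\<^sub>2 * ((1 - z) * (6 - 2 * z)))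
        \<le> ((1 - a\<^sub>2) * h + a\<^sub>2 * Z) * ((1 - z) * (6 - 2 * z)) / (a\<^sub>2 * ((1 - z) * (6 - 2 * z)))"
      using fin0 z a2 unfolding z_def[symmetric] Z_def[symmetric] by (intro divide_right_mono) auto
    also have "\<dots> = ((1 - a\<^sub>2) * h + a\<^sub>2 * Z) / a\<^sub>2" using z by simp
    also have "\<dots> = (R\<^sub>a - 1) * h + Z" using a2 by (simp add: R\<^sub>a_def field_simps)
    also have "\<nu> * (1 - a\<^sub>1) * (6 - 5 * z) * a\<^sub>2 / (a\<^sub>2 * ((1 - z) * (6 - 2 * z))) = \<nu> * (G\<^sub>1 * G\<^sub>2)"
      using a2 by (simp add: G\<^sub>1_def G\<^sub>2_def z_def)
    finally show ?thesis by (simp add: Z_def)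
  qed
  have D: "0 < D" "1 \<le> D" "D \<le> D\<^sub>u"
  proof -
    show "0 < D" using ae by (simp add: D_def)
    show "1 \<le> D" using ae a e0 by (simp add: D_def)
    show "D \<le> D\<^sub>u" unfolding D_def D\<^sub>u_def q\<^sub>1_def using aem ae2
      by (intro divide_left_mono) auto
  qed
  have lowB: "tangent_bound v\<^sub>1 ((1 - \<alpha>) * D + (1 - \<beta>) * \<kappa> + \<tau> * D * \<eta>) ((1 - \<alpha>) * D) ((1 + \<kappa>) * slope x)"
    if Dr: "D \<le> r"
    unfolding tangent_bound_def
  proof
    have r0: "r \<noteq> 0" using Dr D by auto
    have "\<nu> * a\<^sub>2 \<le> 1 * 1" using \<nu> a by (intro mult_mono) auto
    then have \<nu>a2: "0 \<le> 1 - \<nu> * a\<^sub>2" by simp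
    \<comment> \<open>The sum to be bounded is (1 - \<alpha>) * D * (1 + X), because 1 / ((1 -
      \<alpha>) * D) = 1 / (1 - \<alpha>) - e. Division by the common factor leaves expressions that
      are monotone in \<alpha> and \<open>e\<close>.\<close>
    let ?X = "(1 - \<beta>) * \<kappa> * (1 / (1 - \<alpha>) - e) + \<tau> * \<eta> / (1 - \<alpha>)"
    have "(1 - \<beta>) * \<kappa> * (1 / (1 - \<alpha>) - e) = \<kappa> * ((1 - \<beta>) / (1 - \<alpha>) - (1 - \<beta>) * e)"
      using a by (simp add: field_simps)
    also have "\<dots> \<le> \<kappa> * ((1 - \<nu> * a\<^sub>2) / (1 - a\<^sub>2) - (1 - \<nu> * a\<^sub>2) * e\<^sub>l)"
    proof (intro mult_left_mono diff_mono \<kappa>)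
      have "0 \<le> (1 - \<nu>) * (a\<^sub>2 - \<alpha>)" using \<nu> a by simp
      then have "(1 - \<nu> * \<alpha>) * (1 - a\<^sub>2) \<le> (1 - \<nu> * a\<^sub>2) * (1 - \<alpha>)" by (simp add: algebra_simps)
      then show "(1 - \<beta>) / (1 - \<alpha>) \<le> (1 - \<nu> * a\<^sub>2) / (1 - a\<^sub>2)"
        unfolding \<beta> using a low(1)[OF r0] by (simp add: divide_le_eq pos_le_divide_eq)
      show "(1 - \<nu> * a\<^sub>2) * e\<^sub>l \<le> (1 - \<beta>) * e" using \<nu>a2 \<beta>b eb e by (intro mult_mono) auto
    qed
    also have "\<dots> = \<kappa> * (1 - \<nu> * a\<^sub>2) * (1 / (1 - a\<^sub>2) - e\<^sub>l)" by (simp add: right_diff_distrib)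
    also have "\<dots> \<le> \<kappa> * (1 - \<nu> * a\<^sub>2) * (Q - e\<^sub>l)"
      using \<kappa> \<nu>a2 by (intro mult_left_mono diff_right_mono) (auto simp: Q_def)
    finally have "?X \<le> \<kappa> * (1 - \<nu> * a\<^sub>2) * (Q - e\<^sub>l) + \<tau> * H * Q"
    proof (rule add_mono)
      have "\<tau> * \<eta> * (1 / (1 - \<alpha>)) \<le> \<tau> * H * (1 / (1 - a\<^sub>2))"
        using \<tau> \<eta> a low(1)[OF r0] by (intro mult_mono frac_le) auto
      also have "\<dots> \<le> \<tau> * H * Q"
        using \<tau> \<eta> by (intro mult_left_mono) (auto simp: Q_def)
      finally show "\<tau> * \<eta> / (1 - \<alpha>) \<le> \<tau> * H * Q" by simp
    qed
    moreover have X0: "0 \<le> ?X"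
    proof -
      have "e \<le> 1 / (1 - \<alpha>)" using ae a by (simp add: pos_le_divide_eq mult.commute)
      then show ?thesis using \<beta>b \<kappa> \<tau> \<eta> a by (intro add_nonneg_nonneg mult_nonneg_nonneg divide_nonneg_nonneg) auto
    qed
    moreover have "0 \<le> c\<^sub>1" using cf(1) by (rule order_trans[rotated]) simp
    ultimately have "exp v\<^sub>1 * (1 - v\<^sub>1)\<^sup>2 * (1 + ?X)
        \<le> c\<^sub>1 * (1 + (\<kappa> * (1 - \<nu> * a\<^sub>2) * (Q - e\<^sub>l) + \<tau> * H * Q))"
      using cf(1) by (intro mult_mono add_left_mono) auto
    also have "\<dots> \<le> 1" using low(2)[OF r0] by (simp only: add.assoc)
    finally have 1: "exp v\<^sub>1 * (1 - v\<^sub>1)\<^sup>2 * (1 + ?X) \<le> 1" .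
    have "(1 - \<alpha>) * D * (1 + ?X) = (1 - \<alpha>) * D + (1 - \<beta>) * \<kappa> + \<tau> * D * \<eta>"
    proof -
      have "(1 - \<alpha>) * D * (1 / (1 - \<alpha>) - e) = 1"
      proof -
        have "(1 - \<alpha>) * (1 / (1 - \<alpha>) - e) = 1 - (1 - \<alpha>) * e" using a by (simp add: right_diff_distrib)
        then have "(1 - \<alpha>) * D * (1 / (1 - \<alpha>) - e) = D * (1 - (1 - \<alpha>) * e)"
          by (metis mult.assoc mult.commute)
        also have "\<dots> = 1" using ae by (simp add: D_def)
        finally show ?thesis .
      qed
      moreover have "(1 - \<alpha>) * D * (\<tau> * \<eta> / (1 - \<alpha>)) = \<tau> * D * \<eta>" using a by simp
      moreover have "(1 - \<alpha>) * D * (1 + ((1 - \<beta>) * \<kappa> * z + w))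
          = (1 - \<alpha>) * D + (1 - \<beta>) * \<kappa> * ((1 - \<alpha>) * D * z) + (1 - \<alpha>) * D * w" for z w
        by (simp add: algebra_simps)
      ultimately show ?thesis by (simp only: mult_1_right)
    qed
    then have "exp v\<^sub>1 * (1 - v\<^sub>1)\<^sup>2 * ((1 - \<alpha>) * D + (1 - \<beta>) * \<kappa> + \<tau> * D * \<eta>)
        = (1 - \<alpha>) * D * (exp v\<^sub>1 * (1 - v\<^sub>1)\<^sup>2 * (1 + ?X))" by (simp add: mult_ac)
    also have "\<dots> \<le> (1 - \<alpha>) * D * 1" using 1 a D by (intro mult_left_mono) auto
    finally show "exp v\<^sub>1 * (1 - v\<^sub>1)\<^sup>2 * ((1 - \<alpha>) * D + (1 - \<beta>) * \<kappa> + \<tau> * D * \<eta>) \<le> (1 - \<alpha>) * D" by simp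
    have "(1 - \<alpha>) * D + \<tau> * D * \<eta> = ((1 - \<alpha>) + \<tau> * \<eta>) * D" by (simp add: algebra_simps)
    also have "\<dots> \<le> ((1 - a\<^sub>1) + \<tau> * H) * D\<^sub>u"
      using a D \<tau> \<eta> by (intro mult_mono add_mono) auto
    finally have "(1 - \<alpha>) * D + (1 - \<beta>) * \<kappa> + \<tau> * D * \<eta> \<le> ((1 - a\<^sub>1) + \<tau> * H) * D\<^sub>u + k"
      using kb by linarith
    moreover have "0 \<le> (1 - \<alpha>) * D + (1 - \<beta>) * \<kappa> + \<tau> * D * \<eta>" using a D \<beta>b \<kappa> \<tau> \<eta> by simp
    ultimately have "exp v\<^sub>1 * v\<^sub>1 * ((1 - \<alpha>) * D + (1 - \<beta>) * \<kappa> + \<tau> * D * \<eta>)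
        \<le> f\<^sub>1 * (((1 - a\<^sub>1) + \<tau> * H) * D\<^sub>u + k)"
      using cf(4) f0 by (intro mult_mono) auto
    also have "\<dots> \<le> (1 + \<kappa>) * s" by (rule low(3)[OF r0])
    also have "\<dots> \<le> (1 + \<kappa>) * slope x" using sl \<kappa> by (intro mult_left_mono) auto
    finally show "exp v\<^sub>1 * v\<^sub>1 * ((1 - \<alpha>) * D + (1 - \<beta>) * \<kappa> + \<tau> * D * \<eta>) \<le> (1 + \<kappa>) * slope x" .
  qed
  have midB: "tangent_bound v\<^sub>2 ((1 - \<alpha>) * r + (1 - \<beta>) * \<kappa> + \<tau> * r * \<eta>) ((1 - \<alpha>) * r) ((1 + \<kappa>) * slope x)"
    if Dr: "D \<le> r"
    unfolding tangent_bound_def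
  proof
    have r0: "r \<noteq> 0" using Dr D by auto
    define c where "c = exp v\<^sub>2 * (1 - v\<^sub>2)\<^sup>2"
    have c: "0 \<le> c" "c \<le> c\<^sub>2" "c \<le> 1"
      using cf(2) v exp_times_square_le_1[of v\<^sub>2] by (auto simp: c_def)
    have "c * ((1 - \<beta>) * \<kappa> + \<tau> * r * \<eta>) \<le> c\<^sub>2 * (k + \<tau> * r * H)"
      using c kb \<kappa> \<tau> \<eta> \<beta>b r by (intro mult_mono add_mono) auto
    also have "\<dots> \<le> (1 - c\<^sub>2) * ((1 - a\<^sub>2) * r)" by (rule mid(1)[OF r0])
    also have "\<dots> \<le> (1 - c) * ((1 - a\<^sub>2) * r)" using c a r by (intro mult_right_mono) auto
    also have "\<dots> \<le> (1 - c) * ((1 - \<alpha>) * r)" using c a r by (intro mult_left_mono mult_right_mono) auto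
    finally show "exp v\<^sub>2 * (1 - v\<^sub>2)\<^sup>2 * ((1 - \<alpha>) * r + (1 - \<beta>) * \<kappa> + \<tau> * r * \<eta>) \<le> (1 - \<alpha>) * r"
      by (simp add: algebra_simps flip: c_def)
    have "(1 - \<alpha>) * r + \<tau> * r * \<eta> = ((1 - \<alpha>) + \<tau> * \<eta>) * r" by (simp add: algebra_simps)
    also have "\<dots> \<le> ((1 - a\<^sub>1) + \<tau> * H) * r"
      using a r \<tau> \<eta> by (intro mult_right_mono add_mono mult_left_mono) auto
    finally have "(1 - \<alpha>) * r + (1 - \<beta>) * \<kappa> + \<tau> * r * \<eta> \<le> ((1 - a\<^sub>1) + \<tau> * H) * r + k"
      using kb by linarith
    moreover have "0 \<le> (1 - \<alpha>) * r + (1 - \<beta>) * \<kappa> + \<tau> * r * \<eta>" using a r \<beta>b \<kappa> \<tau> \<eta> by simp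
    ultimately have "exp v\<^sub>2 * v\<^sub>2 * ((1 - \<alpha>) * r + (1 - \<beta>) * \<kappa> + \<tau> * r * \<eta>)
        \<le> f\<^sub>2 * (((1 - a\<^sub>1) + \<tau> * H) * r + k)"
      using cf(5) f0 by (intro mult_mono) auto
    also have "\<dots> \<le> (1 + \<kappa>) * s" by (rule mid(2)[OF r0])
    also have "\<dots> \<le> (1 + \<kappa>) * slope x" using sl \<kappa> by (intro mult_left_mono) auto
    finally show "exp v\<^sub>2 * v\<^sub>2 * ((1 - \<alpha>) * r + (1 - \<beta>) * \<kappa> + \<tau> * r * \<eta>) \<le> (1 + \<kappa>) * slope x" .
  qed
  have highB: "tangent_bound v\<^sub>3 ((1 - \<alpha>) * r + (1 - \<beta>) * \<kappa>) ((1 - \<alpha>) * r + \<tau> * e / q)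
      ((1 + \<kappa> - \<tau> / q) * slope x)"
    unfolding tangent_bound_def
  proof
    define c where "c = exp v\<^sub>3 * (1 - v\<^sub>3)\<^sup>2"
    have c: "0 \<le> c" "c \<le> c\<^sub>3" "c \<le> 1"
      using cf(3) v exp_times_square_le_1[of v\<^sub>3] by (auto simp: c_def)
    have "c * ((1 - \<beta>) * \<kappa>) \<le> c\<^sub>3 * k"
      using c kb \<kappa> \<beta>b by (intro mult_mono) auto
    also have "\<dots> \<le> (1 - c\<^sub>3) * ((1 - a\<^sub>2) * r) + \<tau> * t\<^sub>e" by (rule high(1))
    also have "\<dots> \<le> (1 - c) * ((1 - a\<^sub>2) * r) + \<tau> * (e / q)"
    proof (intro add_mono mult_right_mono mult_left_mono)
      have "e\<^sub>l / (1 - e\<^sub>l) \<le> e / q" unfolding q_def using eb e e0 by (intro frac_le) auto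
      with t\<^sub>e show "t\<^sub>e \<le> e / q" by simp
    qed (use c a r \<tau> in auto)
    also have "\<dots> \<le> (1 - c) * ((1 - \<alpha>) * r) + \<tau> * (e / q)"
      using c a r by (intro add_right_mono mult_left_mono mult_right_mono) auto
    finally show "exp v\<^sub>3 * (1 - v\<^sub>3)\<^sup>2 * ((1 - \<alpha>) * r + (1 - \<beta>) * \<kappa>) \<le> (1 - \<alpha>) * r + \<tau> * e / q"
      by (simp add: algebra_simps flip: c_def)
    have k0: "0 \<le> (1 - a\<^sub>1) * r + k" using a r kb \<beta>b \<kappa> by (smt (verit) mult_nonneg_nonneg)
    have "exp v\<^sub>3 * v\<^sub>3 * ((1 - \<alpha>) * r + (1 - \<beta>) * \<kappa>) \<le> f\<^sub>3 * ((1 - a\<^sub>1) * r + k)"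
      using cf(6) f0 a r kb \<kappa> \<beta>b by (intro mult_mono add_mono mult_right_mono) auto
    also have "\<dots> \<le> (1 + \<kappa> - \<tau> * t\<^sub>q) * s" by (rule high(2))
    also have "\<dots> \<le> (1 + \<kappa> - \<tau> / q) * slope x"
    proof -
      have "0 \<le> f\<^sub>3 * ((1 - a\<^sub>1) * r + k)" using f0 k0 by simp
      with high(2) have "0 \<le> (1 + \<kappa> - \<tau> * t\<^sub>q) * s" by linarith
      with s have "0 \<le> 1 + \<kappa> - \<tau> * t\<^sub>q" by (simp add: zero_le_mult_iff)
      moreover have "1 / q \<le> 1 / (1 - e\<^sub>u)"
        using eb e q0 by (intro divide_left_mono) (auto simp: q_def)
      then have "\<tau> * (1 / q) \<le> \<tau> * t\<^sub>q" using t\<^sub>q \<tau> by (intro mult_left_mono) auto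
      ultimately show ?thesis using sl s by (intro mult_mono) auto
    qed
    finally show "exp v\<^sub>3 * v\<^sub>3 * ((1 - \<alpha>) * r + (1 - \<beta>) * \<kappa>) \<le> (1 + \<kappa> - \<tau> / q) * slope x" .
  qed
  have \<kappa>\<eta>: "\<kappa> * \<eta> \<le> \<kappa> * H" using \<kappa> \<eta> by (intro mult_left_mono) auto
  have yB: "y * (x * (1 + \<kappa> * \<eta>)) \<le> 1"
  proof -
    have "y * (x * (1 + \<kappa> * \<eta>)) \<le> y * (l\<^sub>2 * (1 + \<kappa> * H))"
      using y x l \<kappa>\<eta> \<kappa> \<eta> by (intro mult_left_mono mult_mono) auto
    with yc show ?thesis by simp
  qed
  have dB: "d\<^sub>l \<le> d"
  proof -
    have "d = (1 - \<alpha>) * e / (1 - (1 - \<alpha>) * e)" by (simp add: d_def D_def)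
    moreover have "d\<^sub>l \<le> (1 - \<alpha>) * e / (1 - (1 - \<alpha>) * e)"
      unfolding d\<^sub>l_def q\<^sub>2_def using aem2 ae a e0 by (intro frac_le) auto
    ultimately show ?thesis by simp
  qed
  have muB: "\<mu>\<^sup>2 * slope x \<le> C * y * d"
  proof -
    have "\<mu>\<^sup>2 * slope x \<le> \<mu>\<^sup>2 * g" using sl by (intro mult_left_mono) auto
    also have "\<dots> \<le> C * y * d\<^sub>l" by (rule mu)
    also have "\<dots> \<le> C * y * d" using dB C0 y by (intro mult_left_mono) auto
    finally show ?thesis .
  qed
  have CB: "C * ((1 + y)\<^sup>2 + y * e / slope x) \<le> 1 + \<kappa> + 2 * \<mu>"
  proof -
    have "e / slope x \<le> l\<^sub>1 * exp (- l\<^sub>1) / (1 - exp (- l\<^sub>1))"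
      unfolding e_def using l x by (intro exp_div_slope_antimono) auto
    also have "\<dots> \<le> l\<^sub>1 * e\<^sub>u / (1 - e\<^sub>u)"
      using x e e0 eb by (intro frac_le mult_left_mono) auto
    also have "\<dots> \<le> w" by (rule w)
    finally have "y * (e / slope x) \<le> y * w" using y by (intro mult_left_mono) auto
    then have "C * ((1 + y)\<^sup>2 + y * e / slope x) \<le> C * ((1 + y)\<^sup>2 + y * w)"
      using C0 by (intro mult_left_mono) auto
    also have "\<dots> \<le> 1 + \<kappa> + 2 * \<mu>"
      using Cden by (simp add: den_def)
    finally show ?thesis .
  qed
  have x\<kappa>: "x * \<kappa> * \<eta> \<le> l\<^sub>2 * \<kappa> * H" using x l \<kappa> \<eta> by (intro mult_mono) auto
  have lastB: "x - 1 - ln x + x * \<kappa> * \<eta> \<le> x\<^sup>2 / 8"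
    using x\<kappa> last j ln_quad_lower_le[OF l(1)] ln_quad_mono[OF x(2) l(2)] by linarith
  \<comment> \<open>The gain of a switch is certified in the form exp b \<le> B, so that no
    logarithm has to be evaluated; exp y is bounded below by its quadratic Taylor
    polynomial.\<close>
  have lnC: "b \<le> ln l\<^sub>1 + (ln C + y)"
  proof -
    have "exp b \<le> l\<^sub>1 * (C * (1 + y + y\<^sup>2 / 2))" using B bC by linarith
    also have "\<dots> \<le> l\<^sub>1 * (C * exp y)"
      using exp_lower_Taylor_quadratic[OF y(1)] x C0 by (intro mult_left_mono) auto
    finally have "ln (exp b) \<le> ln (l\<^sub>1 * (C * exp y))" by (intro ln_mono) auto
    then show ?thesis using x C0 by (simp add: ln_mult)
  qed
  have finB: "(1 - \<alpha>) * (hgap x - ln (1 - \<beta>) - x\<^sup>2 / 8)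
       \<le> \<alpha> * (x\<^sup>2 / 8 - (x - 1 - ln x + x * \<kappa> * \<eta> - (ln C + y)))"
  proof -
    define G where "G = \<nu> * (G\<^sub>1 * G\<^sub>2)"
    define R where "R = x\<^sup>2 / 8 - (x - 1 - ln x + x * \<kappa> * \<eta> - (ln C + y))"
    define p where "p = x\<^sup>2 / 8 - hgap x"
    have p: "0 \<le> p" "h \<le> p"
      using hgap_le[of x] hslack_le[OF x(2)] hgap_slack_mono[OF x(2) l(2)] x l h by (auto simp: p_def)
    have R: "G \<le> (R\<^sub>a - 1) * h + R"
      using fin h lnC x\<kappa> ln_quad_mono[OF x(2) l(2)] unfolding G_def R_def by linarith
    \<comment> \<open>Divided by \<alpha>, the balance gives the Hoeffding slack of the steps
      without a switch the weight 1 / \<alpha> - 1, which is smallest at the right end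
      \<open>a\<^sub>2\<close>.\<close>
    have Ra: "R\<^sub>a - 1 \<le> 1 / \<alpha> - 1"
    proof -
      have "R\<^sub>a \<le> 1 / a\<^sub>2" by (simp add: R\<^sub>a_def)
      also have "\<dots> \<le> 1 / \<alpha>" using a by (intro divide_left_mono) auto
      finally show ?thesis by simp
    qed
    have "1 \<le> R\<^sub>a"
    proof -
      have "1 \<le> 1 / a\<^sub>2" using a by simp
      then show ?thesis by (simp add: R\<^sub>a_def)
    qed
    then have "(R\<^sub>a - 1) * h \<le> (R\<^sub>a - 1) * p" using p by (intro mult_left_mono) auto
    also have "\<dots> \<le> (1 / \<alpha> - 1) * p" using p Ra by (intro mult_right_mono) auto
    finally have "G \<le> (1 / \<alpha> - 1) * p + R" using R by simp
    then have "\<alpha> * G \<le> \<alpha> * ((1 / \<alpha> - 1) * p + R)" using a by (intro mult_left_mono) auto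
    also have "\<dots> = (1 - \<alpha>) * p + \<alpha> * R" using a by (simp add: field_simps)
    finally have 1: "\<alpha> * G \<le> (1 - \<alpha>) * p + \<alpha> * R" .
    \<comment> \<open>After division by \<alpha>, the cost of mixing is bounded by a product of two
      decreasing functions of \<alpha>, hence by their values at the left end
      \<open>a\<^sub>1\<close>. The first one decreases because \<nu> \<le> 1.\<close>
    have "- ln (1 - \<beta>) \<le> \<beta> / (1 - \<beta>) * ((6 - 5 * \<beta>) / (6 - 2 * \<beta>))"
      using \<beta>b by (intro minus_ln_le_pade) auto
    then have "(1 - \<alpha>) * (- ln (1 - \<beta>)) \<le> (1 - \<alpha>) * (\<beta> / (1 - \<beta>) * ((6 - 5 * \<beta>) / (6 - 2 * \<beta>)))"
      using a by (intro mult_left_mono) auto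
    also have "\<dots> = \<alpha> * (\<nu> * ((1 - \<alpha>) / (1 - \<beta>)) * ((6 - 5 * \<beta>) / (6 - 2 * \<beta>)))"
      by (simp add: \<beta> mult_ac)
    also have "\<dots> \<le> \<alpha> * G"
    proof -
      have \<nu>a: "\<nu> * a\<^sub>1 < 1" using \<beta>b by linarith
      have "0 \<le> (1 - \<nu>) * (\<alpha> - a\<^sub>1)" using \<nu> a by simp
      then have "(1 - \<alpha>) * (1 - \<nu> * a\<^sub>1) \<le> (1 - a\<^sub>1) * (1 - \<nu> * \<alpha>)" by (simp add: algebra_simps)
      then have i: "(1 - \<alpha>) / (1 - \<beta>) \<le> (1 - a\<^sub>1) / (1 - \<nu> * a\<^sub>1)"
        using \<beta>b \<nu>a by (simp add: \<beta> divide_le_eq pos_le_divide_eq)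
      have ii: "(6 - 5 * \<beta>) / (6 - 2 * \<beta>) \<le> (6 - 5 * (\<nu> * a\<^sub>1)) / (6 - 2 * (\<nu> * a\<^sub>1))"
      proof -
        have "(6 - 5 * \<beta>) * (6 - 2 * (\<nu> * a\<^sub>1)) \<le> (6 - 5 * (\<nu> * a\<^sub>1)) * (6 - 2 * \<beta>)"
          using \<beta>b(1) by (simp add: algebra_simps)
        then show ?thesis using \<beta>b \<nu>a by (simp add: divide_le_eq pos_le_divide_eq)
      qed
      have G1: "(1 - \<alpha>) / (1 - \<beta>) \<le> G\<^sub>1" using i by (simp add: G\<^sub>1_def)
      have G2: "(6 - 5 * \<beta>) / (6 - 2 * \<beta>) \<le> G\<^sub>2" using ii by (simp add: G\<^sub>2_def)
      have "0 \<le> (1 - \<alpha>) / (1 - \<beta>)" "0 \<le> (6 - 5 * \<beta>) / (6 - 2 * \<beta>)" using a \<beta>b by auto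
      then have "(1 - \<alpha>) / (1 - \<beta>) * ((6 - 5 * \<beta>) / (6 - 2 * \<beta>)) \<le> G\<^sub>1 * G\<^sub>2"
        using G1 G2 by (intro mult_mono) auto
      then show ?thesis unfolding G_def mult.assoc using \<nu> a by (intro mult_left_mono) auto
    qed
    finally have "(1 - \<alpha>) * (- ln (1 - \<beta>)) \<le> \<alpha> * G" .
    with 1 have "(1 - \<alpha>) * (- ln (1 - \<beta>)) \<le> (1 - \<alpha>) * p + \<alpha> * R" by linarith
    then show ?thesis by (simp add: p_def R_def algebra_simps)
  qed
  show ?thesis
    unfolding trackable_def Let_def \<eta>_def[symmetric] e_def[symmetric]
    unfolding D_def[symmetric] q_def[symmetric] d_def[symmetric]
    by (rule exI[of _ \<kappa>], rule exI[of _ \<tau>], rule exI[of _ \<beta>], rule exI[of _ r], rule exI[of _ v\<^sub>1],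
        rule exI[of _ v\<^sub>2], rule exI[of _ v\<^sub>3], rule exI[of _ y], rule exI[of _ \<mu>], rule exI[of _ C],
        intro conjI impI)
       (fact \<beta>_def \<kappa> \<tau> \<beta>b r v highB y yB \<mu> C0 muB CB lastB finB less_imp_le[OF \<beta>b(3)] | erule lowB midB)+
qed

section \<open>Integer certificates\<close>

text \<open>120 * 100^5 times a Taylor polynomial of exp (- n / 100). The terms alternate in sign,
  so degree 5 bounds from below and degree 4, used in \<open>taylor_high\<close>, from
  above.\<close>

definition taylor_low :: "int \<Rightarrow> int" where
  "taylor_low n = 1200000000000 - 12000000000 * n + 60000000 * n ^ 2 - 200000 * n ^ 3 + 500 * n ^ 4 - n ^ 5"

definition taylor_high :: "int \<Rightarrow> int" where
  "taylor_high n = 1200000000000 - 12000000000 * n + 60000000 * n ^ 2 - 200000 * n ^ 3 + 500 * n ^ 4"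

lemma exp_minus_taylor:
  assumes "0 \<le> n" "n \<le> 100"
  shows "taylor_low n \<le> 1200000000000 * exp (- (n / 100))"
    and "1200000000000 * exp (- (n / 100)) \<le> taylor_high n"
proof -
  have "0 \<le> real_of_int n / 100" "real_of_int n / 100 \<le> 1" using assms by auto
  note * = exp_minus_bounds[OF this]
  show "taylor_low n \<le> 1200000000000 * exp (- (n / 100))"
    using *(1) by (simp add: taylor_low_def power_divide)
  show "1200000000000 * exp (- (n / 100)) \<le> taylor_high n"
    using *(2) by (simp add: taylor_high_def power_divide)
qed

text \<open>Upper bounds of exp at positive arguments are obtained from lower bounds of the
  reciprocal, which turns them into products of integers.\<close>

lemma exp_le_of_taylor:
  fixes a b :: real
  assumes "0 \<le> n" "n \<le> 100" "0 < taylor_low n" "0 \<le> b" "a * 1200000000000 \<le> b * taylor_low n"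
  shows "exp (n / 100) * a \<le> b"
proof -
  have "a * 1200000000000 \<le> b * (1200000000000 * exp (- (n / 100)))"
    using assms exp_minus_taylor(1)[OF assms(1,2)] by (meson mult_left_mono order_trans)
  then show ?thesis by (simp add: exp_minus field_simps)
qed

fun lookup :: "int list \<Rightarrow> int \<Rightarrow> int" where
  "lookup [] i = 0"
| "lookup (x # xs) i = (if i = 0 then x else lookup xs (i - 1))"

fun table_ok :: "(int \<Rightarrow> int \<Rightarrow> bool) \<Rightarrow> int \<Rightarrow> int list \<Rightarrow> bool" where
  "table_ok P i [] \<longleftrightarrow> True"
| "table_ok P i (x # xs) \<longleftrightarrow> P i x \<and> table_ok P (i + 1) xs"

lemma table_okD:
  "table_ok P i xs \<Longrightarrow> 0 \<le> j \<Longrightarrow> j < int (length xs) \<Longrightarrow> P (i + j) (lookup xs j)"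
proof (induction xs arbitrary: i j)
  case (Cons x xs)
  show ?case
  proof (cases "j = 0")
    case False
    then have "P (i + 1 + (j - 1)) (lookup xs (j - 1))" using Cons by (intro Cons.IH) auto
    then show ?thesis using False by simp
  qed (use Cons in simp)
qed simp

text \<open>Upper bounds of 10^5 * exp v * (1 - v)^2 at v = n / 100, the constant coefficients of
  the tangents; \<open>table_f\<close> does the same for their slopes exp v * v.\<close>

definition table_c :: "int list" where
  "table_c = [100001, 98996, 97981, 96956, 95922, 94878, 93824, 92762, 91690, 90609, 89519, 88421,
     87314, 86198, 85075, 83943, 82803, 81656, 80501, 79339, 78170, 76994, 75812, 74623, 73428,
     72227, 71020, 69809, 68592, 67370, 66144, 64913, 63679, 62441, 61200, 59956, 58710, 57461,
     56211, 54959, 53707, 52453, 51200, 49947, 48694, 47443, 46193, 44945, 43700, 42458, 41220]"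

definition table_f :: "int list" where
  "table_f = [1, 1011, 2041, 3092, 4164, 5257, 6372, 7508, 8667, 9848, 11052, 12280, 13530, 14805,
     16104, 17428, 18777, 20151, 21550, 22976, 24429, 25908, 27414, 28948, 30510, 32101, 33721,
     35370, 37048, 38757, 40496, 42267, 44069, 45903, 47769, 49668, 51601, 53567, 55568, 57603,
     59674, 61781, 63924, 66103, 68321, 70576, 72869, 75202, 77574, 79986, 82439]"

lemma table_c:
  assumes "0 \<le> n" "n \<le> 50"
  shows "exp (n / 100) * (1 - n / 100)\<^sup>2 \<le> lookup table_c n / 100000"
proof -
  have "table_ok (\<lambda>n c. 0 \<le> c \<and> 0 < taylor_low n \<and> (100 - n)\<^sup>2 * 12000000000000 \<le> c * taylor_low n) 0 table_c"
    by (simp add: table_c_def taylor_low_def)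
  from table_okD[OF this, of n] assms
  have *: "0 \<le> lookup table_c n" "0 < taylor_low n"
    "(100 - n)\<^sup>2 * 12000000000000 \<le> lookup table_c n * taylor_low n"
    by (simp_all add: table_c_def)
  have r: "real_of_int ((100 - n)\<^sup>2 * 12000000000000) \<le> real_of_int (lookup table_c n * taylor_low n)"
    using *(3) by (simp only: of_int_le_iff)
  have "exp (n / 100) * (100 - n)\<^sup>2 \<le> lookup table_c n / 10"
    using assms *(1,2) r by (intro exp_le_of_taylor) simp_all
  then show ?thesis by (simp add: field_simps power2_eq_square)
qed

lemma table_f:
  assumes "0 \<le> n" "n \<le> 50"
  shows "exp (n / 100) * (n / 100) \<le> lookup table_f n / 100000"
proof -
  have "table_ok (\<lambda>n c. 0 \<le> c \<and> 0 < taylor_low n \<and> n * 1200000000000000 \<le> c * taylor_low n) 0 table_f"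
    by (simp add: table_f_def taylor_low_def)
  from table_okD[OF this, of n] assms
  have *: "0 \<le> lookup table_f n" "0 < taylor_low n"
    "n * 1200000000000000 \<le> lookup table_f n * taylor_low n"
    by (simp_all add: table_f_def)
  have r: "real_of_int (n * 1200000000000000) \<le> real_of_int (lookup table_f n * taylor_low n)"
    using *(3) by (simp only: of_int_le_iff)
  have "exp (n / 100) * n \<le> lookup table_f n / 1000"
    using assms *(1,2) r by (intro exp_le_of_taylor) simp_all
  then show ?thesis by (simp add: field_simps)
qed

text \<open>Upper bounds of 10^6 * exp (j / 10), where the error of each entry is inherited by the
  next.\<close>

definition table_exp :: "int list" where
  "table_exp = [1000000, 1105171, 1221403, 1349860, 1491827, 1648724, 1822122, 2013757, 2225546,
     2459609, 2718289, 3004174, 3320126, 3669307, 4055212, 4481703, 4953048, 5473965, 6049667,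
     6685917, 7389082, 8166199, 9025046, 9974219, 11023217, 12182539, 13463788, 14879787, 16444708,
     18174214, 20085613, 22198036, 24532624, 27112743, 29964216, 33115581]"

text \<open>1085804900000 is \<open>taylor_low 10\<close>: consecutive entries have to grow at least
  by the factor exp (1 / 10).\<close>

fun exp_chain :: "int list \<Rightarrow> bool" where
  "exp_chain (x # y # xs) \<longleftrightarrow> 0 \<le> y \<and> x * 1200000000000 \<le> y * 1085804900000 \<and> exp_chain (y # xs)"
| "exp_chain _ \<longleftrightarrow> True"

lemma exp_chainD:
  assumes "exp_chain xs" "xs \<noteq> []" "exp a \<le> lookup xs 0 / 1000000" "0 \<le> j" "j < int (length xs)"
  shows "exp (a + j / 10) \<le> lookup xs j / 1000000"
  using assms
proof (induction xs arbitrary: a j rule: exp_chain.induct)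
  case (1 x y xs)
  show ?case
  proof (cases "j = 0")
    case False
    have xy: "x * 1200000000000 \<le> y * 1085804900000" "0 \<le> y" using "1.prems"(1) by auto
    have "real_of_int (x * 1200000000000) \<le> real_of_int (y * 1085804900000)"
      using xy(1) by (simp only: of_int_le_iff)
    then have le: "exp (real_of_int 10 / 100) * (x / 1000000) \<le> y / 1000000"
      using xy(2) by (intro exp_le_of_taylor) (simp_all add: taylor_low_def)
    have "exp (a + 1 / 10) = exp (1 / 10) * exp a" by (simp add: exp_add)
    also have "\<dots> \<le> exp (1 / 10) * (x / 1000000)"
      using "1.prems"(3) by (intro mult_left_mono) auto
    also have "\<dots> \<le> y / 1000000" using le by simp
    finally have "exp (a + 1 / 10) \<le> y / 1000000" .
    then have "exp (a + 1 / 10 + (j - 1) / 10) \<le> lookup (y # xs) (j - 1) / 1000000"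
      using 1 False by (intro "1.IH") auto
    moreover have "a + 1 / 10 + (j - 1) / 10 = a + j / 10" by (simp add: field_simps)
    moreover have "lookup (x # y # xs) j = lookup (y # xs) (j - 1)" using False by simp
    ultimately show ?thesis by (simp only:)
  qed (use 1 in simp)
next
  case ("2_2" v)
  then have "j = 0" by simp
  then show ?case using "2_2" by simp
qed simp

text \<open>The table covers the tenths of the argument, a cubic in i / 1000 the rest. The cubic
  coefficient 1/5 instead of 1/6 absorbs the tail of the series on [0, 1/10]; the scale is
  10^16.\<close>

definition exp_num :: "int \<Rightarrow> int \<Rightarrow> int" where
  "exp_num b i = lookup table_exp b * (10000000000 + 10000000 * i + 5000 * i ^ 2 + 2 * i ^ 3)"

lemma exp_num:
  assumes "0 \<le> b" "b \<le> 35" "0 \<le> i" "i < 100"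
  shows "exp (real_of_int (100 * b + i) / 1000) \<le> exp_num b i / 10000000000000000"
proof -
  have "exp_chain table_exp" "table_exp \<noteq> []" "lookup table_exp 0 = 1000000" "length table_exp = 36"
    by (simp_all add: table_exp_def)
  from exp_chainD[OF this(1,2), of 0 b] assms this
  have 1: "exp (b / 10) \<le> lookup table_exp b / 1000000" by simp
  define d :: real where "d = i / 1000"
  have d: "0 \<le> d" "d \<le> 1 / 10" using assms by (auto simp: d_def)
  have "exp d \<le> exp_poly d" using d by (intro exp_le_exp_poly) auto
  also have "\<dots> \<le> 1 + d + d\<^sup>2 / 2 + d ^ 3 / 5"
  proof -
    have "d ^ 3 * d \<le> d ^ 3 * (1 / 10)" using d by (intro mult_left_mono) auto
    moreover have "d ^ 4 * d \<le> d ^ 4 * (1 / 10)" using d by (intro mult_left_mono) auto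
    moreover have "d ^ 3 * d = d ^ 4" "d ^ 4 * d = d ^ 5" by (simp_all add: eval_nat_numeral)
    moreover have "0 \<le> d ^ 3" using d by simp
    ultimately show ?thesis unfolding exp_poly_def by linarith
  qed
  finally have 2: "exp d \<le> 1 + d + d\<^sup>2 / 2 + d ^ 3 / 5" .
  have "exp ((100 * b + i) / 1000) = exp (b / 10) * exp d"
    by (simp add: d_def add_divide_distrib flip: exp_add)
  also have "\<dots> \<le> lookup table_exp b / 1000000 * (1 + d + d\<^sup>2 / 2 + d ^ 3 / 5)"
    using 1 2 by (intro mult_mono order_trans[OF exp_ge_zero 1]) auto
  also have "\<dots> = exp_num b i / 10000000000000000"
    by (simp add: exp_num_def d_def power_divide field_simps)
  finally show ?thesis .
qed

text \<open>a * ln (M / a) is concave in \<open>a\<close>. The inequality \<open>*\<close> is its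
  tangent at \<alpha>; combined with the weights \<open>a\<^sub>2 - \<alpha>\<close> and
  \<open>\<alpha> - a\<^sub>1\<close>, the affine remainders of the two ends cancel.\<close>

lemma skip_lower:
  fixes \<alpha> a\<^sub>1 a\<^sub>2 M v :: real
  assumes a: "0 < a\<^sub>1" "a\<^sub>1 \<le> \<alpha>" "\<alpha> \<le> a\<^sub>2" and M: "0 < M"
    and v: "v < a\<^sub>1 * ln (M / a\<^sub>1)" "v < a\<^sub>2 * ln (M / a\<^sub>2)"
  shows "v < \<alpha> * ln (M / \<alpha>)"
proof (cases "a\<^sub>1 = a\<^sub>2")
  case False
  have *: "a * ln (M / a) \<le> a * ln (M / \<alpha>) + \<alpha> - a" if "0 < a" for a
  proof -
    have "ln (\<alpha> / a) \<le> \<alpha> / a - 1" using a that by (intro ln_le_minus_one) auto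
    then have "a * ln (\<alpha> / a) \<le> a * (\<alpha> / a - 1)" using that by (intro mult_left_mono) auto
    moreover have "ln (\<alpha> / a) = ln (M / a) - ln (M / \<alpha>)" using a M that by (simp add: ln_div)
    ultimately show ?thesis using that by (simp add: algebra_simps)
  qed
  define l where "l = ln (M / \<alpha>)"
  have "v < a\<^sub>1 * l + \<alpha> - a\<^sub>1" "v < a\<^sub>2 * l + \<alpha> - a\<^sub>2"
    using *[of a\<^sub>1] *[of a\<^sub>2] v a by (auto simp: l_def)
  then have "0 \<le> (a\<^sub>2 - \<alpha>) * (a\<^sub>1 * l + \<alpha> - a\<^sub>1 - v)" "0 \<le> (\<alpha> - a\<^sub>1) * (a\<^sub>2 * l + \<alpha> - a\<^sub>2 - v)"
    "0 < (a\<^sub>2 - \<alpha>) * (a\<^sub>1 * l + \<alpha> - a\<^sub>1 - v) \<or> 0 < (\<alpha> - a\<^sub>1) * (a\<^sub>2 * l + \<alpha> - a\<^sub>2 - v)"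
    using a False by (auto simp: less_le zero_less_mult_iff)
  then have "0 < (a\<^sub>2 - \<alpha>) * (a\<^sub>1 * l + \<alpha> - a\<^sub>1 - v) + (\<alpha> - a\<^sub>1) * (a\<^sub>2 * l + \<alpha> - a\<^sub>2 - v)" by linarith
  also have "\<dots> = (a\<^sub>2 - a\<^sub>1) * (\<alpha> * l - v)" by (simp add: algebra_simps)
  finally show ?thesis using a False by (simp add: zero_less_mult_iff l_def)
qed (use assms in simp)

text \<open>
  Integer encodings: \<open>x\<close> and \<open>v\<^sub>i\<close> are scaled by \<open>10\<^sup>2\<close>, \<open>\<alpha>\<close> by \<open>10\<^sup>4\<close>, \<open>\<kappa>\<close> and \<open>y\<close> by \<open>10\<^sup>2\<close>, \<open>\<tau>\<close> by 10,
  \<open>r\<close> by 4, \<open>\<mu>\<close> and \<open>b\<close> by \<open>10\<^sup>3\<close>, the bounds on \<open>e\<^bsup>-x\<^esup>\<close> passed from cell to cell by \<open>10\<^sup>7\<close>, and all other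
  quantities of a cell by \<open>10\<^sup>5\<close> except \<open>h\<close>, which is scaled by \<open>10\<^sup>6\<close>. A piece stores the right end of its
  interval of \<open>\<alpha>\<close>. A skipped piece has no \<open>\<alpha>\<close> with \<open>8 \<alpha> ln (m / \<alpha>) \<le> x\<^sup>2\<close>, a condition that the optimal
  rate enforces.
\<close>

datatype piece = Skip int int int int int | Box int int int int int int int int int int int

text \<open>
  The check is split into stages so that shared subterms, being arguments, are evaluated only once.
\<close>

definition box_final :: "int \<Rightarrow> int \<Rightarrow> int \<Rightarrow> int \<Rightarrow> int \<Rightarrow> int \<Rightarrow> int \<Rightarrow> int \<Rightarrow> int \<Rightarrow> int \<Rightarrow>
    int \<Rightarrow> int \<Rightarrow> int \<Rightarrow> int \<Rightarrow> int \<Rightarrow> int \<Rightarrow> int \<Rightarrow> int \<Rightarrow> int \<Rightarrow> int \<Rightarrow> int \<Rightarrow> int \<Rightarrow> int \<Rightarrow> int \<Rightarrow>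
    int \<Rightarrow> int \<Rightarrow> int \<Rightarrow> int \<Rightarrow> int \<Rightarrow> int \<Rightarrow> int \<Rightarrow> int \<Rightarrow> int \<Rightarrow> int \<Rightarrow> int \<Rightarrow> bool" where
  "box_final M L\<^sub>1 L\<^sub>2 EL S G J TE TQ A\<^sub>2 k t R c\<^sub>1 f\<^sub>1 c\<^sub>2 f\<^sub>2 c\<^sub>3 f\<^sub>3 Y U B n W P\<^sub>1 P\<^sub>2 Z\<^sub>1 Z\<^sub>2 Q\<^sub>1 Q\<^sub>2 K X D N V \<longleftrightarrow>
     0 \<le> k \<and> 0 \<le> t \<and> t \<le> 10 \<and> 0 \<le> R \<and> 0 \<le> Y \<and> Y \<le> 100 \<and> 0 \<le> U \<and>
     (if R = 0 then True else
       A\<^sub>2 < 10000 \<and>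
       c\<^sub>1 * (P\<^sub>2 * 10000000 * W + k * (W - Z\<^sub>2) * Q\<^sub>2 + t * A\<^sub>2 * 100000000000) \<le> 100000 * (P\<^sub>2 * 10000000 * W) \<and>
       f\<^sub>1 * (X * 100000000000 + K * Q\<^sub>1) \<le> (100 + k) * S * Q\<^sub>1 * W \<and>
       100 * c\<^sub>2 * (4 * K + 100 * R * t * A\<^sub>2) \<le> (100000 - c\<^sub>2) * P\<^sub>2 * R * W \<and>
       f\<^sub>2 * (100 * X * R + 4 * K) \<le> 4 * (100 + k) * S * W) \<and>
     400 * c\<^sub>3 * K \<le> (100000 - c\<^sub>3) * P\<^sub>2 * R * W + 4000 * t * TE * W \<and>
     f\<^sub>3 * (1000 * M * P\<^sub>1 * R + 4 * K) * 2500 \<le> (1000000 + 10000 * k - t * TQ) * S * W \<and>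
     Y * L\<^sub>2 * (1000000 * M + k * A\<^sub>2) \<le> 10000000000 * M \<and>
     U ^ 2 * G * D * Q\<^sub>2 \<le> N * Y * P\<^sub>2 * EL * 10000000000000 \<and>
     B * D \<le> L\<^sub>1 * N * (20000 + 200 * Y + Y ^ 2) * 50000000000000 \<and>
     L\<^sub>2 * k * A\<^sub>2 \<le> 1000 * M * J \<and>
     n * P\<^sub>1 * (6 * W - 5 * Z\<^sub>1) * A\<^sub>2 * 1000 * W \<le> V * (W - Z\<^sub>1) * (6 * W - 2 * Z\<^sub>1)"

definition box_mid where
  "box_mid M L\<^sub>1 L\<^sub>2 EU EL S w G J TE TQ h A\<^sub>1 A\<^sub>2 k t R c\<^sub>1 f\<^sub>1 c\<^sub>2 f\<^sub>2 c\<^sub>3 f\<^sub>3 Y U b B n W P\<^sub>1 P\<^sub>2 Z\<^sub>1 Z\<^sub>2 \<longleftrightarrow>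
     box_final M L\<^sub>1 L\<^sub>2 EL S G J TE TQ A\<^sub>2 k t R c\<^sub>1 f\<^sub>1 c\<^sub>2 f\<^sub>2 c\<^sub>3 f\<^sub>3 Y U B n W P\<^sub>1 P\<^sub>2 Z\<^sub>1 Z\<^sub>2
       (1000000000 - P\<^sub>1 * EU) (1000000000 - P\<^sub>2 * EL) ((W - Z\<^sub>1) * k) (P\<^sub>1 * (10 * M) + t * A\<^sub>2)
       ((100 + Y) ^ 2 * 1000 + Y * w) (1000 + 10 * k + 2 * U)
       (P\<^sub>2 * h * 100 * M + A\<^sub>2 * (L\<^sub>1 ^ 2 - 800 * L\<^sub>1 + 80000 + 80 * b) * 1250 * M - L\<^sub>2 * k * A\<^sub>2 ^ 2)"

definition box_start where
  "box_start M L\<^sub>1 L\<^sub>2 EU EL S w G J TE TQ h A\<^sub>1 A\<^sub>2 k t R c\<^sub>1 f\<^sub>1 c\<^sub>2 f\<^sub>2 c\<^sub>3 f\<^sub>3 Y U b B n \<longleftrightarrow>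
     box_mid M L\<^sub>1 L\<^sub>2 EU EL S w G J TE TQ h A\<^sub>1 A\<^sub>2 k t R c\<^sub>1 f\<^sub>1 c\<^sub>2 f\<^sub>2 c\<^sub>3 f\<^sub>3 Y U b B n
       (100000 * M) (10000 - A\<^sub>1) (10000 - A\<^sub>2) (n * A\<^sub>1) (n * A\<^sub>2)"

definition box_ok where
  "box_ok M L\<^sub>1 L\<^sub>2 EU EL S w G J TE TQ h A\<^sub>1 A\<^sub>2 k t R v\<^sub>1 v\<^sub>2 v\<^sub>3 Y U b b' \<longleftrightarrow>
     box_start M L\<^sub>1 L\<^sub>2 EU EL S w G J TE TQ h A\<^sub>1 A\<^sub>2 k t R (lookup table_c v\<^sub>1) (lookup table_f v\<^sub>1)
       (lookup table_c v\<^sub>2) (lookup table_f v\<^sub>2) (lookup table_c v\<^sub>3) (lookup table_f v\<^sub>3) Y U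
       (100 * b + b') (exp_num b b') (10 * M - t)"

text \<open>Each integer inequality is a condition of \<open>box_trackable\<close> multiplied by a
  constant and, where \<open>M\<close> divides, by a power of \<open>M\<close>. The local fact
  \<open>scaled\<close> removes the factor again, so that only polynomial identities are
  left.\<close>

lemma box_ok_trackable:
  fixes x \<alpha> m :: real and M L\<^sub>1 L\<^sub>2 EU EL S w G J TE TQ h A\<^sub>1 A\<^sub>2 k t R v\<^sub>1 v\<^sub>2 v\<^sub>3 Y U b b' :: int
  assumes ok: "box_ok M L\<^sub>1 L\<^sub>2 EU EL S w G J TE TQ h A\<^sub>1 A\<^sub>2 k t R v\<^sub>1 v\<^sub>2 v\<^sub>3 Y U b b'"
    and l: "75 \<le> L\<^sub>1" "L\<^sub>1 / 100 \<le> x" "x \<le> L\<^sub>2 / 100" "L\<^sub>2 \<le> 400"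
    and e: "exp (- (L\<^sub>1 / 100)) \<le> EU / 100000" "EU < 100000" "0 \<le> EL" "EL / 100000 \<le> exp (- (L\<^sub>2 / 100))"
    and slope: "0 < S" "S / 100000 \<le> slope (L\<^sub>2 / 100)"
    and w: "L\<^sub>1 / 100 * (EU / 100000) / (1 - EU / 100000) \<le> w / 100000"
    and g: "slope (L\<^sub>1 / 100) \<le> G / 100000"
    and j: "J / 100000 \<le> ln_quad_lower (L\<^sub>1 / 100)"
    and te: "TE / 100000 \<le> EL / 100000 / (1 - EL / 100000)"
    and tq: "1 / (1 - EU / 100000) \<le> TQ / 100000"
    and h: "h / 1000000 \<le> hslack (L\<^sub>1 / 100)"
    and a: "0 \<le> A\<^sub>1" "A\<^sub>1 / 10000 \<le> \<alpha>" "\<alpha> \<le> A\<^sub>2 / 10000" "A\<^sub>2 \<le> 10000" "0 < \<alpha>" "\<alpha> < 1"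
    and m: "2 \<le> M" "M \<le> m" "t = 0 \<or> m = M"
    and v: "0 < v\<^sub>1" "v\<^sub>1 \<le> 50" "0 < v\<^sub>2" "v\<^sub>2 \<le> 50" "0 < v\<^sub>3" "v\<^sub>3 \<le> 50"
    and b: "0 \<le> b" "b \<le> 35" "0 \<le> b'" "b' < 100"
  shows "trackable x \<alpha> (\<alpha> / m)"
proof -
  note ok' = ok[unfolded box_ok_def box_start_def box_mid_def box_final_def if_bool_eq_conj]
  note toreal = of_int_le_iff[where 'a = real, symmetric] of_int_mult of_int_add of_int_diff
    of_int_numeral of_int_power
  have M: "0 < real_of_int M" using m by simp
  have scaled: "p \<le> q" if "(q - p) * c = q' - p'" "p' \<le> q'" "0 < c" for p q p' q' c :: real
  proof -
    have "0 \<le> (q - p) * c" using that by simp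
    then show ?thesis using that(3) by (simp add: zero_le_mult_iff)
  qed
  note I = ok'[THEN conjunct2, THEN conjunct2, THEN conjunct2, THEN conjunct2, THEN conjunct2,
      THEN conjunct2, THEN conjunct2]
  note low = I[THEN conjunct1, THEN conjunct2, THEN mp]
  note J1 = I[THEN conjunct2]
  note J2 = J1[THEN conjunct2]
  note J3 = J2[THEN conjunct2]
  note J4 = J3[THEN conjunct2]
  note J5 = J4[THEN conjunct2]
  note J6 = J5[THEN conjunct2]
  note J7 = J6[THEN conjunct2]
  define a\<^sub>1 where "a\<^sub>1 = A\<^sub>1 / 10000"
  define a\<^sub>2 where "a\<^sub>2 = A\<^sub>2 / 10000"
  define \<kappa> where "\<kappa> = k / 100"
  define \<tau> where "\<tau> = t / 10"
  define r where "r = R / 4"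
  define e\<^sub>u where "e\<^sub>u = EU / 100000"
  define e\<^sub>l where "e\<^sub>l = EL / 100000"
  define s where "s = S / 100000"
  define w' where "w' = w / 100000"
  define g where "g = G / 100000"
  define j where "j = J / 100000"
  define te where "te = TE / 100000"
  define tq where "tq = TQ / 100000"
  define h' where "h' = h / 1000000"
  define l\<^sub>1 where "l\<^sub>1 = L\<^sub>1 / 100"
  define l\<^sub>2 where "l\<^sub>2 = L\<^sub>2 / 100"
  define y where "y = Y / 100"
  define \<mu> where "\<mu> = U / 1000"
  define c\<^sub>1 where "c\<^sub>1 = lookup table_c v\<^sub>1 / 100000"
  define c\<^sub>2 where "c\<^sub>2 = lookup table_c v\<^sub>2 / 100000"
  define c\<^sub>3 where "c\<^sub>3 = lookup table_c v\<^sub>3 / 100000"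
  define f\<^sub>1 where "f\<^sub>1 = lookup table_f v\<^sub>1 / 100000"
  define f\<^sub>2 where "f\<^sub>2 = lookup table_f v\<^sub>2 / 100000"
  define f\<^sub>3 where "f\<^sub>3 = lookup table_f v\<^sub>3 / 100000"
  define z where "z = real_of_int (100 * b + b') / 1000"
  define B where "B = exp_num b b' / 10000000000000000"
  define \<nu> where "\<nu> = 1 - \<tau> / M"
  define H where "H = a\<^sub>2 / M"
  define q\<^sub>1 where "q\<^sub>1 = 1 - (1 - a\<^sub>1) * e\<^sub>u"
  define q\<^sub>2 where "q\<^sub>2 = 1 - (1 - a\<^sub>2) * e\<^sub>l"
  define k' where "k' = (1 - \<nu> * a\<^sub>1) * \<kappa>"
  define den where "den = (1 + y)\<^sup>2 + y * w'"
  \<comment> \<open>Writing \<tau> and \<open>a\<^sub>2\<close> as multiples of \<open>M\<close>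
    eliminates the divisions hidden in \<open>\<nu>\<close> and \<open>H\<close>.\<close>
  have \<tau>: "\<tau> = (1 - \<nu>) * M" and a2: "a\<^sub>2 = H * M" using M by (simp_all add: \<nu>_def H_def)
  have eqs: "real_of_int A\<^sub>1 = 10000 * a\<^sub>1" "real_of_int A\<^sub>2 = 10000 * (H * M)" "real_of_int k = 100 * \<kappa>"
      "real_of_int t = 10 * ((1 - \<nu>) * M)" "real_of_int R = 4 * r" "real_of_int EU = 100000 * e\<^sub>u"
      "real_of_int EL = 100000 * e\<^sub>l" "real_of_int S = 100000 * s" "real_of_int w = 100000 * w'"
      "real_of_int G = 100000 * g" "real_of_int J = 100000 * j" "real_of_int TE = 100000 * te"
      "real_of_int TQ = 100000 * tq" "real_of_int h = 1000000 * h'" "real_of_int L\<^sub>1 = 100 * l\<^sub>1"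
      "real_of_int L\<^sub>2 = 100 * l\<^sub>2" "real_of_int Y = 100 * y" "real_of_int U = 1000 * \<mu>"
      "real_of_int (lookup table_c v\<^sub>1) = 100000 * c\<^sub>1" "real_of_int (lookup table_c v\<^sub>2) = 100000 * c\<^sub>2"
      "real_of_int (lookup table_c v\<^sub>3) = 100000 * c\<^sub>3" "real_of_int (lookup table_f v\<^sub>1) = 100000 * f\<^sub>1"
      "real_of_int (lookup table_f v\<^sub>2) = 100000 * f\<^sub>2" "real_of_int (lookup table_f v\<^sub>3) = 100000 * f\<^sub>3"
      "real_of_int (exp_num b b') = 10000000000000000 * B"
      "100 * real_of_int b + real_of_int b' = 1000 * z"
    unfolding \<tau>[symmetric] a2[symmetric]
    by (simp_all add: a\<^sub>1_def a\<^sub>2_def \<kappa>_def \<tau>_def r_def e\<^sub>u_def e\<^sub>l_def s_def w'_def g_def j_def te_def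
        tq_def h'_def l\<^sub>1_def l\<^sub>2_def y_def \<mu>_def c\<^sub>1_def c\<^sub>2_def c\<^sub>3_def f\<^sub>1_def f\<^sub>2_def f\<^sub>3_def z_def B_def)
  note poly = \<tau> a2 q\<^sub>1_def q\<^sub>2_def k'_def den_def power2_eq_square
  have R1: "c\<^sub>1 * (1 - a\<^sub>2 + \<kappa> * (1 - \<nu> * a\<^sub>2) * q\<^sub>2 + \<tau> * H) \<le> 1 - a\<^sub>2" if "R \<noteq> 0"
    by (rule scaled[where c = "10 ^ 21 * M", OF _ low[OF that, THEN conjunct2, THEN conjunct1, unfolded toreal eqs]])
      (use M in \<open>(simp_all only: poly)?, simp_all add: algebra_simps\<close>)
  have R2: "f\<^sub>1 * (1 - a\<^sub>1 + \<tau> * H + k' * q\<^sub>1) \<le> (1 + \<kappa>) * s * q\<^sub>1" if "R \<noteq> 0"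
    by (rule scaled[where c = "10 ^ 21 * M", OF _ low[OF that, THEN conjunct2, THEN conjunct2, THEN conjunct1, unfolded toreal eqs]])
      (use M in \<open>(simp_all only: poly)?, simp_all add: algebra_simps\<close>)
  have R3: "c\<^sub>2 * (k' + \<tau> * r * H) \<le> (1 - c\<^sub>2) * ((1 - a\<^sub>2) * r)" if "R \<noteq> 0"
    by (rule scaled[where c = "4 * 10 ^ 14 * M", OF _ low[OF that, THEN conjunct2, THEN conjunct2, THEN conjunct2, THEN conjunct1, unfolded toreal eqs]])
      (use M in \<open>(simp_all only: poly)?, simp_all add: algebra_simps\<close>)
  have R4: "f\<^sub>2 * (((1 - a\<^sub>1) + \<tau> * H) * r + k') \<le> (1 + \<kappa>) * s" if "R \<noteq> 0"
    by (rule scaled[where c = "4 * 10 ^ 12 * M", OF _ low[OF that, THEN conjunct2, THEN conjunct2, THEN conjunct2, THEN conjunct2, unfolded toreal eqs]])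
      (use M in \<open>(simp_all only: poly)?, simp_all add: algebra_simps\<close>)
  have R5: "c\<^sub>3 * k' \<le> (1 - c\<^sub>3) * ((1 - a\<^sub>2) * r) + \<tau> * te"
    by (rule scaled[where c = "4 * 10 ^ 14 * M", OF _ J1[THEN conjunct1, unfolded toreal eqs]])
      (use M in \<open>(simp_all only: poly)?, simp_all add: algebra_simps\<close>)
  have R6: "f\<^sub>3 * ((1 - a\<^sub>1) * r + k') \<le> (1 + \<kappa> - \<tau> * tq) * s"
    by (rule scaled[where c = "10 ^ 16 * M", OF _ J2[THEN conjunct1, unfolded toreal eqs]])
      (use M in \<open>(simp_all only: poly)?, simp_all add: algebra_simps\<close>)
  have R7: "y * (l\<^sub>2 * (1 + \<kappa> * H)) \<le> 1"
    by (rule scaled[where c = "10 ^ 10 * M", OF _ J3[THEN conjunct1, unfolded toreal eqs]])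
      (use M in \<open>(simp_all only: poly)?, simp_all add: algebra_simps\<close>)
  have R8: "\<mu>\<^sup>2 * g * den * q\<^sub>2 \<le> (1 + \<kappa> + 2 * \<mu>) * y * ((1 - a\<^sub>2) * e\<^sub>l)"
    by (rule scaled[where c = "10 ^ 27", OF _ J4[THEN conjunct1, unfolded toreal eqs]])
      (use M in \<open>(simp_all only: poly)?, simp_all add: algebra_simps\<close>)
  have R9: "B * den \<le> l\<^sub>1 * (1 + \<kappa> + 2 * \<mu>) * (1 + y + y\<^sup>2 / 2)"
    by (rule scaled[where c = "10 ^ 23", OF _ J5[THEN conjunct1, unfolded toreal eqs]])
      (use M in \<open>(simp_all only: poly)?, simp_all add: algebra_simps\<close>)
  have R10: "l\<^sub>2 * \<kappa> * H \<le> j"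
    by (rule scaled[where c = "10 ^ 8 * M", OF _ J6[THEN conjunct1, unfolded toreal eqs]])
      (use M in \<open>(simp_all only: poly)?, simp_all add: algebra_simps\<close>)
  have R11: "\<nu> * (1 - a\<^sub>1) * (6 - 5 * (\<nu> * a\<^sub>1)) * a\<^sub>2
      \<le> ((1 - a\<^sub>2) * h' + a\<^sub>2 * (l\<^sub>1\<^sup>2 / 8 - l\<^sub>1 + 1 + z - l\<^sub>2 * \<kappa> * H)) * ((1 - \<nu> * a\<^sub>1) * (6 - 2 * (\<nu> * a\<^sub>1)))"
    by (rule scaled[where c = "10 ^ 22 * M ^ 3", OF _ J7[unfolded toreal eqs]])
      (use M in \<open>(simp_all only: poly power3_eq_cube)?, simp_all add: algebra_simps\<close>)
  have basic: "3 / 4 \<le> l\<^sub>1" "l\<^sub>1 \<le> x" "x \<le> l\<^sub>2" "l\<^sub>2 \<le> 4" "exp (- l\<^sub>1) \<le> e\<^sub>u" "e\<^sub>u < 1" "0 \<le> e\<^sub>l"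
      "e\<^sub>l \<le> exp (- l\<^sub>2)" "0 < s" "s \<le> slope l\<^sub>2" "0 \<le> a\<^sub>1" "a\<^sub>1 \<le> \<alpha>" "\<alpha> \<le> a\<^sub>2" "a\<^sub>2 \<le> 1"
    using l e slope a by (simp_all add: l\<^sub>1_def l\<^sub>2_def e\<^sub>u_def e\<^sub>l_def s_def a\<^sub>1_def a\<^sub>2_def)
  have basic2: "l\<^sub>1 * e\<^sub>u / (1 - e\<^sub>u) \<le> w'" "slope l\<^sub>1 \<le> g" "j \<le> ln_quad_lower l\<^sub>1"
      "te \<le> e\<^sub>l / (1 - e\<^sub>l)" "1 / (1 - e\<^sub>u) \<le> tq" "h' \<le> hslack l\<^sub>1"
    unfolding l\<^sub>1_def e\<^sub>u_def e\<^sub>l_def w'_def g_def j_def te_def tq_def h'_def by (fact w g j te tq h)+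
  have basic3: "2 \<le> real_of_int M" "\<tau> = 0 \<or> m = M" using m by (auto simp: \<tau>_def)
  have basic4: "0 \<le> \<kappa>" "0 \<le> \<tau>" "\<tau> \<le> 1" "0 \<le> r" "0 \<le> y" "y \<le> 1" "0 \<le> \<mu>"
    using ok'[THEN conjunct1] ok'[THEN conjunct2, THEN conjunct1]
      ok'[THEN conjunct2, THEN conjunct2, THEN conjunct1]
      ok'[THEN conjunct2, THEN conjunct2, THEN conjunct2, THEN conjunct1]
      ok'[THEN conjunct2, THEN conjunct2, THEN conjunct2, THEN conjunct2, THEN conjunct1]
      ok'[THEN conjunct2, THEN conjunct2, THEN conjunct2, THEN conjunct2, THEN conjunct2, THEN conjunct1]
      ok'[THEN conjunct2, THEN conjunct2, THEN conjunct2, THEN conjunct2, THEN conjunct2, THEN conjunct2, THEN conjunct1]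
    by (simp_all add: \<kappa>_def \<tau>_def r_def y_def \<mu>_def)
  have v': "0 < v / 100" "v / 100 < 1" if "0 < v" "v \<le> 50" for v :: int
    using that by auto
  have "a\<^sub>2 < 1" if "R \<noteq> 0"
    using low[OF that, THEN conjunct1] by (simp add: a\<^sub>2_def)
  note low' = this R1 R2 R3 R4
  have "R \<noteq> 0" if "r \<noteq> 0" using that by (simp add: r_def)
  note low' = low'[OF this]
  have cf: "exp (v\<^sub>1 / 100) * (1 - v\<^sub>1 / 100)\<^sup>2 \<le> c\<^sub>1" "exp (v\<^sub>2 / 100) * (1 - v\<^sub>2 / 100)\<^sup>2 \<le> c\<^sub>2"
      "exp (v\<^sub>3 / 100) * (1 - v\<^sub>3 / 100)\<^sup>2 \<le> c\<^sub>3" "exp (v\<^sub>1 / 100) * (v\<^sub>1 / 100) \<le> f\<^sub>1"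
      "exp (v\<^sub>2 / 100) * (v\<^sub>2 / 100) \<le> f\<^sub>2" "exp (v\<^sub>3 / 100) * (v\<^sub>3 / 100) \<le> f\<^sub>3"
    unfolding c\<^sub>1_def c\<^sub>2_def c\<^sub>3_def f\<^sub>1_def f\<^sub>2_def f\<^sub>3_def
    by (intro table_c table_f; use v in simp)+
  have B: "exp z \<le> B" using exp_num[OF b] by (simp add: z_def B_def)
  show ?thesis
    by (rule box_trackable[of l\<^sub>1 x l\<^sub>2 e\<^sub>u e\<^sub>l s w' g j te tq h' a\<^sub>1 \<alpha> a\<^sub>2 M m \<tau> "v\<^sub>1 / 100" "v\<^sub>2 / 100" "v\<^sub>3 / 100"
        c\<^sub>1 c\<^sub>2 c\<^sub>3 f\<^sub>1 f\<^sub>2 f\<^sub>3 z B \<kappa> r y \<mu>, folded \<nu>_def H_def, folded k'_def q\<^sub>1_def q\<^sub>2_def den_def])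
      (erule low' | fact basic basic2 a(5,6) basic3 m(2) v'[OF v(1,2)] v'[OF v(3,4)] v'[OF v(5,6)]
        cf B basic4 R5 R6 R7 R8 R9 R10 R11)+
qed

text \<open>\<open>A\<close> is the end of the preceding piece, and the list has to finish at 10000,
  that is, at \<alpha> = 1. The flag \<open>ex\<close> stands for m = M and is required where a box
  uses the credit \<open>t\<close>. A skipped piece supplies lower bounds of ln (M / \<alpha>) at
  its two ends, which is enough by concavity; 125 is 1000 / 8, the scaled constant of the condition
  on \<alpha> and x.\<close>

fun pieces_ok where
  "pieces_ok M ex L\<^sub>1 L\<^sub>2 EU EL S w G J TE TQ h A [] \<longleftrightarrow> A = (10000 :: int)"
| "pieces_ok M ex L\<^sub>1 L\<^sub>2 EU EL S w G J TE TQ h A (Skip A' b b' d d' # ps) \<longleftrightarrow>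
     0 < A \<and> A \<le> A' \<and> 0 \<le> b \<and> b \<le> 35 \<and> 0 \<le> b' \<and> b' < 100 \<and> 0 \<le> d \<and> d \<le> 35 \<and> 0 \<le> d' \<and> d' < 100 \<and>
     exp_num b b' * A \<le> M * 100000000000000000000 \<and> exp_num d d' * A' \<le> M * 100000000000000000000 \<and>
     125 * L\<^sub>2 ^ 2 < A * (100 * b + b') \<and> 125 * L\<^sub>2 ^ 2 < A' * (100 * d + d') \<and>
     pieces_ok M ex L\<^sub>1 L\<^sub>2 EU EL S w G J TE TQ h A' ps"
| "pieces_ok M ex L\<^sub>1 L\<^sub>2 EU EL S w G J TE TQ h A (Box A' k t R v\<^sub>1 v\<^sub>2 v\<^sub>3 Y U b b' # ps) \<longleftrightarrow>
     0 \<le> A \<and> A' \<le> 10000 \<and> (if t = 0 then True else ex) \<and> 0 \<le> b \<and> b \<le> 35 \<and> 0 \<le> b' \<and> b' < 100 \<and>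
     0 < v\<^sub>1 \<and> v\<^sub>1 \<le> 50 \<and> 0 < v\<^sub>2 \<and> v\<^sub>2 \<le> 50 \<and> 0 < v\<^sub>3 \<and> v\<^sub>3 \<le> 50 \<and>
     box_ok M L\<^sub>1 L\<^sub>2 EU EL S w G J TE TQ h A A' k t R v\<^sub>1 v\<^sub>2 v\<^sub>3 Y U b b' \<and>
     pieces_ok M ex L\<^sub>1 L\<^sub>2 EU EL S w G J TE TQ h A' ps"

text \<open>The first piece whose right end exceeds \<alpha> contains it. If it is a box, its
  certificate applies; if it is skipped, \<open>dom\<close> is contradicted.\<close>

lemma pieces_ok_trackable:
  fixes x \<alpha> m :: real and M L\<^sub>1 L\<^sub>2 EU EL S w G J TE TQ h A :: int
  assumes ok: "pieces_ok M ex L\<^sub>1 L\<^sub>2 EU EL S w G J TE TQ h A ps"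
    and A: "A / 10000 \<le> \<alpha>"
    and l: "75 \<le> L\<^sub>1" "L\<^sub>1 / 100 \<le> x" "x \<le> L\<^sub>2 / 100" "L\<^sub>2 \<le> 400"
    and e: "exp (- (L\<^sub>1 / 100)) \<le> EU / 100000" "EU < 100000" "0 \<le> EL" "EL / 100000 \<le> exp (- (L\<^sub>2 / 100))"
    and slope: "0 < S" "S / 100000 \<le> slope (L\<^sub>2 / 100)"
    and w: "L\<^sub>1 / 100 * (EU / 100000) / (1 - EU / 100000) \<le> w / 100000"
    and g: "slope (L\<^sub>1 / 100) \<le> G / 100000"
    and j: "J / 100000 \<le> ln_quad_lower (L\<^sub>1 / 100)"
    and te: "TE / 100000 \<le> EL / 100000 / (1 - EL / 100000)"
    and tq: "1 / (1 - EU / 100000) \<le> TQ / 100000"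
    and h: "h / 1000000 \<le> hslack (L\<^sub>1 / 100)"
    and \<alpha>: "0 < \<alpha>" "\<alpha> < 1" and m: "2 \<le> M" "M \<le> m" "ex \<Longrightarrow> m = M"
    and dom: "8 * \<alpha> * ln (m / \<alpha>) \<le> x\<^sup>2"
  shows "trackable x \<alpha> (\<alpha> / m)"
  using ok A
proof (induction ps arbitrary: A)
  case Nil
  then show ?case using \<alpha> by simp
next
  case (Cons p ps)
  show ?case
  proof (cases p)
    case (Skip A' b b' d d')
    note ok = Cons.prems(1)[unfolded Skip pieces_ok.simps]
    show ?thesis
    proof (cases "\<alpha> < A' / 10000")
      case True
      have *: "real_of_int L\<^sub>2 ^ 2 / 80000 < a / 10000 * ln (M / (a / 10000))"
        if a: "0 < a" "exp_num b b' * a \<le> M * 100000000000000000000" "125 * L\<^sub>2 ^ 2 < a * (100 * b + b')"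
          and b: "0 \<le> b" "b \<le> 35" "0 \<le> b'" "b' < 100" for a b b' :: int
      proof -
        define c where "c = real_of_int (100 * b + b') / 1000"
        have "real_of_int (exp_num b b' * a) \<le> real_of_int (M * 100000000000000000000)"
          using a(2) by (simp only: of_int_le_iff)
        then have "exp_num b b' / 10000000000000000 * (a / 10000) \<le> M" by simp
        moreover have "exp c * (a / 10000) \<le> exp_num b b' / 10000000000000000 * (a / 10000)"
          using exp_num[OF b] a(1) unfolding c_def by (intro mult_right_mono) auto
        ultimately have "exp c * (a / 10000) \<le> M" by (rule order_trans[rotated])
        then have "exp c \<le> M / (a / 10000)" using a(1) by (subst pos_le_divide_eq) auto
        then have "ln (exp c) \<le> ln (M / (a / 10000))" using exp_gt_zero by (intro ln_mono) auto
        then have "a / 10000 * c \<le> a / 10000 * ln (M / (a / 10000))"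
          using a(1) by (intro mult_left_mono) auto
        moreover have "real_of_int (125 * L\<^sub>2 ^ 2) < real_of_int (a * (100 * b + b'))"
          using a(3) by (simp only: of_int_less_iff)
        then have "real_of_int L\<^sub>2 ^ 2 / 80000 < a / 10000 * c" by (simp add: c_def field_simps)
        ultimately show ?thesis by linarith
      qed
      \<comment> \<open>The condition already fails for \<open>x\<close> at the right end of the
        cell and \<open>m\<close> at its least value \<open>M\<close>, which is the case closest to
        satisfying it.\<close>
      have "real_of_int L\<^sub>2 ^ 2 / 80000 < \<alpha> * ln (M / \<alpha>)"
        by (rule skip_lower[of "A / 10000" \<alpha> "A' / 10000"])
          (use ok True Cons.prems(2) m * in auto)
      also have "\<dots> \<le> \<alpha> * ln (m / \<alpha>)"
        using m \<alpha> by (intro mult_left_mono ln_mono divide_right_mono) auto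
      finally have "real_of_int L\<^sub>2 ^ 2 / 10000 < 8 * \<alpha> * ln (m / \<alpha>)" by simp
      moreover have "x\<^sup>2 \<le> (L\<^sub>2 / 100)\<^sup>2" using l by (intro power_mono) auto
      ultimately show ?thesis using dom by (simp add: power_divide)
    qed (use Cons.IH ok in auto)
  next
    case (Box A' k t R v\<^sub>1 v\<^sub>2 v\<^sub>3 Y U b b')
    note ok = Cons.prems(1)[unfolded Box pieces_ok.simps]
    show ?thesis
    proof (cases "\<alpha> < A' / 10000")
      case True
      show ?thesis
        by (rule box_ok_trackable[OF _ l e slope w g j te tq h _ Cons.prems(2) _ _ \<alpha> m(1,2),
              where k = k and t = t and R = R and v\<^sub>1 = v\<^sub>1 and v\<^sub>2 = v\<^sub>2 and v\<^sub>3 = v\<^sub>3 and Y = Y and U = U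
                and b = b and b' = b' and A\<^sub>2 = A'])
          (use ok True m(3) in \<open>auto split: if_splits\<close>)
    qed (use Cons.IH ok in auto)
  qed
qed

text \<open>The width in \<open>x\<close>, an enclosure of 10^7 * exp (- x) at the right end, nine
  numbers shared by all pieces of the cell and rounded to the safe side, and the pieces.\<close>

datatype cell = Cell int int int int int int int int int int int int "piece list"

text \<open>The enclosure at the right end comes from the one at the left end by multiplication with
  Taylor bounds of exp (- n / 100), so no cell evaluates exp afresh. The large coefficients in the
  condition on \<open>h\<close> bring the four terms of \<open>hslack\<close> to a common
  denominator.\<close>

definition cell_ok where
  "cell_ok M ex L\<^sub>1 L\<^sub>2 u v n u' v' EU EL S w G J TE TQ h ps \<longleftrightarrow>
     0 < n \<and> n \<le> 100 \<and> L\<^sub>2 \<le> 400 \<and> 0 < u \<and>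
     u' * 1200000000000 \<le> u * taylor_low n \<and> v * taylor_high n \<le> v' * 1200000000000 \<and>
     v \<le> 100 * EU \<and> EU < 100000 \<and> 0 \<le> EL \<and> 100 * EL \<le> u' \<and> 0 < S \<and> S * L\<^sub>2 \<le> 10000000 - v' \<and>
     1000 * L\<^sub>1 * EU \<le> (100000 - EU) * w \<and> 10000000 - u \<le> G * L\<^sub>1 \<and>
     (if L\<^sub>1 < 100 then J \<le> 2800 else
       4 * J * (L\<^sub>1 + 100) \<le> 5 * (L\<^sub>1 ^ 2 - 800 * L\<^sub>1 + 80000) * (L\<^sub>1 + 100) + 800000 * (L\<^sub>1 - 100)) \<and>
     TE * (100000 - EL) \<le> 100000 * EL \<and> 10000000000 \<le> TQ * (100000 - EU) \<and>
     h * 31104000000000000000000 \<le> 540000000000000000 * L\<^sub>1 ^ 4 - 1200000000000 * L\<^sub>1 ^ 6 + 2250000 * L\<^sub>1 ^ 8 - 4 * L\<^sub>1 ^ 10 \<and>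
     pieces_ok M ex L\<^sub>1 L\<^sub>2 EU EL S w G J TE TQ h 0 ps"

fun cells_ok where
  "cells_ok M ex L u v [] L' u' v' \<longleftrightarrow> L = (L' :: int) \<and> u = (u' :: int) \<and> v = (v' :: int)"
| "cells_ok M ex L u v (Cell n u\<^sub>1 v\<^sub>1 EU EL S w G J TE TQ h ps # cs) L' u' v' \<longleftrightarrow>
     cell_ok M ex L (L + n) u v n u\<^sub>1 v\<^sub>1 EU EL S w G J TE TQ h ps \<and> cells_ok M ex (L + n) u\<^sub>1 v\<^sub>1 cs L' u' v'"

text \<open>Allows a long certificate to be evaluated in several chunks; the enclosure of exp (- x)
  at the junction is part of the interface.\<close>

lemma cells_ok_append:
  "cells_ok M ex L u v cs L' u' v' \<Longrightarrow> cells_ok M ex L' u' v' cs' L'' u'' v'' \<Longrightarrow>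
    cells_ok M ex L u v (cs @ cs') L'' u'' v''"
  by (induction M ex L u v cs L' u' v' rule: cells_ok.induct) auto

lemma cell_ok_exp:
  assumes ok: "cell_ok M ex L\<^sub>1 L\<^sub>2 u v n u' v' EU EL S w G J TE TQ h ps" "L\<^sub>2 = L\<^sub>1 + n"
    and u: "u / 10000000 \<le> exp (- (L\<^sub>1 / 100))" "exp (- (L\<^sub>1 / 100)) \<le> v / 10000000"
  shows "u' / 10000000 \<le> exp (- (L\<^sub>2 / 100))" "exp (- (L\<^sub>2 / 100)) \<le> v' / 10000000"
proof -
  define e where "e = exp (- (real_of_int L\<^sub>1 / 100))"
  define d where "d = exp (- (real_of_int n / 100))"
  have L2: "exp (- (L\<^sub>2 / 100)) = e * d"
    unfolding e_def d_def ok(2) exp_add[symmetric] by (simp add: add_divide_distrib)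
  have n: "0 \<le> n" "n \<le> 100" "0 < u" and c: "u' * 1200000000000 \<le> u * taylor_low n"
      "v * taylor_high n \<le> v' * 1200000000000" using ok(1) by (auto simp: cell_ok_def)
  note t = exp_minus_taylor[OF n(1,2), folded d_def]
  have e: "u / 10000000 \<le> e" "e \<le> v / 10000000" "0 < e" "0 < d" using u by (auto simp: e_def d_def)
  have "real_of_int (v * taylor_high n) \<le> real_of_int (v' * 1200000000000)"
    using c(2) by (simp only: of_int_le_iff)
  moreover have "e * d \<le> v / 10000000 * (taylor_high n / 1200000000000)"
    using e t by (intro mult_mono) auto
  ultimately show "exp (- (L\<^sub>2 / 100)) \<le> v' / 10000000" unfolding L2 by simp
  have "real_of_int (u' * 1200000000000) \<le> real_of_int (u * taylor_low n)"
    using c(1) by (simp only: of_int_le_iff)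
  then have "u' / 10000000 \<le> u / 10000000 * (taylor_low n / 1200000000000)" by simp
  also have "\<dots> \<le> u / 10000000 * d" using n t by (intro mult_left_mono) auto
  also have "\<dots> \<le> e * d" using e by (intro mult_right_mono) auto
  finally show "u' / 10000000 \<le> exp (- (L\<^sub>2 / 100))" unfolding L2 .
qed

lemma cell_ok_trackable:
  fixes x \<alpha> m :: real and M L\<^sub>1 L\<^sub>2 :: int
  assumes ok: "cell_ok M ex L\<^sub>1 L\<^sub>2 u v n u' v' EU EL S w G J TE TQ h ps" "L\<^sub>2 = L\<^sub>1 + n"
    and u: "u / 10000000 \<le> exp (- (L\<^sub>1 / 100))" "exp (- (L\<^sub>1 / 100)) \<le> v / 10000000"
    and l: "75 \<le> L\<^sub>1" "L\<^sub>1 / 100 \<le> x" "x \<le> L\<^sub>2 / 100"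
    and \<alpha>: "0 < \<alpha>" "\<alpha> < 1" and m: "2 \<le> M" "M \<le> m" "ex \<Longrightarrow> m = M"
    and dom: "8 * \<alpha> * ln (m / \<alpha>) \<le> x\<^sup>2"
  shows "trackable x \<alpha> (\<alpha> / m)"
proof -
  note e' = cell_ok_exp[OF ok u]
  note c = ok(1)[unfolded cell_ok_def]
  have c1: "L\<^sub>2 \<le> 400" "0 < u" "v \<le> 100 * EU" "EU < 100000" "0 \<le> EL" "100 * EL \<le> u'" "0 < S"
      "S * L\<^sub>2 \<le> 10000000 - v'" "1000 * L\<^sub>1 * EU \<le> (100000 - EU) * w" "10000000 - u \<le> G * L\<^sub>1"
      "TE * (100000 - EL) \<le> 100000 * EL" "10000000000 \<le> TQ * (100000 - EU)"
      "pieces_ok M ex L\<^sub>1 L\<^sub>2 EU EL S w G J TE TQ h 0 ps"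
    using c by auto
  note toreal = of_int_le_iff[where 'a = real, symmetric] of_int_mult of_int_add of_int_diff
    of_int_numeral of_int_power
  have L: "0 < real_of_int L\<^sub>1" "0 < real_of_int L\<^sub>2" using l by auto
  show ?thesis
  proof (rule pieces_ok_trackable[OF c1(13) _ l c1(1) _ c1(4,5) _ c1(7) _ _ _ _ _ _ _ \<alpha> m dom])
    show e1: "exp (- (L\<^sub>1 / 100)) \<le> EU / 100000" using u(2) c1(3) by linarith
    show e2: "EL / 100000 \<le> exp (- (L\<^sub>2 / 100))" using e'(1) c1(6) by linarith
    have "EL / 100000 < 1" using e2 L(2) by (intro le_less_trans[OF e2]) auto
    then have el: "real_of_int EL < 100000" by simp
    show "S / 100000 \<le> slope (L\<^sub>2 / 100)"
    proof -
      have "S / 100000 * (L\<^sub>2 / 100) \<le> 1 - v' / 10000000" using c1(8)[unfolded toreal] by simp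
      also have "\<dots> \<le> 1 - exp (- (L\<^sub>2 / 100))" using e' by simp
      finally show ?thesis unfolding slope_def using L by (subst pos_le_divide_eq) auto
    qed
    show "L\<^sub>1 / 100 * (EU / 100000) / (1 - EU / 100000) \<le> w / 100000"
      using c1(9)[unfolded toreal] c1(4) by (simp add: field_simps)
    show "slope (L\<^sub>1 / 100) \<le> G / 100000"
    proof -
      have "1 - exp (- (L\<^sub>1 / 100)) \<le> 1 - u / 10000000" using u by simp
      also have "\<dots> \<le> G / 100000 * (L\<^sub>1 / 100)" using c1(10)[unfolded toreal] by simp
      finally show ?thesis unfolding slope_def using L by (subst pos_divide_le_eq) auto
    qed
    show "J / 100000 \<le> ln_quad_lower (L\<^sub>1 / 100)"
    proof (cases "L\<^sub>1 < 100")
      case True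
      then show ?thesis using c by (simp add: ln_quad_lower_def)
    next
      case False
      then have J: "4 * J * (L\<^sub>1 + 100) \<le> 5 * (L\<^sub>1 ^ 2 - 800 * L\<^sub>1 + 80000) * (L\<^sub>1 + 100) + 800000 * (L\<^sub>1 - 100)"
        using c by auto
      have "2 * (L\<^sub>1 / 100 - 1) / (L\<^sub>1 / 100 + 1) = (2 * real_of_int L\<^sub>1 - 200) / (real_of_int L\<^sub>1 + 100)"
        using L by (simp add: field_simps)
      moreover have "(J / 100000 - ((L\<^sub>1 / 100)\<^sup>2 / 8 - L\<^sub>1 / 100 + 1)) * (real_of_int L\<^sub>1 + 100)
          \<le> 2 * real_of_int L\<^sub>1 - 200"
        using J[unfolded toreal] by (simp add: power2_eq_square field_simps)
      then have "J / 100000 - ((L\<^sub>1 / 100)\<^sup>2 / 8 - L\<^sub>1 / 100 + 1)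
          \<le> (2 * real_of_int L\<^sub>1 - 200) / (real_of_int L\<^sub>1 + 100)"
        using L by (subst pos_le_divide_eq) auto
      moreover have "ln_quad_lower (L\<^sub>1 / 100)
          = (L\<^sub>1 / 100)\<^sup>2 / 8 - L\<^sub>1 / 100 + 1 + 2 * (L\<^sub>1 / 100 - 1) / (L\<^sub>1 / 100 + 1)"
        using False by (simp add: ln_quad_lower_def)
      ultimately show ?thesis by linarith
    qed
    show "TE / 100000 \<le> EL / 100000 / (1 - EL / 100000)"
      using c1(11)[unfolded toreal] el by (simp add: field_simps)
    show "1 / (1 - EU / 100000) \<le> TQ / 100000"
      using c1(12)[unfolded toreal] c1(4) by (simp add: field_simps)
    have H: "h * 31104000000000000000000 \<le> 540000000000000000 * L\<^sub>1 ^ 4 - 1200000000000 * L\<^sub>1 ^ 6 + 2250000 * L\<^sub>1 ^ 8 - 4 * L\<^sub>1 ^ 10"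
      using c by auto
    show "h / 1000000 \<le> hslack (L\<^sub>1 / 100)"
      using H[unfolded toreal] by (simp add: hslack_def power_divide)
  qed (use \<alpha> in auto)
qed

lemma cells_ok_trackable:
  fixes x \<alpha> m :: real and M L :: int
  assumes "cells_ok M ex L u v cs L' u' v'"
    and "u / 10000000 \<le> exp (- (L / 100))" "exp (- (L / 100)) \<le> v / 10000000"
    and "75 \<le> L" "L / 100 \<le> x" "x < L' / 100"
    and "0 < \<alpha>" "\<alpha> < 1" and "2 \<le> M" "M \<le> m" "ex \<Longrightarrow> m = M"
    and "8 * \<alpha> * ln (m / \<alpha>) \<le> x\<^sup>2"
  shows "trackable x \<alpha> (\<alpha> / m)"
  using assms
proof (induction cs arbitrary: L u v)
  case (Cons p cs)
  obtain n u\<^sub>1 v\<^sub>1 EU EL S w G J TE TQ h ps where p: "p = Cell n u\<^sub>1 v\<^sub>1 EU EL S w G J TE TQ h ps"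
    by (cases p)
  have ok: "cell_ok M ex L (L + n) u v n u\<^sub>1 v\<^sub>1 EU EL S w G J TE TQ h ps"
    "cells_ok M ex (L + n) u\<^sub>1 v\<^sub>1 cs L' u' v'"
    using Cons.prems(1) by (simp_all add: p)
  have n: "0 < n" using ok(1) by (simp add: cell_ok_def)
  show ?case
  proof (cases "x \<le> (L + n) / 100")
    case True
    with Cons.prems ok(1) show ?thesis
      by (intro cell_ok_trackable[of M ex L "L + n" u v n u\<^sub>1 v\<^sub>1 EU EL S w G J TE TQ h ps x \<alpha> m]) auto
  next
    case False
    with Cons.prems ok n cell_ok_exp[OF ok(1) refl Cons.prems(2,3)] show ?thesis
      by (intro Cons.IH[of "L + n" u\<^sub>1 v\<^sub>1]) auto
  qed
qed simp

section \<open>Certificates for m = 2, 4, 6 and for all larger m\<close>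

text \<open>The start of the chain of enclosures. Taylor bounds at 1/40 are sharp enough to keep
  seven digits when raised to the powers 5 and 6.\<close>

lemma exp_three_quarters:
  "4723665 / 10000000 \<le> exp (- (75 / 100 :: real))" "exp (- (75 / 100 :: real)) \<le> 4723666 / 10000000"
proof -
  have eq: "exp (- (1 / 8 :: real)) = exp (- (1 / 40)) ^ 5"
  proof -
    have "exp (- (1 / 8 :: real)) = exp (of_nat 5 * (- (1 / 40)))" by simp
    then show ?thesis by (simp only: exp_of_nat_mult)
  qed
  have eq': "exp (- (75 / 100 :: real)) = exp (- (1 / 8)) ^ 6"
  proof -
    have "exp (- (75 / 100 :: real)) = exp (of_nat 6 * (- (1 / 8)))" by simp
    then show ?thesis by (simp only: exp_of_nat_mult)
  qed
  have b: "975309912 / 1000000000 \<le> exp (- (1 / 40 :: real))"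
    "exp (- (1 / 40 :: real)) \<le> 9753099122 / 10000000000"
    using exp_minus_bounds[of "1 / 40"] by (simp_all add: power_divide)
  have "(882496902 / 1000000000 :: real) \<le> (975309912 / 1000000000) ^ 5" by (simp add: power_divide)
  also have "\<dots> \<le> exp (- (1 / 8))" unfolding eq using b(1) by (rule power_mono) simp
  finally have c1: "882496902 / 1000000000 \<le> exp (- (1 / 8 :: real))" .
  have "exp (- (1 / 8)) \<le> (9753099122 / 10000000000 :: real) ^ 5"
    unfolding eq using b(2) by (rule power_mono) simp
  also have "\<dots> \<le> 882496904 / 1000000000" by (simp add: power_divide)
  finally have c2: "exp (- (1 / 8 :: real)) \<le> 882496904 / 1000000000" .
  have "(4723665 / 10000000 :: real) \<le> (882496902 / 1000000000) ^ 6" by (simp add: power_divide)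
  also have "\<dots> \<le> exp (- (75 / 100))" unfolding eq' using c1 by (rule power_mono) simp
  finally show "4723665 / 10000000 \<le> exp (- (75 / 100 :: real))" .
  have "exp (- (75 / 100)) \<le> (882496904 / 1000000000 :: real) ^ 6"
    unfolding eq' using c2 by (rule power_mono) simp
  also have "\<dots> \<le> 4723666 / 10000000" by (simp add: power_divide)
  finally show "exp (- (75 / 100 :: real)) \<le> 4723666 / 10000000" .
qed

text \<open>
  For \<open>m \<ge> 8\<close> one certificate with \<open>\<tau> = 0\<close> suffices, as its inequalities are monotone in \<open>m\<close>; the smaller
  even \<open>m\<close> need their own.
\<close>

lemma certificate_2_1: "cells_ok 2 True 75 4723665 4723666 [
  Cell 20 3867409 3867423 47237 38674 64553 67146 70352 2800 63062 189527 542 [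
    Box 1203 49 7 0 1 1 10 12 386 3 54, Skip 10000 9 38 1 13],
  Cell 20 3166366 3166389 38675 31663 59422 59913 64554 2800 46333 163066 1386 [
    Box 1475 33 8 0 1 1 1 12 319 4 58, Skip 10000 11 21 1 66],
  Cell 20 2592400 2592429 31664 25924 54870 53287 59423 15484 34996 146336 2949 [
    Box 2258 37 8 0 1 1 23 11 261 6 31, Skip 10000 10 9 2 28],
  Cell 20 2122477 2122509 25925 21224 50822 47248 54872 17568 26942 134999 5540 [
    Box 2299 26 9 0 1 1 7 10 219 7 0, Skip 10000 13 7 3 1],
  Cell 20 1737737 1737769 21226 17377 47212 41766 50823 18168 21031 126946 9508 [
    Box 1972 22 9 0 1 1 14 11 212 7 99, Skip 10000 19 42 3 83],
  Cell 15 1495684 1495713 17378 14956 44759 36808 47213 17826 17586 121034 15234 [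
    Box 2030 20 9 0 1 1 20 10 190 8 96, Skip 10000 22 23 4 52],
  Cell 20 1224562 1224591 14958 12245 41787 33420 44760 17193 13953 117589 20925 [
    Box 1791 16 9 0 1 1 20 11 181 9 33, Box 2997 19 9 0 1 1 25 8 144 9 35, Skip 10000 18 40 5 52],
  Cell 20 1002586 1002614 12246 10025 39119 29306 41788 16092 11141 113955 30707 [
    Box 1877 13 9 0 1 1 21 10 157 9 94, Box 2945 16 9 0 1 1 27 8 132 10 1, Box 3830 18 9 3 30 34 8 7 115 10 2,
    Box 4670 19 9 0 1 1 30 6 99 9 97, Skip 10000 14 16 6 62],
  Cell 20 820847 820874 10027 8208 36716 25633 39120 14912 8941 111145 43385 [
    Box 2078 11 9 0 1 1 25 9 135 10 52, Box 3140 14 9 2 25 32 9 8 119 10 62,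
    Box 3900 15 9 0 1 1 32 7 105 10 59, Box 4584 16 9 0 1 1 32 5 84 10 57, Box 5261 17 9 0 1 1 33 5 78 10 55,
    Box 6696 12 10 0 1 1 1 3 49 9 93, Box 8644 13 10 0 1 1 1 1 18 9 74, Box 10000 11 9 0 1 1 1 1 0 8 79],
  Cell 20 672052 672077 8209 6720 34547 22358 36717 13839 7204 108944 59378 [
    Box 2341 9 9 0 1 1 26 9 121 11 3, Box 3451 12 9 1 25 41 14 8 106 11 13, Box 4220 13 9 0 1 1 34 6 87 11 12,
    Box 4888 14 9 0 1 1 35 4 67 11 11, Box 5542 15 9 0 1 1 36 4 62 11 11, Box 7035 10 10 0 1 1 1 4 49 10 50,
    Box 9092 11 10 0 1 1 1 1 13 10 31, Box 10000 10 10 0 1 1 1 1 0 9 15],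
  Cell 20 550229 550252 6721 5502 32585 19455 34548 13016 5822 107206 79095 [
    Box 2697 8 9 0 1 1 31 7 96 11 56, Box 3938 10 9 0 1 1 34 6 81 11 59, Box 4828 11 9 0 1 1 35 6 75 11 57,
    Box 5624 12 9 0 1 1 36 5 63 11 56, Box 7286 8 10 0 1 1 1 3 37 11 1, Box 9627 9 10 0 1 1 1 1 8 10 81,
    Box 10000 8 10 0 1 1 1 1 0 9 31],
  Cell 20 450489 450510 5503 4504 30804 16889 32586 12560 4716 105824 102921 [
    Box 3114 7 9 0 1 1 35 5 73 12 5, Box 4590 9 9 0 1 1 38 4 58 12 7, Box 6463 6 10 0 1 1 1 3 39 11 60,
    Box 8792 7 10 0 1 1 1 1 13 11 44, Box 10000 8 10 0 1 1 1 1 0 10 53],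
  Cell 20 368829 368848 4506 3688 29185 14628 30805 12564 3829 104719 131208 [
    Box 3580 6 9 0 1 1 38 4 58 12 49, Box 5389 8 9 0 1 1 41 4 49 12 51, Box 7909 5 10 0 1 1 1 2 23 11 99,
    Box 10000 7 10 0 1 1 10 1 0 11 48],
  Cell 20 301971 301989 3689 3019 27708 12640 29186 13101 3112 103831 164267 [
    Box 4135 5 9 0 1 1 39 4 51 12 92, Box 6382 7 9 0 1 1 42 4 40 12 90, Box 9914 4 10 0 1 1 1 1 2 12 25,
    Box 10000 7 10 0 1 1 12 1 0 10 68],
  Cell 20 247232 247249 3020 2472 26358 10900 27709 14236 2534 103115 202346 [
    Box 4747 4 9 0 1 1 38 4 44 13 30, Box 7670 6 9 0 1 1 42 2 21 13 28, Box 10000 4 10 0 1 1 1 1 0 11 91],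
  Cell 15 212794 212810 2473 2127 25421 9383 26359 16018 2173 102536 245613 [
    Box 5464 4 9 0 1 1 44 4 39 13 77, Box 10000 3 10 0 1 1 1 1 0 13 12],
  Cell 15 183153 183168 2129 1831 24542 8375 25422 17807 1865 102176 281511 [
    Box 6065 3 9 0 1 1 39 2 24 14 1, Box 10000 5 9 0 1 1 43 1 0 13 62]]
  400 183153 183168"
  by code_simp

text \<open>The subdivision is finest for m = 4; its certificate is therefore split into seven
  consecutive ranges of \<open>x\<close>.\<close>

lemma certificate_4_1: "cells_ok 4 True 75 4723665 4723666 [
  Cell 20 3867409 3867423 47237 38674 64553 67146 70352 2800 63062 189527 542 [
    Box 460 84 5 20 31 15 9 13 469 5 53, Skip 10000 24 53 1 13],
  Cell 20 3166366 3166389 38675 31663 59422 59913 64554 2800 46333 163066 1386 [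
    Box 530 73 5 26 31 11 7 11 373 6 99, Skip 10000 31 20 1 66],
  Cell 15 2725316 2725339 31664 27253 55958 53287 59423 15484 37462 146336 2949 [
    Box 694 70 4 30 31 10 7 12 354 8 61, Skip 10000 30 44 2 12],
  Cell 20 2231299 2231326 27254 22312 51791 48704 55960 17211 28720 137465 4778 [
    Box 498 60 4 26 29 9 7 10 288 9 9, Box 944 68 4 30 32 10 7 10 284 9 42, Skip 10000 29 80 2 82],
  Cell 20 1826832 1826861 22314 18268 48077 43085 51792 18125 22351 128724 8367 [
    Box 572 58 3 24 30 10 8 10 259 10 20, Box 880 60 4 20 31 12 9 9 243 10 26,
    Box 1114 63 4 24 32 11 8 10 252 10 37, Skip 10000 32 43 3 62],
  Cell 15 1572368 1572395 18269 15723 45554 38000 48078 17976 18656 122353 13616 [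
    Box 720 53 3 26 29 9 7 10 239 11 6, Box 1072 61 3 22 31 11 9 9 227 11 44,
    Box 1302 59 4 20 31 12 9 9 222 11 29, Skip 10000 32 86 4 28],
  Cell 15 1353349 1353374 15724 13533 43233 34517 45555 17430 15651 118658 18882 [
    Box 783 43 4 24 26 8 6 10 216 11 17, Box 1116 52 4 24 29 9 7 10 217 11 62,
    Box 1310 59 3 22 31 11 9 9 208 12 3, Box 1477 62 3 16 32 14 12 8 196 12 16,
    Box 1617 59 4 18 32 13 10 9 203 11 96, Skip 10000 30 93 5 1],
  Cell 10 1224560 1224584 13534 12245 41787 31305 43234 16666 13953 115653 25480 [
    Box 926 40 4 28 25 7 5 10 205 11 70, Box 1323 54 3 20 30 11 9 8 188 12 48,
    Box 1537 57 3 24 31 10 8 9 197 12 62, Box 1719 60 3 22 32 11 9 9 196 12 76,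
    Box 1889 57 4 20 32 12 9 9 192 12 57, Skip 10000 29 19 5 52],
  Cell 10 1108027 1108050 12246 11080 40417 29306 41788 16092 12460 113955 30707 [
    Box 995 33 5 22 22 8 5 10 191 11 64, Box 1383 51 3 22 29 10 8 8 178 12 71,
    Box 1614 55 3 16 31 13 11 8 177 12 91, Box 1827 59 3 22 32 11 9 8 176 13 11,
    Box 1926 54 4 22 31 11 8 7 162 12 81, Box 2049 56 4 20 32 12 9 8 172 12 91, Skip 10000 29 53 6 6],
  Cell 6 1043500 1043523 11081 10435 39630 27417 40419 15500 11650 112462 36658 [
    Box 1116 36 4 26 24 7 5 10 188 12 26, Box 1582 51 3 22 30 10 8 9 182 13 13,
    Box 1848 50 4 18 30 12 9 8 168 13 3, Box 2055 58 3 22 32 11 9 8 170 13 48,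
    Box 2235 55 4 20 32 12 9 8 166 13 28, Skip 10000 28 57 6 39],
  Cell 6 982731 982753 10436 9827 38867 26334 39631 15145 10897 111653 40597 [
    Box 1164 30 5 14 21 10 7 9 171 12 9, Box 1605 39 5 26 26 8 5 10 179 12 61,
    Box 1901 54 3 18 31 12 10 8 165 13 49, Box 2074 56 3 24 32 10 8 8 164 13 58,
    Box 2220 58 3 22 32 11 9 7 154 13 69, Box 2368 60 3 12 33 18 15 7 153 13 79,
    Box 2455 55 4 14 32 16 12 8 159 13 48, Skip 10000 27 41 6 73],
  Cell 6 925501 925522 9828 9255 38128 25287 38868 14798 10198 110900 44828 [
    Box 1227 25 6 20 19 7 4 10 171 11 95, Box 1691 43 4 18 27 11 8 7 149 13 7,
    Box 1986 53 3 20 31 11 9 8 160 13 65, Box 2171 50 4 16 30 13 10 7 147 13 45,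
    Box 2301 57 3 22 32 11 9 8 158 13 84, Box 2379 52 4 10 31 19 15 8 155 13 54,
    Box 2479 60 3 12 33 18 15 7 148 13 97, Box 2560 60 3 12 33 18 15 6 137 13 99,
    Box 2612 49 5 12 31 17 12 7 142 13 34, Skip 10000 27 11 7 9],
  Cell 6 871604 871624 9256 8716 37411 24277 38129 14461 9548 110201 49361 [
    Box 1293 13 9 1 13 34 12 9 151 11 25, Box 1751 46 3 20 28 10 8 7 146 13 47,
    Box 2032 51 3 22 30 10 8 8 155 13 75, Box 2206 49 4 14 30 14 11 8 152 13 56,
    Box 2343 45 5 18 29 12 8 6 130 13 33, Box 2447 51 4 12 31 17 13 7 141 13 70,
    Box 2525 52 4 11 31 18 14 6 131 13 75, Box 2618 59 3 11 33 19 16 7 142 14 15,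
    Box 2670 59 3 11 33 19 16 7 142 14 15, Box 2695 48 5 12 31 17 12 7 137 13 48,
    Box 2730 54 4 14 32 16 12 7 139 13 84, Box 2767 49 5 11 31 18 13 6 127 13 53,
    Box 2853 56 4 12 33 18 14 6 129 13 95, Skip 10000 26 9 7 45],
  Cell 6 820845 820865 8717 8208 36716 23301 37412 14140 8941 109550 54208 [
    Box 1361 12 9 0 1 1 30 11 160 11 37, Box 1838 45 3 20 28 10 8 7 141 13 61,
    Box 2094 49 3 12 30 16 13 7 140 13 83, Box 2284 53 3 18 31 12 10 7 140 14 2,
    Box 2421 54 3 11 32 18 15 7 139 14 10, Box 2496 49 4 14 30 15 11 6 127 13 79,
    Box 2602 51 4 12 31 17 13 7 136 13 90, Box 2666 57 3 9 33 21 18 7 138 14 25,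
    Box 2770 59 3 11 33 19 16 6 128 14 36, Box 2819 59 3 11 33 19 16 7 137 14 35,
    Box 2857 48 5 12 31 17 12 6 123 13 68, Box 2894 54 4 14 32 16 12 6 125 14 5,
    Box 2952 61 3 9 34 22 19 6 127 14 45, Box 2992 56 4 11 33 19 15 7 134 14 12,
    Box 3030 56 4 11 33 19 15 6 124 14 13, Skip 10000 25 79 7 82]]
  250 820845 820865"
  by code_simp

lemma certificate_4_2: "cells_ok 4 True 250 820845 820865 [
  Cell 4 788659 788679 8209 7886 36265 22358 36717 13839 8561 108944 59378 [
    Box 1449 19 7 11 17 10 5 9 147 12 11, Box 1973 45 3 20 28 10 8 8 147 13 83,
    Box 2249 39 5 16 27 12 8 7 133 13 41, Box 2440 52 3 18 31 12 10 6 127 14 20,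
    Box 2593 54 3 11 32 18 15 6 126 14 31, Box 2713 50 4 12 31 17 13 6 123 14 5,
    Box 2807 51 4 11 31 18 14 6 123 14 10, Box 2898 58 3 10 33 20 17 7 134 14 51,
    Box 2950 58 3 8 33 23 20 6 124 14 51, Box 3011 59 3 11 34 19 16 6 124 14 56,
    Box 3118 55 4 12 33 18 14 6 121 14 31, Box 3177 55 4 11 33 19 15 6 121 14 30,
    Box 3217 55 4 8 33 23 19 6 120 14 30, Skip 10000 25 7 8 7],
  Cell 4 757735 757755 7887 7577 35822 21749 36266 13650 8198 108563 63011 [
    Box 1499 11 9 0 1 1 30 10 147 11 62, Box 2006 34 5 14 24 12 8 7 131 13 24,
    Box 2299 43 4 16 28 12 9 7 132 13 80, Box 2491 46 4 12 29 16 12 7 131 13 95,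
    Box 2656 54 3 11 32 18 15 7 133 14 42, Box 2754 60 2 10 33 20 18 6 125 14 79,
    Box 2862 56 3 9 33 21 18 6 122 14 54, Box 2987 58 3 11 33 19 16 6 122 14 65,
    Box 3068 47 5 12 31 17 12 7 126 13 97, Box 3167 55 4 12 33 18 14 6 119 14 41,
    Box 3257 55 4 11 33 19 15 6 118 14 44, Box 3313 55 4 8 33 24 19 5 108 14 43,
    Box 3359 63 3 11 35 20 17 6 120 14 86, Box 3389 62 3 10 35 21 18 6 119 14 83, Skip 10000 24 56 8 33],
  Cell 4 728023 728044 7578 7280 35389 21155 35823 13473 7851 108200 66796 [
    Box 1564 11 9 9 13 9 2 9 137 11 74, Box 2097 34 5 14 25 12 8 7 128 13 37,
    Box 2397 38 5 12 27 15 10 8 135 13 60, Box 2613 46 4 11 30 17 13 7 128 14 9,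
    Box 2750 53 3 10 32 19 16 6 120 14 50, Box 2851 54 3 11 32 18 15 6 120 14 56,
    Box 2960 56 3 9 33 21 18 6 119 14 66, Box 3056 57 3 10 33 20 17 6 119 14 72,
    Box 3131 47 5 12 31 17 12 7 123 14 6, Box 3219 53 4 9 33 21 17 6 116 14 46,
    Box 3304 54 4 10 33 20 16 5 106 14 51, Box 3350 54 4 10 33 20 16 6 115 14 50,
    Box 3383 55 4 8 33 24 19 6 115 14 53, Box 3414 55 4 8 34 24 19 5 105 14 54,
    Box 3444 55 4 8 34 24 19 5 105 14 55, Box 3472 55 4 8 34 24 19 6 114 14 55,
    Box 3494 55 4 7 34 26 21 6 114 14 55, Box 3541 56 4 9 34 22 18 6 114 14 61, Skip 10000 24 24 8 59],
  Cell 4 699476 699497 7281 6994 34964 20575 35390 13307 7519 107853 70736 [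
    Box 1606 10 9 0 1 1 29 9 134 11 78, Box 2147 33 5 12 24 13 9 7 125 13 42,
    Box 2456 42 4 16 28 12 9 7 126 13 99, Box 2667 45 4 12 29 16 12 7 125 14 15,
    Box 2838 53 3 11 32 18 15 5 108 14 63, Box 2967 43 5 11 29 17 12 6 113 14 0,
    Box 3075 50 4 10 32 19 15 5 105 14 42, Box 3167 57 3 10 33 20 17 6 116 14 84,
    Box 3247 58 3 11 34 19 16 5 106 14 89, Box 3320 60 3 9 34 22 19 5 106 14 96,
    Box 3404 54 4 11 33 19 15 5 103 14 63, Box 3446 54 4 11 33 19 15 5 103 14 62,
    Box 3495 54 4 8 33 24 19 6 112 14 63, Box 3517 54 4 8 33 23 19 5 102 14 62,
    Box 3542 48 5 8 32 23 17 6 109 14 25, Box 3581 55 4 7 34 26 21 5 102 14 68,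
    Box 3623 50 5 9 33 22 16 5 100 14 33, Box 3663 50 5 9 33 22 16 5 100 14 34,
    Box 3700 50 5 9 33 22 16 5 99 14 35, Box 3735 50 5 9 33 22 16 5 99 14 35, Skip 10000 23 69 8 85],
  Cell 2 685625 685647 6995 6856 34755 20007 34965 13155 7360 107522 74835 [
    Box 1679 10 9 0 1 1 30 10 139 11 91, Box 2249 33 5 12 24 13 9 6 115 13 55,
    Box 2568 47 3 9 29 19 16 7 126 14 44, Box 2803 45 4 11 29 17 13 7 123 14 29,
    Box 2988 42 5 12 29 16 11 7 120 14 7, Box 3141 49 4 10 31 19 15 6 113 14 51,
    Box 3280 57 3 10 33 20 17 5 105 14 98, Box 3396 52 4 9 33 21 17 5 102 14 66,
    Box 3497 53 4 11 33 19 15 6 111 14 71, Box 3592 54 4 8 33 24 19 5 101 14 76,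
    Box 3662 48 5 8 32 23 17 6 107 14 38, Box 3754 49 5 9 33 22 16 6 107 14 44,
    Box 3808 49 5 9 33 22 16 5 98 14 43, Box 3882 50 5 10 33 21 15 6 106 14 48, Skip 10000 23 13 8 98]]
  268 685625 685647"
  by code_simp

lemma certificate_4_3: "cells_ok 4 True 268 685625 685647 [
  Cell 2 672048 672071 6857 6720 34547 19730 34756 13084 7204 107362 76945 [
    Box 1714 10 9 0 1 1 32 9 131 11 97, Box 2285 28 6 11 23 13 8 7 120 13 27,
    Box 2615 47 3 9 30 19 16 6 116 14 50, Box 2858 45 4 11 30 17 13 6 113 14 35,
    Box 3042 53 3 11 32 18 15 5 105 14 83, Box 3191 49 4 10 31 19 15 7 120 14 56,
    Box 3303 57 3 10 33 20 17 5 104 15 1, Box 3390 57 3 7 34 25 22 5 103 15 3,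
    Box 3478 53 4 10 33 20 16 5 101 14 74, Box 3551 53 4 11 33 19 15 5 100 14 75,
    Box 3624 53 4 8 33 23 19 5 100 14 77, Box 3685 48 5 8 32 23 17 6 106 14 42,
    Box 3793 49 5 9 33 22 16 6 106 14 50, Box 3863 49 5 9 33 22 16 6 105 14 49,
    Box 3918 43 6 9 32 22 14 5 94 14 10, Box 3963 43 6 9 32 22 14 5 94 14 10, Skip 10000 23 0 9 12],
  Cell 2 658740 658764 6721 6587 34342 19455 34548 13016 7051 107206 79095 [
    Box 1750 10 9 0 1 1 33 8 123 12 3, Box 2313 32 5 16 24 11 7 8 128 13 60,
    Box 2641 41 4 10 28 17 13 7 121 14 18, Box 2903 45 4 11 30 17 13 6 112 14 41,
    Box 3095 53 3 11 32 18 15 6 113 14 89, Box 3250 49 4 10 31 19 15 6 110 14 62,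
    Box 3367 50 4 8 32 22 18 6 109 14 67, Box 3464 51 4 7 32 25 20 5 100 14 72,
    Box 3564 52 4 10 33 20 16 5 99 14 78, Box 3635 46 5 10 32 20 14 5 97 14 40,
    Box 3675 48 5 8 32 23 17 6 106 14 45, Box 3742 47 5 8 32 23 17 6 105 14 45,
    Box 3858 49 5 9 33 22 16 5 96 14 56, Box 3906 49 5 9 33 22 16 6 104 14 53,
    Box 3938 43 6 9 32 22 14 5 93 14 13, Box 4003 43 6 9 32 22 14 6 101 14 16,
    Box 4045 43 6 7 32 25 17 5 92 14 15, Skip 10000 22 87 9 25],
  Cell 2 645696 645720 6588 6456 34139 19184 34343 12953 6901 107053 81287 [
    Box 1783 10 9 18 13 7 1 9 128 12 8, Box 2349 46 2 10 29 17 15 7 125 14 60,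
    Box 2684 41 4 10 28 17 13 6 111 14 23, Box 2949 45 4 11 30 17 13 7 119 14 46,
    Box 3140 53 3 11 32 18 15 5 102 14 94, Box 3306 49 4 10 32 19 15 7 117 14 68,
    Box 3430 50 4 8 32 23 18 6 108 14 73, Box 3532 51 4 9 32 21 17 5 98 14 78,
    Box 3634 52 4 9 33 22 17 5 98 14 84, Box 3701 46 5 10 32 20 14 6 104 14 45,
    Box 3787 47 5 8 32 23 17 5 95 14 51, Box 3859 49 5 9 33 22 16 5 95 14 58,
    Box 3920 48 5 7 33 25 19 5 94 14 55, Box 3968 42 6 8 32 23 15 5 92 14 16,
    Box 4012 43 6 9 32 22 14 5 92 14 19, Box 4076 43 6 7 32 25 17 5 91 14 21,
    Box 4131 43 6 6 32 27 19 5 91 14 21, Box 4173 45 6 8 33 24 16 5 91 14 27, Skip 10000 22 49 9 39],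
  Cell 2 632910 632934 6458 6329 33938 18917 34140 12893 6756 106904 83520 [
    Box 1795 9 9 0 1 1 29 8 120 12 6, Box 2386 36 4 11 26 15 11 6 111 14 0,
    Box 2736 41 4 10 28 17 13 6 110 14 29, Box 3008 45 4 11 30 17 13 6 109 14 52,
    Box 3189 41 5 12 29 16 11 6 106 14 24, Box 3365 49 4 11 32 18 14 6 107 14 74,
    Box 3485 50 4 8 32 23 18 6 106 14 78, Box 3601 45 5 9 31 21 15 6 104 14 46,
    Box 3669 45 5 6 31 26 20 6 103 14 45, Box 3754 46 5 10 32 20 14 6 103 14 51,
    Box 3852 47 5 8 32 23 17 5 94 14 57, Box 3913 47 5 8 32 23 17 5 93 14 56,
    Box 3959 47 5 6 33 27 21 5 93 14 56, Box 3991 41 6 8 31 23 15 5 91 14 16,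
    Box 4014 41 6 8 31 23 15 6 99 14 16, Box 4029 43 6 9 32 22 14 5 91 14 21,
    Box 4076 42 6 9 32 22 14 5 90 14 21, Box 4115 42 6 9 32 22 14 5 90 14 21,
    Box 4150 43 6 7 32 25 17 5 90 14 24, Box 4182 43 6 6 32 27 19 5 90 14 25,
    Box 4212 43 6 6 32 27 19 5 89 14 25, Box 4246 44 6 8 33 24 16 5 89 14 28,
    Box 4272 43 6 6 33 27 19 5 89 14 25, Skip 10000 22 29 9 53],
  Cell 2 620377 620402 6330 6203 33739 18652 33939 12837 6613 106758 85794 [
    Box 1829 9 9 0 1 1 31 9 125 12 11, Box 2435 36 4 11 26 15 11 6 110 14 6,
    Box 2768 41 4 10 28 17 13 6 109 14 32, Box 3028 44 4 9 29 19 15 5 99 14 52,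
    Box 3222 41 5 12 29 16 11 6 105 14 29, Box 3381 48 4 10 31 19 15 6 106 14 74,
    Box 3497 50 4 8 32 23 18 5 97 14 82, Box 3606 50 4 7 32 25 20 5 96 14 85,
    Box 3702 45 5 9 31 21 15 6 102 14 51, Box 3794 46 5 10 32 20 14 5 93 14 56,
    Box 3897 47 5 8 32 23 17 6 101 14 62, Box 3936 46 5 8 32 23 17 5 92 14 56,
    Box 4001 41 6 8 31 23 15 5 90 14 22, Box 4041 41 6 8 31 23 15 5 89 14 21,
    Box 4074 41 6 8 31 23 15 5 89 14 21, Box 4137 42 6 9 32 22 14 5 89 14 27,
    Box 4184 42 6 7 32 25 17 5 89 14 27, Box 4220 42 6 6 32 27 19 5 88 14 26,
    Box 4252 42 6 6 32 27 19 5 88 14 26, Box 4280 42 6 6 32 27 19 5 88 14 26,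
    Box 4304 42 6 6 32 27 19 4 79 14 26, Box 4319 36 7 6 31 26 16 5 86 13 85,
    Box 4330 36 7 6 31 26 16 5 86 13 85, Box 4336 42 6 6 32 27 19 5 87 14 25,
    Box 4341 42 6 6 32 27 19 5 87 14 25, Box 4346 42 6 6 32 27 19 5 87 14 25,
    Box 4350 42 6 6 32 27 19 5 87 14 25, Box 4354 42 6 6 32 27 19 5 87 14 25,
    Box 4357 42 6 6 32 27 19 5 87 14 25, Box 4360 42 6 6 32 27 19 5 87 14 25, Skip 10000 22 16 9 67]]
  278 620377 620402"
  by code_simp

text \<open>Around \<alpha> = 0.444 the pieces shrink to a width of 0.0002.\<close>

lemma certificate_4_4: "cells_ok 4 True 278 620377 620402 [
  Cell 1 614204 614229 6205 6142 33640 18392 33740 12784 6543 106616 88112 [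
    Box 1871 9 9 0 1 1 31 8 118 12 18, Box 2489 36 4 11 26 15 11 6 109 14 12,
    Box 2829 40 4 7 28 21 17 6 108 14 36, Box 3105 44 4 11 30 17 13 6 107 14 59,
    Box 3303 46 4 8 31 21 17 6 106 14 70, Box 3465 48 4 10 31 19 15 6 105 14 80,
    Box 3594 43 5 8 31 22 16 6 102 14 47, Box 3737 45 5 9 31 21 15 5 93 14 58,
    Box 3829 39 6 9 30 21 13 6 99 14 18, Box 3931 46 5 8 32 23 17 5 92 14 63,
    Box 3994 40 6 6 31 26 18 5 89 14 22, Box 4095 41 6 8 31 23 15 5 89 14 29,
    Box 4152 41 6 8 32 23 15 5 88 14 27, Box 4252 42 6 7 32 25 17 5 88 14 34,
    Box 4312 42 6 6 32 27 19 5 87 14 32, Box 4363 42 6 6 32 27 19 5 87 14 32,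
    Box 4378 36 7 6 31 27 16 5 85 13 89, Box 4392 36 7 6 31 27 16 5 85 13 89,
    Box 4406 36 7 6 31 27 16 5 85 13 89, Box 4419 36 7 6 31 27 16 5 85 13 89, Skip 10000 22 2 9 74],
  Cell 1 608092 608118 6143 6080 33542 18261 33641 12760 6473 106546 89286 [
    Box 1890 9 9 0 1 1 32 9 124 12 21, Box 2509 36 4 11 26 15 11 6 108 14 14,
    Box 2855 51 2 11 31 17 15 6 111 15 9, Box 3127 44 4 11 30 17 13 6 106 14 61,
    Box 3325 46 4 8 31 21 17 6 105 14 72, Box 3494 48 4 11 31 18 14 6 104 14 83,
    Box 3630 43 5 8 31 22 16 5 93 14 50, Box 3760 45 5 9 32 21 15 6 101 14 60,
    Box 3863 45 5 9 32 21 15 5 92 14 61, Box 3962 46 5 8 32 23 17 5 91 14 66,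
    Box 4082 41 6 8 31 23 15 5 89 14 32, Box 4169 41 6 8 32 23 15 5 88 14 31,
    Box 4267 42 6 7 32 25 17 5 87 14 36, Box 4340 42 6 6 32 27 19 5 87 14 36,
    Box 4358 36 7 8 31 23 13 5 85 13 91, Box 4367 41 6 5 32 29 21 5 86 14 28,
    Box 4375 41 6 5 32 29 21 5 86 14 28, Box 4382 41 6 5 32 29 21 5 86 14 28,
    Box 4389 41 6 5 32 29 21 5 86 14 28, Box 4395 41 6 5 32 30 21 5 86 14 28,
    Box 4400 41 6 5 32 30 21 5 86 14 28, Box 4405 41 6 5 32 30 21 5 86 14 28,
    Box 4410 41 6 5 32 30 21 5 86 14 28, Box 4414 41 6 5 32 30 21 5 86 14 28,
    Box 4418 41 6 5 32 30 21 5 86 14 28, Box 4421 41 6 5 32 30 21 5 86 14 28,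
    Box 4424 41 6 5 32 30 21 5 86 14 28, Box 4427 41 6 5 32 30 21 5 86 14 28,
    Box 4430 41 6 5 32 30 21 5 86 14 28, Box 4433 35 7 4 31 31 21 5 84 13 87,
    Box 4435 41 6 5 32 30 21 5 86 14 28, Box 4437 41 6 5 32 30 21 5 86 14 28,
    Box 4439 41 6 5 32 30 21 5 86 14 28, Box 4441 35 7 4 31 31 21 5 84 13 87,
    Box 4443 35 7 4 31 31 21 5 84 13 87, Box 4446 36 7 8 31 24 13 5 84 13 91,
    Box 4466 36 7 8 31 24 13 5 84 13 92, Box 4506 36 7 8 32 24 13 5 84 13 93, Skip 10000 21 75 9 81],
  Cell 1 602041 602068 6082 6020 33444 18133 33543 12736 6405 106476 90471 [
    Box 1906 9 9 0 1 1 32 8 117 12 23, Box 2522 36 4 11 26 15 11 6 108 14 15,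
    Box 2872 40 4 9 28 18 14 6 106 14 40, Box 3154 44 4 11 30 17 13 5 97 14 64,
    Box 3357 46 4 8 31 21 17 5 96 14 75, Box 3518 48 4 11 32 18 14 5 95 14 85,
    Box 3662 43 5 8 31 22 16 6 101 14 53, Box 3783 44 5 7 31 24 18 5 92 14 58,
    Box 3892 45 5 10 32 20 14 5 91 14 63, Box 3967 39 6 7 30 24 16 5 89 14 23,
    Box 4092 41 6 8 31 23 15 5 88 14 34, Box 4180 41 6 8 32 23 15 5 87 14 33,
    Box 4304 42 6 7 32 26 17 5 87 14 40, Box 4348 36 7 8 31 23 13 4 76 13 95,
    Box 4385 41 6 5 32 30 21 5 86 14 32, Box 4419 35 7 5 31 29 18 5 84 13 91,
    Box 4432 35 7 5 31 29 18 5 84 13 90, Box 4436 35 7 4 31 31 21 6 91 13 89,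
    Box 4440 35 7 4 31 31 21 6 91 13 89, Box 4443 35 7 4 31 31 21 6 91 13 89,
    Box 4446 35 7 4 31 31 21 6 91 13 89, Box 4449 35 7 4 31 31 21 6 91 13 89,
    Box 4452 35 7 4 31 31 21 6 91 13 89, Box 4455 35 7 4 31 31 21 6 91 13 89,
    Box 4458 35 7 4 31 31 21 6 91 13 89, Box 4461 35 7 4 31 31 21 6 91 13 89,
    Box 4463 35 7 4 31 32 21 6 91 13 89, Box 4465 35 7 4 31 32 21 6 91 13 89,
    Box 4467 35 7 4 31 32 21 6 91 13 89, Box 4479 36 7 8 31 24 13 4 75 13 93,
    Box 4535 36 7 8 32 24 13 5 83 13 96, Skip 10000 21 77 9 88]]
  281 602041 602068"
  by code_simp

lemma certificate_4_5: "cells_ok 4 True 281 602041 602068 [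
  Cell 2 590119 590147 6021 5901 33250 18003 33445 12714 6271 106407 91667 [
    Box 1922 9 9 0 1 1 33 9 122 12 25, Box 2527 35 4 8 25 18 14 8 122 14 13,
    Box 2892 40 4 9 28 18 14 6 105 14 43, Box 3158 38 5 10 28 17 12 5 94 14 27,
    Box 3361 52 3 8 32 22 19 4 87 15 15, Box 3520 48 4 11 32 18 14 5 94 14 87,
    Box 3662 49 4 8 32 23 18 6 102 14 94, Box 3795 44 5 9 31 21 15 5 91 14 61,
    Box 3893 45 5 10 32 20 14 5 90 14 65, Box 3971 39 6 7 31 24 16 5 88 14 25,
    Box 4019 39 6 7 31 24 16 5 87 14 24, Box 4115 41 6 8 32 23 15 5 87 14 35,
    Box 4202 41 6 8 32 23 15 4 78 14 36, Box 4278 42 6 7 32 25 17 5 86 14 39,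
    Box 4333 41 6 7 32 25 17 4 77 14 35, Box 4368 41 6 5 32 29 21 5 85 14 34,
    Box 4400 35 7 5 31 28 18 4 75 13 93, Box 4430 35 7 5 31 29 18 5 83 13 93,
    Box 4458 35 7 5 31 29 18 5 83 13 93, Box 4471 35 7 4 31 32 21 6 90 13 92,
    Box 4483 35 7 4 31 32 21 6 90 13 92, Box 4495 35 7 4 31 32 21 6 90 13 92,
    Box 4506 35 7 4 31 32 21 6 90 13 92, Box 4517 35 7 4 31 32 21 4 74 13 92,
    Box 4622 37 7 7 32 26 15 5 82 14 5, Box 4712 37 7 7 32 26 15 4 73 14 4, Skip 10000 21 25 10 2],
  Cell 2 578433 578462 5902 5784 33058 17751 33251 12672 6139 106273 94091 [
    Box 1957 9 9 0 1 1 34 8 114 12 30, Box 2573 35 4 8 25 18 14 7 113 14 18,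
    Box 2951 40 4 10 28 17 13 6 104 14 49, Box 3238 44 4 11 30 17 13 6 103 14 72,
    Box 3440 40 5 8 29 21 15 6 100 14 44, Box 3584 41 5 7 30 23 17 5 91 14 49,
    Box 3733 43 5 8 31 22 16 5 90 14 60, Box 3856 44 5 7 31 24 18 5 89 14 65,
    Box 3952 45 5 10 32 20 14 5 89 14 69, Box 4039 39 6 7 31 24 16 4 78 14 30,
    Box 4108 41 6 8 32 23 15 4 78 14 36, Box 4198 40 6 8 31 23 15 4 77 14 36,
    Box 4259 40 6 8 32 23 15 5 85 14 35, Box 4337 41 6 7 32 25 17 5 85 14 41,
    Box 4364 40 6 4 32 32 24 5 84 14 34, Box 4427 35 7 8 31 23 13 6 90 13 99,
    Box 4488 35 7 6 31 27 16 5 82 13 99, Box 4531 35 7 6 31 27 16 6 89 13 98,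
    Box 4573 35 7 6 31 27 16 5 81 13 98, Box 4645 37 7 7 32 26 15 4 73 14 7,
    Box 4711 37 7 7 33 26 15 4 72 14 7, Box 4806 37 7 6 33 28 17 5 80 14 9, Skip 10000 21 13 10 16],
  Cell 4 555752 555781 5785 5557 32678 17500 33059 12635 5883 106141 96559 [
    Box 1960 8 9 0 1 1 30 7 105 12 25, Box 2599 30 5 8 24 17 12 7 109 13 88,
    Box 2983 40 4 11 28 16 12 6 102 14 53, Box 3235 32 6 9 26 18 11 6 97 13 96,
    Box 3424 51 3 10 32 19 16 5 93 15 20, Box 3595 41 5 9 30 20 14 5 89 14 54,
    Box 3691 41 5 6 30 25 19 5 88 14 53, Box 3820 43 5 8 31 22 16 5 88 14 65,
    Box 3930 44 5 7 31 24 18 5 87 14 70, Box 3974 44 5 6 32 26 20 5 87 14 67,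
    Box 4013 32 7 7 29 23 13 5 83 13 87, Box 4099 39 6 7 31 24 16 4 76 14 35,
    Box 4166 39 6 6 31 26 18 5 84 14 35, Box 4243 40 6 8 32 23 15 4 75 14 40,
    Box 4306 40 6 8 32 23 15 4 75 14 40, Box 4351 40 6 8 32 23 15 5 83 14 40,
    Box 4390 34 7 7 30 24 14 5 81 13 98, Box 4412 34 7 7 31 24 14 6 88 13 97,
    Box 4432 34 7 7 31 24 14 5 80 13 97, Box 4450 34 7 7 31 25 14 5 80 13 97,
    Box 4485 35 7 6 31 27 16 5 80 14 2, Box 4517 35 7 6 31 27 16 5 80 14 2, Box 4547 35 7 6 31 27 16 5 80 14 2,
    Box 4575 35 7 6 31 27 16 6 87 14 2, Box 4601 35 7 6 31 27 16 5 79 14 2, Box 4625 35 7 6 32 27 16 5 79 14 2,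
    Box 4647 35 7 6 32 27 16 5 79 14 2, Box 4667 35 7 6 32 27 16 5 79 14 2, Box 4728 36 7 7 32 26 15 6 86 14 8,
    Box 4782 36 7 7 32 26 15 5 78 14 7, Box 4837 36 7 5 33 30 19 5 78 14 7,
    Box 4885 30 8 7 31 26 12 5 76 13 64, Box 4930 30 8 7 32 26 12 4 68 13 64,
    Box 4973 30 8 7 32 26 12 5 75 13 63, Box 5012 30 8 7 32 26 12 4 67 13 62,
    Box 5044 31 8 6 32 28 14 4 67 13 65, Skip 10000 20 70 10 45]]
  289 555752 555781"
  by code_simp

lemma certificate_4_6: "cells_ok 4 True 289 555752 555781 [
  Cell 4 533960 533989 5558 5339 32307 17008 32680 12573 5640 105886 101626 [
    Box 2038 8 9 0 1 1 33 8 109 12 36, Box 2693 25 6 9 22 15 9 6 97 13 63,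
    Box 3082 40 4 10 28 17 13 5 91 14 62, Box 3349 37 5 9 28 19 13 5 88 14 41,
    Box 3550 45 4 8 31 21 17 5 89 14 92, Box 3698 35 6 9 28 19 12 6 93 14 22,
    Box 3823 41 5 7 30 23 17 5 86 14 64, Box 3930 43 5 8 31 22 16 4 77 14 73,
    Box 4043 37 6 8 30 22 14 5 83 14 35, Box 4104 37 6 8 30 22 14 4 74 14 33,
    Box 4196 38 6 7 31 24 16 4 74 14 40, Box 4256 38 6 6 31 26 18 4 73 14 39,
    Box 4338 39 6 8 31 23 15 4 73 14 45, Box 4401 39 6 8 32 23 15 5 81 14 45,
    Box 4457 34 7 7 31 25 14 5 79 14 7, Box 4508 34 7 7 31 25 14 5 78 14 7, Box 4554 34 7 7 31 25 14 5 78 14 7,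
    Box 4621 34 7 6 31 27 16 5 78 14 8, Box 4671 34 7 6 31 27 16 5 77 14 7, Box 4719 34 7 4 31 32 21 5 77 14 7,
    Box 4767 36 7 7 32 26 15 5 77 14 15, Box 4835 35 7 7 32 26 15 5 76 14 12,
    Box 4904 35 7 7 32 26 15 5 76 14 12, Box 4923 28 8 6 31 27 13 5 74 13 62,
    Box 4933 28 8 6 31 27 13 4 66 13 61, Box 4944 28 8 6 31 27 13 4 66 13 61,
    Box 4957 28 8 5 31 29 15 4 66 13 61, Box 4971 28 8 5 31 29 15 4 66 13 61,
    Box 5030 29 8 7 32 26 12 4 66 13 68, Box 5081 29 8 7 32 26 12 5 73 13 67,
    Box 5097 28 8 3 31 35 21 4 65 13 60, Box 5169 29 8 4 32 32 18 4 65 13 67,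
    Box 5277 30 8 6 33 29 14 4 64 13 72, Box 5393 30 8 5 33 31 16 4 63 13 71, Skip 10000 19 90 10 74],
  Cell 6 502864 502892 5340 5028 31762 16529 32308 12530 5294 105642 106871 [
    Box 2084 7 9 0 1 1 29 7 99 12 37, Box 2756 20 7 9 20 14 7 6 92 13 34, Box 3142 33 5 9 26 17 12 6 94 14 27,
    Box 3414 36 5 8 28 20 14 6 93 14 45, Box 3592 43 4 7 30 23 18 5 86 14 91,
    Box 3747 39 5 8 29 21 15 4 75 14 62, Box 3874 40 5 7 30 23 17 5 83 14 68,
    Box 3991 42 5 8 31 22 16 4 74 14 78, Box 4095 37 6 8 30 22 14 6 88 14 42,
    Box 4188 37 6 8 30 22 14 5 80 14 43, Box 4305 38 6 7 31 24 16 4 71 14 50,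
    Box 4385 38 6 6 31 26 18 4 70 14 49, Box 4419 32 7 6 30 25 15 4 69 14 5,
    Box 4451 32 7 6 30 26 15 5 76 14 5, Box 4480 32 7 6 30 26 15 5 76 14 5, Box 4507 32 7 6 30 26 15 5 76 14 5,
    Box 4531 32 7 6 30 26 15 5 76 14 5, Box 4605 33 7 7 31 25 14 4 68 14 12,
    Box 4659 33 7 7 31 25 14 5 75 14 11, Box 4716 34 7 6 31 27 16 5 75 14 15,
    Box 4768 34 7 6 32 27 16 4 67 14 15, Box 4815 34 7 6 32 27 16 5 74 14 15,
    Box 4857 34 7 6 32 27 16 5 74 14 15, Box 4895 34 7 6 32 28 16 4 66 14 15,
    Box 4929 34 7 6 32 28 16 4 66 14 14, Box 4983 28 8 6 31 27 13 4 64 13 72,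
    Box 5034 28 8 6 31 27 13 4 64 13 71, Box 5093 28 8 5 31 29 15 4 63 13 71,
    Box 5160 28 8 5 32 30 15 4 63 13 71, Box 5205 28 8 5 32 30 15 4 62 13 69,
    Box 5258 28 8 5 32 30 15 4 62 13 69, Box 5322 28 8 4 32 33 18 4 62 13 69,
    Box 5435 29 8 5 33 31 16 4 61 13 75, Box 5560 29 8 5 34 32 16 4 60 13 74,
    Box 5689 29 8 4 34 35 19 4 59 13 72, Box 5798 28 8 2 34 44 28 4 58 13 64, Skip 10000 19 28 11 18],
  Cell 6 473579 473606 5029 4735 31234 15833 31763 12500 4970 105296 115078 [
    Box 2203 7 9 0 1 1 32 7 96 12 52, Box 2905 15 8 5 18 17 8 7 94 13 11, Box 3298 32 5 6 26 22 16 5 83 14 36,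
    Box 3581 35 5 8 28 20 14 5 82 14 55, Box 3801 37 5 6 29 24 18 5 81 14 67,
    Box 3984 39 5 9 30 20 14 4 72 14 78, Box 4145 35 6 7 29 23 15 5 78 14 47,
    Box 4316 36 6 8 30 22 14 5 77 14 55, Box 4399 35 6 6 30 25 17 5 76 14 47,
    Box 4495 36 6 4 31 31 23 4 68 14 53, Box 4622 31 7 6 30 26 15 4 66 14 17,
    Box 4708 31 7 4 30 31 20 4 65 14 15, Box 4819 32 7 7 31 25 14 5 72 14 21,
    Box 4966 33 7 6 32 28 16 4 64 14 28, Box 5046 26 8 7 30 25 11 4 62 13 75,
    Box 5109 32 7 3 32 36 25 5 70 14 18, Box 5230 27 8 6 32 28 13 4 61 13 81,
    Box 5362 27 8 5 32 30 15 4 60 13 80, Box 5487 27 8 4 33 33 18 4 59 13 78,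
    Box 5674 28 8 5 34 32 16 4 58 13 84, Box 5854 28 8 4 35 35 19 3 49 13 81,
    Box 6056 27 8 2 35 44 28 4 55 13 73, Box 6349 21 9 2 36 43 21 3 45 13 24, Skip 10000 18 32 11 63]]
  305 473579 473606"
  by code_simp

lemma certificate_4_7: "cells_ok 4 True 305 473579 473606 [
  Cell 10 428511 428537 4737 4285 30385 15167 31235 12515 4476 104973 123700 [
    Box 2309 7 9 0 1 1 37 6 84 12 63, Box 3018 18 7 10 20 13 6 5 77 13 48, Box 3422 31 5 7 26 20 14 5 78 14 43,
    Box 3712 34 5 6 27 23 17 5 77 14 62, Box 3932 25 7 7 26 20 11 5 73 13 94,
    Box 4111 33 6 8 29 21 13 5 74 14 46, Box 4265 33 6 8 29 21 13 5 73 14 49,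
    Box 4411 34 6 7 30 23 15 4 65 14 56, Box 4511 28 7 5 28 26 16 4 63 14 11,
    Box 4581 34 6 5 30 28 19 4 64 14 54, Box 4682 29 7 7 29 24 13 4 62 14 17,
    Box 4800 30 7 5 30 28 17 4 61 14 23, Box 4907 30 7 4 30 31 20 4 61 14 23,
    Box 4987 31 7 7 31 25 14 4 60 14 26, Box 5099 31 7 5 32 29 18 4 60 14 28,
    Box 5168 25 8 5 30 29 14 4 58 13 80, Box 5231 25 8 5 31 29 14 3 50 13 79,
    Box 5296 24 8 2 31 39 25 4 57 13 74, Box 5441 26 8 6 32 28 13 3 49 13 87,
    Box 5598 26 8 5 33 31 15 3 48 13 86, Box 5760 26 8 4 33 34 18 3 47 13 84,
    Box 5955 26 8 3 34 38 22 3 46 13 83, Box 6207 20 9 3 35 38 16 4 50 13 33,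
    Box 6553 20 9 2 37 44 21 3 41 13 30, Box 7088 20 9 2 40 47 22 3 38 13 25,
    Box 8128 14 10 0 1 1 29 2 24 12 64, Skip 10000 15 26 12 41],
  Cell 15 368822 368846 4286 3688 29185 14106 30386 12645 3829 104478 139015 [
    Box 2486 6 9 0 1 1 38 5 71 12 77, Box 3276 13 8 8 18 14 5 5 69 13 30, Box 3710 30 5 7 26 20 14 4 64 14 60,
    Box 4020 33 5 6 28 23 17 4 63 14 79, Box 4277 24 7 7 26 21 11 4 59 14 9,
    Box 4488 31 6 6 29 24 16 3 52 14 60, Box 4647 20 8 6 26 23 10 4 56 13 74,
    Box 4838 27 7 6 29 25 14 4 57 14 28, Box 4991 27 7 4 30 30 19 4 56 14 27,
    Box 5166 29 7 6 31 27 15 3 48 14 39, Box 5318 22 8 5 30 28 13 4 53 13 85,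
    Box 5467 22 8 3 30 34 19 4 52 13 84, Box 5659 23 8 3 32 35 20 4 51 13 90,
    Box 5887 24 8 5 33 32 15 3 43 13 95, Box 6155 24 8 2 34 43 27 2 34 13 93,
    Box 6495 17 9 2 35 42 19 3 38 13 34, Box 6991 17 9 2 38 45 20 2 29 13 30,
    Box 7959 11 10 0 1 1 25 2 23 12 70, Box 10000 15 10 0 1 1 33 1 0 12 72],
  Cell 20 301965 301987 3689 3019 27708 12640 29186 13101 3112 103831 164267 [
    Box 2792 5 9 0 1 1 39 6 69 13 2, Box 3714 16 7 7 20 17 8 4 55 13 89, Box 4258 9 9 2 20 26 10 4 51 13 26,
    Box 4690 16 8 5 25 23 10 3 44 13 82, Box 5034 11 9 5 24 24 6 4 48 13 38,
    Box 5381 25 7 5 30 28 16 2 35 14 48, Box 5750 26 7 5 32 30 17 3 41 14 55,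
    Box 6180 20 8 4 33 34 16 2 31 14 4, Box 6738 14 9 2 35 42 18 3 34 13 49, Box 7702 8 10 0 1 1 20 1 16 12 88,
    Box 9857 11 10 0 1 1 30 1 4 12 94, Box 10000 14 10 0 1 1 14 1 0 10 83],
  Cell 20 247228 247247 3020 2472 26358 10900 27709 14236 2534 103115 202346 [
    Box 3278 4 9 0 1 1 38 5 56 13 41, Box 4556 7 9 5 20 20 4 5 51 13 58, Box 5497 4 10 0 1 1 4 3 35 13 24,
    Box 6477 5 10 0 1 1 14 3 31 13 26, Box 7942 6 10 0 1 1 17 1 14 13 26, Box 10000 9 10 0 1 1 28 1 0 12 92],
  Cell 20 202413 202430 2473 2024 25121 9383 26359 16018 2065 102536 245613 [
    Box 3847 4 9 0 1 1 46 4 44 13 86, Box 5709 3 10 0 1 1 4 3 32 13 66, Box 7576 4 10 0 1 1 10 2 19 13 62,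
    Box 10000 6 10 0 1 1 19 1 0 13 21],
  Cell 10 183150 183167 2025 1831 24542 8061 25123 18492 1865 102067 294131 [
    Box 4474 3 9 0 1 1 39 3 35 14 24, Box 7118 3 10 0 1 1 7 2 20 14 7, Box 10000 5 10 0 1 1 19 1 0 13 62]]
  400 183150 183167"
  by code_simp

lemma certificate_6_1: "cells_ok 6 True 75 4723665 4723666 [
  Cell 15 4065696 4065700 47237 40656 65936 67146 70352 2800 68509 189527 542 [
    Box 563 91 5 22 32 15 9 13 494 5 95, Skip 10000 17 99 1 2],
  Cell 15 3499376 3499383 40657 34993 61910 61661 65937 2800 53829 168512 1118 [
    Box 550 84 4 12 32 22 16 12 427 7 21, Skip 10000 25 6 1 38],
  Cell 15 3011940 3011950 34994 30119 58233 56524 61911 13659 43100 153832 2059 [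
    Box 616 78 4 28 32 11 8 11 369 8 24, Skip 10000 29 23 1 81],
  Cell 20 2465967 2465984 30120 24659 53814 51723 58234 16181 32729 143103 3487 [
    Box 403 70 3 14 31 17 14 11 327 8 94, Box 683 72 4 18 32 14 11 11 321 8 97,
    Box 1006 75 4 24 33 12 9 10 302 9 5, Skip 10000 24 36 2 46],
  Cell 20 2018962 2018984 24660 20189 49881 45825 53815 17833 25296 132732 6389 [
    Box 472 62 3 22 30 11 9 10 276 9 84, Box 741 69 3 24 32 11 9 10 276 10 15,
    Box 939 68 4 30 32 9 7 10 271 10 6, Skip 10000 34 8 3 21],
  Cell 15 1737736 1737757 20190 17377 47212 40477 49882 18153 21031 125298 10760 [
    Box 617 60 2 18 30 12 11 11 268 10 94, Box 891 63 3 16 31 14 12 9 242 11 5,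
    Box 1096 66 3 24 32 11 9 9 240 11 18, Skip 10000 34 93 3 83],
  Cell 15 1495683 1495703 17378 14956 44759 36808 47213 17826 17586 121034 15234 [
    Box 680 54 2 24 29 9 8 10 235 11 37, Box 945 58 3 24 30 10 8 10 233 11 54,
    Box 1178 63 3 20 32 12 10 8 210 11 78, Box 1304 64 3 18 32 13 11 9 220 11 81, Skip 10000 34 61 4 52],
  Cell 15 1287346 1287365 14958 12873 42500 33420 44760 17193 14774 117589 20925 [
    Box 769 50 2 26 28 8 7 9 206 11 78, Box 1075 55 3 20 30 11 9 8 194 12 6,
    Box 1252 55 4 30 30 8 6 9 202 12 4, Box 1405 61 3 22 32 11 9 9 203 12 35,
    Box 1504 62 3 16 32 14 12 9 202 12 39, Skip 10000 34 93 5 26],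
  Cell 10 1164838 1164857 12874 11648 41093 30292 42501 16383 13183 114777 28006 [
    Box 927 47 2 30 27 7 6 10 205 12 33, Box 1287 56 2 14 30 14 13 8 185 12 80,
    Box 1523 57 3 24 31 10 8 8 183 12 83, Box 1722 60 3 22 32 11 9 8 182 12 98, Skip 10000 33 56 5 78],
  Cell 10 1053989 1054007 11649 10539 39759 28348 41094 15797 11780 113185 33588 [
    Box 995 44 2 28 26 7 6 9 185 12 52, Box 1392 54 2 24 30 9 8 9 185 13 8,
    Box 1633 55 3 18 31 12 10 8 173 13 11, Box 1817 61 2 24 32 10 9 7 163 13 43, Skip 10000 34 83 6 33],
  Cell 10 953688 953706 10541 9536 38494 26512 39761 15204 10541 111784 39921 [
    Box 1087 47 0 24 27 8 8 8 168 13 10, Box 1490 48 3 18 28 11 9 8 164 13 11,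
    Box 1773 57 2 22 31 10 9 8 165 13 60, Box 1923 55 3 16 31 13 11 7 153 13 47,
    Box 2061 57 3 24 32 10 8 8 162 13 57, Skip 10000 33 50 6 91],
  Cell 10 862932 862949 9538 8629 37294 24778 38495 14628 9443 110544 47056 [
    Box 1173 44 0 14 26 12 12 8 159 13 27, Box 1662 51 2 20 29 10 9 8 157 13 64,
    Box 1900 51 3 22 30 10 8 7 145 13 61, Box 2063 54 3 20 31 11 9 7 145 13 73,
    Box 2226 59 2 16 32 14 12 7 145 14 5, Box 2319 56 3 24 32 10 8 7 143 13 87, Skip 10000 32 36 7 51],
  Cell 10 780813 780829 8630 7808 36153 23141 37295 14089 8469 109446 55047 [
    Box 1299 43 0 22 26 8 8 8 151 13 55, Box 1803 49 2 26 29 8 7 6 130 13 86,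
    Box 2081 53 2 24 30 9 8 6 129 14 8, Box 2302 53 3 20 31 11 9 6 127 14 6,
    Box 2453 58 2 11 32 18 16 6 127 14 33, Box 2584 56 3 24 32 10 8 6 125 14 20,
    Box 2716 61 2 10 33 20 18 6 126 14 48, Skip 10000 29 93 8 13],
  Cell 15 672051 672067 7809 6720 34547 21600 36154 13605 7204 108471 63943 [
    Box 1383 40 0 18 25 9 9 7 130 13 64, Box 1868 45 2 16 28 11 10 7 128 13 91,
    Box 2145 53 1 9 30 19 18 5 110 14 38, Box 2319 52 2 10 30 18 16 6 118 14 31,
    Box 2484 55 2 22 31 10 9 5 108 14 47, Box 2627 54 3 18 31 12 10 6 116 14 37,
    Box 2724 54 3 16 32 13 11 6 115 14 39, Box 2799 56 3 24 32 10 8 6 115 14 44,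
    Box 2873 56 3 24 32 10 8 5 105 14 47, Box 2950 60 2 10 33 19 18 6 115 14 72,
    Box 3090 59 3 20 33 12 10 5 104 14 63, Skip 10000 29 50 9 12]]
  270 672051 672067"
  by code_simp

lemma certificate_6_2: "cells_ok 6 True 270 672051 672067 [
  Cell 15 578439 578454 6721 5784 33058 19455 34548 13016 6139 107206 79095 [
    Box 1552 36 0 22 24 7 7 6 111 13 85, Box 2157 44 2 28 28 7 6 7 118 14 32,
    Box 2466 48 2 22 29 9 8 6 108 14 54, Box 2694 51 2 10 30 18 16 5 99 14 72,
    Box 2897 54 2 14 31 14 13 5 98 14 88, Box 3095 57 2 12 32 17 15 5 97 15 3,
    Box 3220 61 1 8 33 23 22 4 88 15 27, Box 3370 59 2 10 33 20 18 5 96 15 14,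
    Box 3502 64 1 6 34 28 27 5 96 15 42, Box 3671 62 2 9 34 22 20 4 85 15 29, Skip 10000 27 66 10 16],
  Cell 20 473585 473600 5785 4735 31234 17500 33059 12635 4970 106141 96559 [
    Box 1738 33 0 30 22 5 5 7 107 14 5, Box 2372 40 2 22 26 8 7 5 89 14 47,
    Box 2748 49 1 10 29 17 16 5 89 15 3, Box 3026 46 3 18 29 11 9 5 87 14 82,
    Box 3231 52 2 12 31 16 14 5 87 15 17, Box 3463 55 2 10 32 19 17 4 77 15 35,
    Box 3634 60 1 6 33 27 26 4 77 15 64, Box 3819 58 2 10 33 20 18 4 76 15 51,
    Box 4058 61 2 9 34 22 20 4 75 15 67, Box 4241 57 3 9 34 22 19 4 73 15 42,
    Box 4369 53 4 7 33 25 21 3 62 15 15, Box 4536 54 4 9 34 22 18 3 61 15 21, Skip 10000 25 64 11 63],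
  Cell 20 387738 387753 4736 3877 29576 15163 31235 12515 4033 104972 123700 [
    Box 2050 30 0 28 21 5 5 6 89 14 41, Box 2834 44 0 7 27 20 20 4 73 15 32,
    Box 3338 48 1 10 29 17 16 4 71 15 54, Box 3737 49 2 10 30 18 16 4 69 15 58,
    Box 4130 54 2 11 32 18 16 4 67 15 86, Box 4443 52 3 9 32 21 18 4 65 15 69,
    Box 4715 49 4 10 32 20 16 4 63 15 47, Box 4983 45 5 9 32 22 16 3 52 15 22,
    Box 5178 44 5 5 32 30 24 3 51 15 14, Box 5458 42 6 9 33 23 15 3 49 14 97,
    Box 5678 36 7 5 32 30 20 3 47 14 56, Skip 10000 23 26 13 21],
  Cell 20 317452 317467 3878 3174 28065 13112 29577 12913 3278 104035 155541 [
    Box 2400 12 6 4 13 15 11 6 75 13 54, Box 3406 44 0 26 27 7 7 3 56 15 85,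
    Box 4072 52 0 9 30 19 19 3 54 16 33, Box 4589 44 3 8 30 21 18 3 50 15 77,
    Box 5077 43 4 9 31 21 16 3 48 15 68, Box 5546 40 5 6 31 27 21 3 45 15 44,
    Box 6069 37 6 6 33 29 20 2 34 15 19, Box 6698 33 7 5 35 34 21 2 30 14 85,
    Box 7533 27 8 4 39 41 22 1 18 14 33, Skip 10000 19 76 14 88],
  Cell 20 259907 259921 3175 2599 26685 11313 28066 13893 2668 103280 192345 [
    Box 2830 4 9 0 1 1 35 5 59 13 32, Box 4023 42 0 26 27 7 7 3 49 16 23, Box 4888 43 2 9 29 19 17 3 45 16 24,
    Box 5641 34 5 7 29 24 17 2 33 15 56, Box 6476 32 6 6 32 29 19 2 29 15 37,
    Box 7507 27 7 4 37 39 24 1 17 14 92, Box 9376 12 10 0 1 1 36 1 8 13 54, Skip 10000 17 77 16 66],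
  Cell 20 212793 212806 2600 2127 25421 9744 26686 15509 2173 102670 234304 [
    Box 3349 4 9 0 1 1 44 4 47 13 78, Box 4737 41 0 20 26 9 9 3 42 16 61, Box 5840 27 5 6 27 24 17 2 29 15 56,
    Box 7030 31 5 3 32 40 32 1 17 15 79, Box 8743 11 9 0 1 1 48 1 10 14 6, Box 10000 18 10 0 1 1 48 1 0 13 1],
  Cell 15 183152 183164 2129 1831 24542 8375 25422 17807 1865 102176 281511 [
    Box 3901 3 9 0 1 1 39 3 37 14 15, Box 5650 16 6 4 22 25 16 2 27 15 19, Box 7301 20 6 3 31 38 26 1 15 15 44,
    Box 10000 7 10 0 1 1 29 1 0 14 0]]
  400 183152 183164"
  by code_simp

lemma certificate_8_1: "cells_ok 8 False 75 4723665 4723666 [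
  Cell 10 4274148 4274151 47237 42741 67362 67146 70352 2800 74645 189527 542 [
    Box 308 102 0 5 33 40 40 14 563 6 66, Skip 10000 29 33 0 91],
  Cell 10 3867409 3867413 42742 38674 64553 63451 67363 2800 63062 174649 891 [
    Box 361 95 0 6 33 35 35 13 498 7 40, Skip 10000 31 26 1 13],
  Cell 10 3499376 3499381 38675 34993 61910 59913 64554 2800 53829 163066 1386 [
    Box 416 90 0 6 33 34 34 12 444 8 11, Skip 10000 33 13 1 38],
  Cell 15 3011940 3011948 34994 30119 58233 56524 61911 13659 43100 153832 2059 [
    Box 272 80 0 5 32 35 35 13 411 8 42, Box 413 84 0 4 33 40 40 12 395 8 56,
    Box 630 88 0 5 34 37 37 11 377 8 69, Skip 10000 28 58 1 81],
  Cell 10 2725316 2725324 30120 27253 55959 51723 58234 16181 37462 143103 3487 [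
    Box 431 77 0 6 32 31 31 12 372 9 48, Box 830 84 0 6 34 33 33 11 352 9 71, Skip 10000 25 46 2 12],
  Cell 10 2465967 2465976 27254 24659 53814 48704 55960 17211 32729 137465 4778 [
    Box 483 74 0 7 32 28 28 11 336 10 1, Box 719 78 0 6 33 31 31 11 333 10 13, Skip 10000 34 8 2 46],
  Cell 10 2231299 2231308 24660 22312 51791 45825 53815 17833 28720 132732 6389 [
    Box 478 68 0 6 31 29 29 11 315 10 34, Box 746 75 0 6 33 31 31 11 314 10 62,
    Box 1033 79 0 7 34 29 29 10 297 10 77, Skip 10000 27 23 2 82],
  Cell 10 2018962 2018972 22314 20189 49881 43085 51792 18125 25296 128724 8367 [
    Box 545 66 0 7 31 26 26 11 297 10 81, Box 741 70 0 5 32 33 33 10 283 10 97,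
    Box 897 73 0 5 33 33 33 10 282 11 9, Box 1126 77 0 5 34 34 34 11 292 11 24, Skip 10000 28 42 3 21],
  Cell 10 1826832 1826842 20190 18268 48077 40477 49882 18153 22351 125298 10760 [
    Box 568 61 0 6 30 27 27 11 279 11 9, Box 811 68 0 5 32 32 32 9 255 11 41,
    Box 990 72 0 6 33 30 30 9 254 11 56, Box 1041 71 0 5 33 33 33 10 265 11 52, Skip 10000 34 71 3 62],
  Cell 10 1652985 1652996 18269 16529 46372 38000 48078 17976 19802 122353 13616 [
    Box 653 60 0 9 30 21 21 10 253 11 53, Box 926 67 0 7 32 26 26 9 241 11 86,
    Box 1002 67 0 5 32 32 32 10 251 11 84, Box 1131 70 0 5 33 32 32 10 251 11 98,
    Box 1181 70 0 5 33 32 32 10 250 11 97, Skip 10000 34 30 4 6],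
  Cell 6 1556722 1556734 16530 15567 45393 35647 46373 17642 18437 119804 16987 [
    Box 718 56 0 5 29 29 29 11 255 11 85, Box 1070 66 0 6 32 28 28 10 245 12 33,
    Box 1285 69 0 5 33 32 32 10 243 12 45, Skip 10000 33 66 4 33],
  Cell 6 1466065 1466077 15568 14660 44447 34296 45394 17384 17178 118439 19278 [
    Box 781 56 0 9 29 20 20 10 237 12 11, Box 1056 62 0 5 31 30 30 9 225 12 40,
    Box 1219 65 0 4 32 35 35 9 224 12 53, Box 1378 68 0 6 33 29 29 9 223 12 66, Skip 10000 33 44 4 61],
  Cell 6 1380688 1380700 14661 13806 43531 32986 44448 17093 16017 117180 21785 [
    Box 833 55 0 10 29 18 18 10 229 12 31, Box 1120 61 0 5 31 30 30 9 218 12 61,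
    Box 1287 64 0 5 32 31 31 9 217 12 74, Box 1484 68 0 7 33 26 26 9 216 12 92, Skip 10000 33 3 4 91],
  Cell 6 1300282 1300295 13807 13002 42645 31718 43532 16776 14945 116019 24517 [
    Box 841 51 0 7 28 22 22 9 210 12 34, Box 1196 61 0 6 31 27 27 9 211 12 85,
    Box 1393 64 0 6 32 28 28 9 210 12 99, Box 1460 64 0 5 32 31 31 8 198 12 98,
    Box 1601 67 0 6 33 28 28 8 197 13 12, Skip 10000 32 50 5 21],
  Cell 6 1224559 1224572 13003 12245 41787 30491 42646 16441 13953 114947 27487 [
    Box 911 51 0 10 28 17 17 10 214 12 58, Box 1270 60 0 7 31 24 24 9 204 13 4,
    Box 1467 63 0 6 32 27 27 9 203 13 18, Box 1538 63 0 5 32 30 30 9 202 13 17,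
    Box 1680 66 0 5 33 31 31 8 191 13 32, Skip 10000 32 82 5 52],
  Cell 6 1153246 1153259 12246 11532 40957 29306 41788 16092 13035 113955 30707 [
    Box 986 51 0 11 28 16 16 9 198 12 82, Box 1270 56 0 5 30 29 29 8 186 13 6,
    Box 1428 59 0 4 31 33 33 8 186 13 21, Box 1608 63 0 6 32 27 27 8 185 13 41,
    Box 1677 63 0 5 32 30 30 9 195 13 40, Skip 10000 34 78 5 84],
  Cell 6 1086086 1086099 11533 10860 40152 28159 40958 15737 12183 113037 34187 [
    Box 996 47 0 7 27 21 21 9 190 12 81, Box 1358 56 0 6 30 26 26 8 180 13 29,
    Box 1545 59 0 5 31 29 29 7 169 13 44, Box 1709 62 0 5 32 30 30 8 179 13 59,
    Box 1772 62 0 4 32 34 34 8 178 13 58, Skip 10000 34 77 6 17],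
  Cell 6 1022837 1022850 10861 10228 39373 27050 40153 15381 11393 112185 37939 [
    Box 1073 47 0 18 27 10 10 8 175 13 3, Box 1466 56 0 7 30 23 23 8 175 13 51,
    Box 1666 59 0 5 31 29 29 8 174 13 66, Box 1847 62 0 5 32 30 30 8 173 13 81,
    Box 1921 62 0 4 32 34 34 8 172 13 80, Skip 10000 33 83 6 50]]
  228 1022837 1022850"
  by code_simp

lemma certificate_8_2: "cells_ok 8 False 228 1022837 1022850 [
  Cell 6 963271 963284 10229 9632 38618 25980 39374 15028 10658 111395 41975 [
    Box 1156 47 0 24 27 8 8 9 179 13 25, Box 1559 55 0 6 30 25 25 8 169 13 68,
    Box 1764 58 0 5 31 29 29 7 158 13 82, Box 1942 61 0 5 32 30 30 7 157 13 97,
    Box 2014 61 0 4 32 34 34 7 156 13 96, Skip 10000 33 99 6 85],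
  Cell 10 871603 871616 9633 8716 37411 24945 38619 14684 9548 110660 46305 [
    Box 1175 44 0 14 26 12 12 8 160 13 24, Box 1556 52 0 7 29 22 22 7 150 13 68,
    Box 1745 55 0 4 30 32 32 8 159 13 84, Box 1899 58 0 5 31 29 29 7 149 13 99,
    Box 1953 58 0 4 31 33 33 8 158 13 98, Box 2083 61 0 6 32 27 27 6 138 14 14,
    Box 2136 61 0 5 32 30 30 6 137 14 13, Skip 10000 34 85 7 45],
  Cell 10 788659 788671 8717 7886 36265 23301 37412 14140 8561 109550 54208 [
    Box 1300 43 0 22 26 8 8 9 160 13 51, Box 1726 51 0 5 29 27 27 7 142 13 96,
    Box 1938 54 0 5 30 28 28 7 141 14 12, Box 2104 57 0 5 31 29 29 7 140 14 27,
    Box 2174 57 0 4 31 33 33 7 140 14 27, Box 2316 60 0 6 32 26 26 6 130 14 43, Skip 10000 34 83 8 7],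
  Cell 10 713608 713620 7887 7136 35175 21749 36266 13650 7684 108563 63011 [
    Box 1400 40 0 16 25 10 10 8 143 13 65, Box 1929 51 0 8 29 20 20 6 125 14 29,
    Box 2184 54 0 5 30 28 28 7 133 14 44, Box 2389 57 0 5 31 29 29 6 123 14 60,
    Box 2591 60 0 7 32 24 24 6 122 14 75, Skip 10000 33 63 8 72],
  Cell 15 614208 614219 7137 6142 33640 20290 35176 13229 6543 107686 72766 [
    Box 1491 37 0 12 24 12 12 6 115 13 73, Box 2026 48 0 7 28 21 21 7 123 14 38,
    Box 2351 53 0 7 30 22 22 6 114 14 67, Box 2584 56 0 7 31 23 23 6 113 14 83,
    Box 2688 56 0 4 31 32 32 6 112 14 82, Box 2856 59 0 5 32 29 29 5 102 14 98,
    Box 2942 59 0 4 32 33 33 6 111 14 97, Box 3122 62 0 5 33 30 30 5 101 15 13, Skip 10000 31 17 9 74],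
  Cell 20 502870 502882 6143 5028 31762 18261 33641 12760 5294 106546 89286 [
    Box 1676 34 0 14 23 10 10 6 103 13 95, Box 2248 45 0 7 27 20 20 5 94 14 59,
    Box 2613 50 0 6 29 24 24 5 93 14 92, Box 2870 53 0 6 30 25 25 5 92 15 9,
    Box 3075 56 0 6 31 25 25 4 82 15 22, Box 3336 59 0 7 32 24 24 4 81 15 41,
    Box 3632 62 0 7 33 25 25 4 80 15 57, Skip 10000 30 77 11 18],
  Cell 20 411715 411727 5029 4117 30057 15833 31763 12500 4293 105296 115078 [
    Box 1961 30 0 28 21 5 5 6 92 14 25, Box 2759 44 0 7 27 20 20 4 75 15 14,
    Box 3345 52 0 11 30 16 16 4 73 15 61, Box 3895 58 0 7 32 24 24 3 62 15 94,
    Box 4525 64 0 7 34 26 26 3 59 16 25, Skip 10000 28 12 12 73],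
  Cell 20 337083 337095 4118 3370 28504 13701 30058 12735 3487 104295 145478 [
    Box 2295 27 0 12 20 10 10 5 75 14 56, Box 3323 43 0 22 27 8 8 4 66 15 62,
    Box 4126 52 0 14 30 14 14 3 55 16 15, Box 4994 60 0 11 33 19 19 3 52 16 60,
    Box 5464 55 0 2 32 47 47 2 40 16 26, Skip 10000 26 30 14 37],
  Cell 20 275980 275991 3371 2759 27086 11827 28505 13535 2837 103489 180769 [
    Box 2666 24 0 20 18 6 6 4 60 14 85, Box 3927 41 0 22 26 8 8 3 50 16 0,
    Box 5076 53 0 18 31 12 12 3 47 16 73, Box 5867 51 0 2 30 47 47 2 34 16 55,
    Box 6417 47 0 2 29 45 45 2 32 16 24, Skip 10000 25 11 16 12],
  Cell 20 225953 225964 2760 2259 25789 10190 27087 14955 2311 102839 221168 [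
    Box 3042 20 0 3 16 25 25 4 53 15 2, Box 4560 38 0 22 25 8 8 3 43 16 28, Box 5967 50 0 30 30 8 8 2 31 17 2,
    Box 7014 45 0 2 28 47 47 1 19 16 62, Box 8060 39 0 2 26 47 47 1 15 16 17, Skip 10000 22 28 17 96],
  Cell 20 184994 185005 2260 1849 24598 8764 25790 17043 1883 102313 266797 [
    Box 3506 18 0 4 15 20 20 4 47 15 32, Box 5357 36 0 26 24 7 7 2 30 16 61,
    Box 7132 47 0 26 29 10 10 1 17 17 29, Box 8817 38 0 3 25 48 48 1 10 16 58,
    Box 9964 11 0 11 10 49 49 1 1 14 24, Skip 10000 19 98 19 91],
  Cell 1 183153 183165 1851 1831 24542 7525 24600 19840 1865 101886 317663 [
    Box 4051 16 0 2 13 31 31 3 39 15 66, Box 6332 33 0 24 23 8 8 2 27 16 87,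
    Box 8609 38 0 3 25 49 49 1 11 17 11, Box 9977 5 0 9 5 49 49 1 1 14 21, Skip 10000 20 5 20 1]]
  400 183153 183165"
  by code_simp

section \<open>The regret bound\<close>

lemma trackable_certified:
  fixes x \<alpha> :: real and m :: nat
  assumes x: "3 / 4 \<le> x" "x < 4" and \<alpha>: "0 < \<alpha>" "\<alpha> < 1" and m: "even m" "2 \<le> m"
    and dom: "8 * \<alpha> * ln (m / \<alpha>) \<le> x\<^sup>2"
  shows "trackable x \<alpha> (\<alpha> / m)"
proof -
  have *: "trackable x \<alpha> (\<alpha> / m)"
    if "cells_ok M ex 75 4723665 4723666 cs 400 u v" "2 \<le> M" "M \<le> int m" "ex \<Longrightarrow> int m = M" for M ex cs u v
  proof (rule cells_ok_trackable[OF that(1) _ _ _ _ _ \<alpha> that(2) _ _ dom])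
    show "real_of_int M \<le> real m" using that(3) by linarith
    show "real m = real_of_int M" if ex using that \<open>ex \<Longrightarrow> int m = M\<close> by linarith
  qed (use x exp_three_quarters in simp_all)
  have "m = 2 \<or> m = 4 \<or> m = 6 \<or> 8 \<le> m" using m by presburger
  then consider "m = 2" | "m = 4" | "m = 6" | "8 \<le> m" by blast
  then show ?thesis
  proof cases
    case 1
    then show ?thesis by (intro *[OF certificate_2_1]) auto
  next
    case 2
    then show ?thesis
      by (intro *[OF cells_ok_append[OF cells_ok_append[OF cells_ok_append[OF cells_ok_append[OF cells_ok_append[OF cells_ok_append[OF certificate_4_1 certificate_4_2] certificate_4_3] certificate_4_4] certificate_4_5] certificate_4_6] certificate_4_7]]) auto
  next
    case 3
    then show ?thesis by (intro *[OF cells_ok_append[OF certificate_6_1 certificate_6_2]]) auto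
  next
    case 4
    then show ?thesis by (intro *[OF cells_ok_append[OF certificate_8_1 certificate_8_2]]) auto
  qed
qed

text \<open>Two opposing demands determine \<kappa>. A step without a switch needs \<kappa> \<le> (1
  + \<kappa>) * exp (- x), which at x = 3/4 admits values up to about 0.895. A switch has to earn ln
  (D + \<kappa>) \<ge> 1, which with D \<ge> 1.86 asks for at least about 0.858. The unit earned by
  a switch then cancels the cost of mixing, (1 - \<alpha>) * (- ln (1 - \<alpha>)) \<le>
  \<alpha>.\<close>

lemma fixed_share_small_rate:
  fixes p l :: "nat \<Rightarrow> 's \<Rightarrow> real" and c :: "nat \<Rightarrow> 's" and A :: "'s set" and x \<alpha> \<eta> :: real
  defines "W \<equiv> \<lambda>t. \<Sum>s\<in>A. p t s * exp (- x * l t s)" and "E \<equiv> \<lambda>t. \<Sum>s\<in>A. p t s * l t s"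
  assumes A: "finite A" "2 \<le> card A" and x: "0 < x" "x \<le> 3 / 4" and \<alpha>: "0 < \<alpha>" "\<alpha> < 1"
    and \<eta>: "\<eta> = \<alpha> / card A" and T: "1 \<le> T"
    and p1: "\<And>s. s \<in> A \<Longrightarrow> p 1 s = 1 / card A"
    and step: "\<And>t s. t \<in> {1..<T} \<Longrightarrow> s \<in> A \<Longrightarrow>
      p (Suc t) s = \<eta> + (1 - \<alpha>) * (p t s * exp (- x * l t s) / W t)"
    and l: "\<And>t s. t \<in> {1..T} \<Longrightarrow> s \<in> A \<Longrightarrow> 0 \<le> l t s \<and> l t s \<le> 1"
    and c: "\<And>t. t \<in> {1..T} \<Longrightarrow> c t \<in> A"
    and K: "card {t \<in> {1..T - 1}. c (t + 1) \<noteq> c t} \<le> K" "real K = \<alpha> * (real T - 1)"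
    and dom: "8 * \<alpha> * ln (card A / \<alpha>) \<le> x\<^sup>2"
  shows "x * ((\<Sum>t = 1..T. E t) - (\<Sum>t = 1..T. l t (c t)))
         \<le> ln (card A) - real K * ln \<eta> + real T * x\<^sup>2 / 8"
proof -
  define \<kappa> :: real where "\<kappa> = 87 / 100"
  define e where "e = exp (- x)"
  define D where "D = 1 / (1 - (1 - \<alpha>) * e)"
  have m: "2 \<le> real (card A)" using A by simp
  have \<eta>0: "0 < \<eta>" using \<alpha> m by (simp add: \<eta>)
  have x2: "x\<^sup>2 / 8 \<le> 9 / 128" using x power_mono[OF x(2), of 2] by (simp add: power2_eq_square)
  have ln2: "2 / 3 \<le> ln (2 :: real)" using ln_ge_pade[of 2] by simp
  have ln100: "4 \<le> ln (100 :: real)"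
  proof -
    have "ln (2 ^ 6) \<le> ln (100 :: real)" by (intro ln_mono) auto
    moreover have "ln (2 ^ 6 :: real) = real 6 * ln 2" by (rule ln_realpow)
    ultimately show ?thesis using ln2 by linarith
  qed
  have dom2: "\<alpha> * ln (2 / \<alpha>) \<le> x\<^sup>2 / 8"
  proof -
    have "\<alpha> * ln (2 / \<alpha>) \<le> \<alpha> * ln (card A / \<alpha>)"
      using \<alpha> m by (intro mult_left_mono ln_mono divide_right_mono) auto
    then show ?thesis using dom by simp
  qed
  \<comment> \<open>By concavity \<alpha> * ln (2 / \<alpha>) stays above 9/128, the largest value
    of x^2 / 8 here, on all of [1/50, 1], because it does so at both ends.\<close>
  have a: "\<alpha> < 1 / 50"
  proof (rule ccontr)
    assume "\<not> \<alpha> < 1 / 50"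
    then have "9 / 128 < \<alpha> * ln (2 / \<alpha>)"
      using \<alpha> ln2 ln100 by (intro skip_lower[of "1 / 50" \<alpha> 1]) auto
    with dom2 x2 show False by linarith
  qed
  have \<kappa>\<eta>: "\<kappa> * \<eta> \<le> x\<^sup>2 / 8"
  proof -
    have "ln 100 \<le> ln (2 / \<alpha>)" using a \<alpha> by (intro ln_mono) (auto simp: pos_le_divide_eq)
    then have "1 \<le> ln (2 / \<alpha>)" using ln100 by linarith
    then have "\<alpha> * 1 \<le> \<alpha> * ln (2 / \<alpha>)" using \<alpha> by (intro mult_left_mono) auto
    moreover have "\<kappa> * \<eta> \<le> 1 * \<eta>" using \<eta>0 by (intro mult_right_mono) (auto simp: \<kappa>_def)
    moreover have "\<eta> \<le> \<alpha>" using \<alpha> m by (simp add: \<eta> divide_le_eq)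
    ultimately show ?thesis using dom2 by simp
  qed
  have el: "47236 / 100000 \<le> e" "e < 1"
  proof -
    have "exp (- (75 / 100)) \<le> e" using x by (simp add: e_def)
    then show "47236 / 100000 \<le> e" using exp_three_quarters(1) by simp
    show "e < 1" using x by (simp add: e_def)
  qed
  have \<kappa>e: "\<kappa> \<le> (1 + \<kappa>) * e" using el by (simp add: \<kappa>_def)
  have ae: "46291 / 100000 \<le> (1 - \<alpha>) * e" "(1 - \<alpha>) * e < 1"
  proof -
    have "(1 - 1 / 50) * (47236 / 100000) \<le> (1 - \<alpha>) * e" using a el by (intro mult_mono) auto
    then show "46291 / 100000 \<le> (1 - \<alpha>) * e" by simp
    have "(1 - \<alpha>) * e \<le> 1 * e" using \<alpha> el by (intro mult_right_mono) auto
    then show "(1 - \<alpha>) * e < 1" using el by linarith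
  qed
  have D: "186 / 100 \<le> D" "D = 1 + (1 - \<alpha>) * D * e"
    using ae by (auto simp: D_def field_simps)
  have lnD: "1 \<le> ln (D + \<kappa>)"
  proof -
    have "exp 1 \<le> D + \<kappa>" using D(1) exp_le_exp_poly[of 1] by (simp add: \<kappa>_def exp_poly_def)
    then have "ln (exp 1) \<le> ln (D + \<kappa>)" by (intro ln_mono) auto
    then show ?thesis by simp
  qed
  have KT: "real K \<le> real T - 1" using K(2) \<alpha> T by (simp add: mult_left_le_one_le)
  have end_bound: "x * (E - a) + ln (P + \<kappa> * \<eta>) \<le> \<kappa> * \<eta>" if f: "feasible_step x b E W a P" for b E W a P
  proof -
    have f': "0 \<le> a" "a \<le> 1" "0 < P" "P \<le> 1" "E - a \<le> (1 - a) * (1 - P)"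
      using f by (auto simp: feasible_step_def)
    have "(1 - a) * (1 - P) \<le> 1 * (1 - P)" using f' by (intro mult_right_mono) auto
    then have "x * (E - a) \<le> x * (1 - P)" using f' x by (intro mult_left_mono) auto
    also have "\<dots> \<le> 1 * (1 - P)" using f' x by (intro mult_right_mono) auto
    finally have "x * (E - a) \<le> 1 - P" by simp
    moreover have "ln (P + \<kappa> * \<eta>) \<le> P + \<kappa> * \<eta> - 1"
      using f' \<eta>0 by (intro ln_le_minus_one) (simp add: \<kappa>_def)
    ultimately show ?thesis by linarith
  qed
  have "x * ((\<Sum>t = 1..T. E t) - (\<Sum>t = 1..T. l t (c t)))
         \<le> - ln (1 / card A + \<kappa> * \<eta>) + (real T - 1 - real K) * (x\<^sup>2 / 8 - ln (1 - \<alpha>))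
           + real K * (\<kappa> * \<eta> - ln (D + \<kappa>) - ln \<eta>) + \<kappa> * \<eta>"
    unfolding E_def
  proof (rule fixed_share_bound[where \<alpha> = \<alpha> and D = D])
    show "D = 1 / (1 - (1 - \<alpha>) * exp (- x))" by (simp add: D_def e_def)
    show "K \<le> T - 1" using KT T by linarith
    fix E W a P assume f: "feasible_step x (D * \<eta>) E W a P"
    then have f': "0 < W" "W \<le> 1 - (1 - e) * E" "0 \<le> a" "a \<le> 1" "0 < P" "P \<le> 1" "0 \<le> E"
        "E - a \<le> (1 - a) * (1 - P)"
      by (auto simp: feasible_step_def e_def)
    show "x * (E - a) + ln (P + \<kappa> * \<eta>) \<le> \<kappa> * \<eta>" by (rule end_bound[OF f])
    define V where "V = 1 - (1 - e) * E"
    have V: "0 < V" "W \<le> V" using f' by (auto simp: V_def)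
    have "(1 - a) * (1 - P) \<le> (1 - a) * 1" using f' by (intro mult_left_mono) auto
    then have "E - a \<le> (1 - a) * 1" using f'(8) by (rule order_trans[rotated])
    then have "E \<le> 1" by simp
    then have "(1 - e) * E \<le> (1 - e) * 1" using el by (intro mult_left_mono) auto
    then have Ve: "e \<le> V" by (simp add: V_def)
    define z where "z = exp (- x * a) / V"
    have z: "0 < z" using V by (simp add: z_def)
    \<comment> \<open>The Bayes factor of one step is at most exp x. The offset
      \<open>\<kappa> * \<eta>\<close> is not multiplied by it, and this bound shows that the fresh
      share \<open>\<eta>\<close> makes up for what the offset misses.\<close>
    have "z \<le> 1 / e" unfolding z_def using x f' Ve el by (intro frac_le) auto
    then have "(1 - \<alpha>) * \<kappa> * z \<le> 1 * \<kappa> * (1 / e)" using \<alpha> z by (intro mult_mono) (auto simp: \<kappa>_def)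
    also have "\<dots> \<le> 1 + \<kappa>" using \<kappa>e el by (simp add: pos_divide_le_eq)
    finally have "\<eta> * ((1 - \<alpha>) * \<kappa> * z) \<le> \<eta> * (1 + \<kappa>)" using \<eta>0 by (intro mult_left_mono) auto
    then have "(1 - \<alpha>) * ((P + \<kappa> * \<eta>) * z) \<le> \<eta> + (1 - \<alpha>) * (P * z) + \<kappa> * \<eta>"
      by (simp add: algebra_simps)
    also have "\<dots> \<le> \<eta> + (1 - \<alpha>) * (P * exp (- x * a) / W) + \<kappa> * \<eta>"
    proof -
      have "z \<le> exp (- x * a) / W" unfolding z_def using V f' by (intro divide_left_mono) auto
      then have "P * z \<le> P * (exp (- x * a) / W)" using f' by (intro mult_left_mono) auto
      then have "(1 - \<alpha>) * (P * z) \<le> (1 - \<alpha>) * (P * (exp (- x * a) / W))"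
        by (rule mult_left_mono) (use \<alpha> in simp)
      then show ?thesis by simp
    qed
    finally have "ln ((1 - \<alpha>) * ((P + \<kappa> * \<eta>) * z)) \<le> ln (\<eta> + (1 - \<alpha>) * (P * exp (- x * a) / W) + \<kappa> * \<eta>)"
      using \<alpha> f' \<eta>0 z by (intro ln_mono mult_pos_pos) (auto simp: \<kappa>_def add_pos_pos)
    moreover have P': "0 < P + \<kappa> * \<eta>" using f' \<eta>0 by (simp add: \<kappa>_def add_pos_pos)
    then have "ln ((1 - \<alpha>) * ((P + \<kappa> * \<eta>) * z)) = ln (1 - \<alpha>) + ln (P + \<kappa> * \<eta>) + (- x * a - ln V)"
      using \<alpha> z V by (simp add: ln_mult z_def ln_div)
    moreover have "x * E + ln V \<le> hgap x" using V x by (intro mgf_le_hgap) (auto simp: V_def e_def)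
    moreover have "hgap x \<le> x\<^sup>2 / 8" using x by (intro hgap_le) auto
    ultimately show "x * (E - a) + ln (P + \<kappa> * \<eta>) - ln (\<eta> + (1 - \<alpha>) * (P * exp (- x * a) / W) + \<kappa> * \<eta>)
        \<le> x\<^sup>2 / 8 - ln (1 - \<alpha>)"
      by (simp add: right_diff_distrib)
    fix p' assume p': "\<eta> * (1 + (1 - \<alpha>) * D * exp (- x) / W) \<le> p'"
    have "0 \<le> (1 - e) * E" using el f' by simp
    then have "W \<le> 1" using f' by linarith
    have d0: "0 \<le> (1 - \<alpha>) * D * e" using \<alpha> D(1) el by simp
    then have "(1 - \<alpha>) * D * e * W \<le> (1 - \<alpha>) * D * e" using \<open>W \<le> 1\<close> by (rule mult_left_le[rotated])
    then have "(1 - \<alpha>) * D * e \<le> (1 - \<alpha>) * D * e / W" using f' by (simp add: pos_le_divide_eq)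
    then have "D \<le> 1 + (1 - \<alpha>) * D * exp (- x) / W" using D(2) by (simp add: e_def)
    then have "\<eta> * D \<le> p'" using p' \<eta>0 by (meson less_imp_le mult_left_mono order_trans)
    then have le: "\<eta> * (D + \<kappa>) \<le> p' + \<kappa> * \<eta>" by (simp add: distrib_left mult.commute)
    have "0 < \<eta> * (D + \<kappa>)" using \<eta>0 D(1) by (intro mult_pos_pos) (auto simp: \<kappa>_def)
    with le have "ln (\<eta> * (D + \<kappa>)) \<le> ln (p' + \<kappa> * \<eta>)" by (intro ln_mono)
    moreover have "ln (\<eta> * (D + \<kappa>)) = ln \<eta> + ln (D + \<kappa>)"
      using \<eta>0 D(1) by (intro ln_mult_pos) (auto simp: \<kappa>_def)
    ultimately show "x * (E - a) + ln (P + \<kappa> * \<eta>) - ln (p' + \<kappa> * \<eta>) \<le> \<kappa> * \<eta> - ln (D + \<kappa>) - ln \<eta>"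
      using end_bound[OF f] by linarith
  qed (use A x \<alpha> \<eta> T p1 step l c K in \<open>auto simp: W_def \<kappa>_def\<close>)
  moreover have "- ln (1 / card A + \<kappa> * \<eta>) \<le> ln (card A)"
  proof -
    have "ln (1 / card A) \<le> ln (1 / card A + \<kappa> * \<eta>)" using m \<eta>0 by (intro ln_mono) (auto simp: \<kappa>_def)
    then show ?thesis using m by (simp add: ln_div)
  qed
  moreover have "(real T - 1 - real K) * (x\<^sup>2 / 8 - ln (1 - \<alpha>)) + real K * (\<kappa> * \<eta> - ln (D + \<kappa>) - ln \<eta>)
      \<le> (real T - 1) * (x\<^sup>2 / 8) - real K * ln \<eta>"
  proof -
    define h where "h = x\<^sup>2 / 8"
    have "ln (1 / (1 - \<alpha>)) \<le> 1 / (1 - \<alpha>) - 1" using \<alpha> by (intro ln_le_minus_one) auto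
    then have "(1 - \<alpha>) * (- ln (1 - \<alpha>)) \<le> (1 - \<alpha>) * (1 / (1 - \<alpha>) - 1)"
      using \<alpha> by (intro mult_left_mono) (auto simp: ln_div)
    also have "\<dots> = \<alpha> * 1" using \<alpha> by (simp add: right_diff_distrib)
    also have "\<dots> \<le> \<alpha> * (h - \<kappa> * \<eta> + ln (D + \<kappa>))"
      using \<alpha> \<kappa>\<eta> lnD by (intro mult_left_mono) (auto simp: h_def)
    finally have "(real T - 1) * ((1 - \<alpha>) * (- ln (1 - \<alpha>))) \<le> (real T - 1) * (\<alpha> * (h - \<kappa> * \<eta> + ln (D + \<kappa>)))"
      using T by (intro mult_left_mono) auto
    then show ?thesis unfolding K(2) h_def[symmetric] by (simp add: algebra_simps)
  qed
  moreover have "(real T - 1) * (x\<^sup>2 / 8) = real T * x\<^sup>2 / 8 - x\<^sup>2 / 8" by (simp add: left_diff_distrib)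
  ultimately show ?thesis using \<kappa>\<eta> by linarith
qed

text \<open>For \<alpha> = 0 the update is plain exponential weighting. With \<kappa> = 0 the
  potential is - ln P, and every step, the last included, costs at most
  \<open>hgap x\<close>.\<close>

lemma fixed_share_no_switch:
  fixes p l :: "nat \<Rightarrow> 's \<Rightarrow> real" and c :: "nat \<Rightarrow> 's" and A :: "'s set" and x :: real
  defines "W \<equiv> \<lambda>t. \<Sum>s\<in>A. p t s * exp (- x * l t s)" and "E \<equiv> \<lambda>t. \<Sum>s\<in>A. p t s * l t s"
  assumes A: "finite A" "A \<noteq> {}" and x: "0 < x" "x \<le> 4" and T: "1 \<le> T"
    and p1: "\<And>s. s \<in> A \<Longrightarrow> p 1 s = 1 / card A"
    and step: "\<And>t s. t \<in> {1..<T} \<Longrightarrow> s \<in> A \<Longrightarrow> p (Suc t) s = p t s * exp (- x * l t s) / W t"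
    and l: "\<And>t s. t \<in> {1..T} \<Longrightarrow> s \<in> A \<Longrightarrow> 0 \<le> l t s \<and> l t s \<le> 1"
    and c: "\<And>t. t \<in> {1..T} \<Longrightarrow> c t \<in> A"
    and K: "card {t \<in> {1..T - 1}. c (t + 1) \<noteq> c t} \<le> 0"
  shows "x * ((\<Sum>t = 1..T. E t) - (\<Sum>t = 1..T. l t (c t))) \<le> ln (card A) + real T * x\<^sup>2 / 8"
proof -
  have h: "hgap x \<le> x\<^sup>2 / 8" using x by (intro hgap_le) auto
  have "x * ((\<Sum>t = 1..T. E t) - (\<Sum>t = 1..T. l t (c t)))
         \<le> - ln (1 / card A + 0 * 0) + (real T - 1 - real 0) * hgap x + real 0 * 0 + hgap x"
    unfolding E_def
  proof (rule fixed_share_bound[where \<alpha> = 0 and D = "1 / (1 - (1 - 0) * exp (- x))"])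
    fix E W a P assume "feasible_step x (1 / (1 - (1 - 0) * exp (- x)) * 0) E W a P"
    then have f: "0 < W" "W \<le> 1 - (1 - exp (- x)) * E" "0 \<le> a" "a \<le> 1" "0 < P" "P \<le> 1"
        "E - a \<le> (1 - a) * (1 - P)"
      by (auto simp: feasible_step_def)
    have "x * E + ln W \<le> hgap x" using f x by (intro mgf_le_hgap) auto
    then show "x * (E - a) + ln (P + 0 * 0) - ln (0 + (1 - 0) * (P * exp (- x * a) / W) + 0 * 0) \<le> hgap x"
      using f by (simp add: ln_mult ln_div right_diff_distrib)
    define q where "q = 1 - exp (- x)"
    have q: "0 \<le> q" "q \<le> 1" using x by (auto simp: q_def)
    \<comment> \<open>Puts \<open>P * exp (- x * a)\<close> below the line that bounds the
      normaliser, so that the Hoeffding exponent applies with it in the place of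
      \<open>W\<close>.\<close>
    have "P * exp (- x * a) \<le> P * (1 - q * a)"
      using exp_neg_le_chord[of a x] f by (intro mult_left_mono) (auto simp: q_def)
    also have "\<dots> = P * (1 - q) + q * (P * (1 - a))" by (simp add: algebra_simps)
    also have "\<dots> \<le> 1 * (1 - q) + q * (P * (1 - a))"
      using q f by (intro add_right_mono mult_right_mono) auto
    also have "\<dots> \<le> 1 - q * E"
    proof -
      have "q * E \<le> q * (1 - P * (1 - a))" using f q by (intro mult_left_mono) (auto simp: algebra_simps)
      then show ?thesis by (simp add: algebra_simps)
    qed
    finally have "x * E + ln (P * exp (- x * a)) \<le> hgap x"
      using f x by (intro mgf_le_hgap) (auto simp: q_def)
    then show "x * (E - a) + ln (P + 0 * 0) \<le> hgap x"
      using f by (simp add: ln_mult right_diff_distrib)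
  qed (use A x T p1 step l c K in \<open>auto simp: W_def\<close>)
  also have "\<dots> = ln (card A) + real T * hgap x"
    using A by (simp add: ln_div card_gt_0_iff algebra_simps)
  also have "\<dots> \<le> ln (card A) + real T * (x\<^sup>2 / 8)" using h by (intro add_left_mono mult_left_mono) auto
  finally show ?thesis by simp
qed

text \<open>At the tuned rate T * x^2 / 8 equals the complexity \<open>C\<close>. The two parts of
  the bound coincide, and 2 * C / x is T * x / 4.\<close>

lemma fixed_share_regret:
  fixes p l :: "nat \<Rightarrow> 's \<Rightarrow> real" and c :: "nat \<Rightarrow> 's" and A :: "'s set" and x \<alpha> C :: real and K T :: nat
  defines "W \<equiv> \<lambda>t. \<Sum>s\<in>A. p t s * exp (- x * l t s)" and "E \<equiv> \<lambda>t. \<Sum>s\<in>A. p t s * l t s"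
  assumes A: "even (card A)" "2 \<le> card A" and T: "2 \<le> T"
    and \<alpha>: "\<alpha> = mixing_rate K T" "\<alpha> < 1"
    and x: "x = sqrt (8 * complexity K (card A) T / T)" "x < 4"
    and p1: "\<And>s. s \<in> A \<Longrightarrow> p 1 s = 1 / card A"
    and step: "\<And>t s. t \<in> {1..<T} \<Longrightarrow> s \<in> A \<Longrightarrow>
      p (Suc t) s = \<alpha> / card A + (1 - \<alpha>) * (p t s * exp (- x * l t s) / W t)"
    and l: "\<And>t s. t \<in> {1..T} \<Longrightarrow> s \<in> A \<Longrightarrow> 0 \<le> l t s \<and> l t s \<le> 1"
    and c: "\<And>t. t \<in> {1..T} \<Longrightarrow> c t \<in> A"
    and K: "card {t \<in> {1..T - 1}. c (t + 1) \<noteq> c t} \<le> K"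
  shows "0 < x" and "(\<Sum>t = 1..T. E t) - (\<Sum>t = 1..T. l t (c t)) \<le> T * x / 4"
proof -
  define m where "m = real (card A)"
  define n where "n = real T - 1"
  define C where "C = complexity K (card A) T"
  have A': "finite A" "A \<noteq> {}"
    using A(2) by (metis card.infinite not_numeral_le_zero, auto)
  have m: "2 \<le> m" using A by (simp add: m_def)
  have n: "1 \<le> n" "0 < n" "real T = n + 1" using T by (auto simp: n_def)
  have lnm: "0 < ln m" using m by simp
  have \<alpha>n: "\<alpha> = real K / n" by (simp add: \<alpha>(1) mixing_rate_def n_def)
  have Kn: "real K = \<alpha> * n" "real K < n" using \<alpha>(2) n unfolding \<alpha>n by (simp_all add: pos_divide_less_eq)
  have C: "C = real K * ln m + real K * ln (T / K) + ln m" by (simp add: C_def complexity_def m_def)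
  have lnTK: "0 \<le> real K * ln (T / K)"
  proof (cases "K = 0")
    case False
    then have "1 \<le> T / K" using Kn(2) n(3) by (subst pos_le_divide_eq) auto
    then show ?thesis by (intro mult_nonneg_nonneg ln_ge_zero) auto
  qed simp
  have C0: "0 < C" unfolding C using lnm lnTK by (intro add_nonneg_pos add_nonneg_nonneg) auto
  have x2: "x\<^sup>2 = 8 * C / T" using C0 n by (simp add: x C_def)
  have x2C: "real T * x\<^sup>2 / 8 = C" using n by (simp add: x2)
  show x0: "0 < x" using C0 n by (simp add: x C_def)
  have "x * ((\<Sum>t = 1..T. E t) - (\<Sum>t = 1..T. l t (c t))) \<le> 2 * C"
  proof (cases "K = 0")
    case True
    then have "\<alpha> = 0" by (simp add: \<alpha> mixing_rate_def)
    then have "x * ((\<Sum>t = 1..T. E t) - (\<Sum>t = 1..T. l t (c t))) \<le> ln (card A) + real T * x\<^sup>2 / 8"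
      unfolding E_def using A' x0 x(2) T p1 step l c K True
      by (intro fixed_share_no_switch) (auto simp: W_def)
    then show ?thesis using True C by (simp add: x2C m_def)
  next
    case False
    then have K0: "0 < real K" by simp
    then have \<alpha>0: "0 < \<alpha>" using n(2) by (simp add: \<alpha>n)
    have K1: "1 \<le> real K" using False by simp
    have n2: "2 \<le> n"
    proof -
      have "K + 1 < T" using Kn(2) n(3) by linarith
      then have "3 \<le> T" using False by linarith
      then show ?thesis by (simp add: n_def)
    qed
    define \<eta> where "\<eta> = \<alpha> / card A"
    have nK: "n / K = 1 / \<alpha>" using Kn(1) n \<alpha>0 by simp
    have ln\<eta>: "- ln \<eta> = ln m + ln (n / K)"
      unfolding nK \<eta>_def m_def[symmetric] using \<alpha>0 m by (simp add: ln_div)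
    \<comment> \<open>As T * \<alpha> = K + \<alpha>, this says that (K + \<alpha>) * (ln m + ln ((T
      - 1) / K)) \<le> C. The additional \<alpha> * ln (1 / \<alpha>) is paid by (1 - \<alpha>) * ln
      m and by the gain of K * ln (T / K) over K * ln ((T - 1) / K), which is worth at least 2 *
      \<alpha> / 3.\<close>
    have dom: "8 * \<alpha> * ln (card A / \<alpha>) \<le> x\<^sup>2"
    proof -
      have "\<alpha> * ln (1 / \<alpha>) \<le> \<alpha> * (ln 2 + (1 / (2 * \<alpha>) - 1))"
      proof -
        \<comment> \<open>The tangent of ln is taken at the point belonging to \<alpha> = 1/2; the
          ln 2 that appears is then dominated by ln m.\<close>
        have "ln (1 / (2 * \<alpha>)) \<le> 1 / (2 * \<alpha>) - 1" using \<alpha>0 by (intro ln_le_minus_one) auto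
        then show ?thesis using \<alpha>0 by (intro mult_left_mono) (auto simp: ln_div ln_mult)
      qed
      also have "\<dots> = \<alpha> * ln 2 + 1 / 2 - \<alpha>" using \<alpha>0 by (simp add: field_simps)
      also have "\<dots> \<le> (1 - \<alpha>) * ln m + \<alpha> * (2 / 3)"
      proof -
        have l2: "2 / 3 \<le> ln (2 :: real)" "ln (2 :: real) \<le> 5 / 6"
          using ln_ge_pade[of 2] ln_le_pade[of 1] by auto
        have "(1 - \<alpha>) * ln 2 \<le> (1 - \<alpha>) * ln m" using \<alpha> m by (intro mult_left_mono) auto
        moreover have "0 \<le> \<alpha> * (5 / 6 - ln 2)" using l2 \<alpha>0 by simp
        then have "2 * (\<alpha> * ln 2) \<le> \<alpha> * (5 / 3)" by (simp add: right_diff_distrib)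
        moreover have "(1 - \<alpha>) * ln 2 = ln 2 - \<alpha> * ln 2" by (simp add: left_diff_distrib)
        ultimately show ?thesis using l2 by linarith
      qed
      also have "\<alpha> * (2 / 3) \<le> \<alpha> * (n / T)" using n2 \<alpha>0 n(3) by (intro mult_left_mono) (auto simp: pos_le_divide_eq)
      also have "\<alpha> * (n / T) \<le> real K * ln (T / n)"
      proof -
        have "ln (n / T) \<le> n / T - 1" using n by (intro ln_le_minus_one) auto
        then have "real K * (1 - n / T) \<le> real K * ln (T / n)"
          using n by (intro mult_left_mono) (auto simp: ln_div)
        moreover have "1 - n / T = 1 / T" using n by (simp add: field_simps)
        ultimately show ?thesis using Kn by simp
      qed
      finally have bound: "\<alpha> * ln (1 / \<alpha>) \<le> (1 - \<alpha>) * ln m + real K * ln (T / n)" by simp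
      have split: "ln (T / K) = ln (T / n) + ln (n / K)" using n K0 by (simp add: ln_div)
      have arith: "(k + a) * (u + v) \<le> k * u + k * (w + v) + u" if "a * v \<le> (1 - a) * u + k * w" for k a u v w :: real
        using that by (simp add: algebra_simps)
      have "(real K + \<alpha>) * (ln m + ln (n / K)) \<le> C"
        unfolding C split by (rule arith) (use bound in \<open>simp only: nK\<close>)
      moreover have "real K + \<alpha> = T * \<alpha>" unfolding Kn(1) n(3) by (simp add: algebra_simps)
      moreover have "ln m + ln (n / K) = ln (card A / \<alpha>)"
        unfolding ln\<eta>[symmetric] \<eta>_def m_def[symmetric] using \<alpha>0 m by (simp add: ln_div)
      ultimately have "T * \<alpha> * ln (card A / \<alpha>) \<le> C" by (simp only:)
      then have "8 * \<alpha> * ln (card A / \<alpha>) * T \<le> 8 * C" by (simp add: mult_ac)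
      then show ?thesis unfolding x2 using n by (subst pos_le_divide_eq) auto
    qed
    have "x * ((\<Sum>t = 1..T. E t) - (\<Sum>t = 1..T. l t (c t))) \<le> ln (card A) - real K * ln \<eta> + real T * x\<^sup>2 / 8"
    proof (cases "x \<le> 3 / 4")
      case True
      show ?thesis unfolding E_def
        by (rule fixed_share_small_rate[where \<alpha> = \<alpha>])
          (use A A' x0 True \<alpha>0 \<alpha>(2) T p1 step l c K Kn dom in \<open>auto simp: W_def \<eta>_def n_def\<close>)
    next
      case False
      then have "trackable x \<alpha> \<eta>"
        unfolding \<eta>_def using x(2) \<alpha>0 \<alpha>(2) A dom by (intro trackable_certified) auto
      then show ?thesis unfolding E_def
        by (intro fixed_share_trackable[where \<alpha> = \<alpha> and \<eta> = \<eta>])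
          (use A A' x0 \<alpha>0 \<alpha>(2) T p1 step l c K Kn in \<open>auto simp: W_def \<eta>_def n_def\<close>)
    qed
    moreover have "- (real K * ln \<eta>) \<le> real K * ln m + real K * ln (T / K)"
    proof -
      have "ln (n / K) \<le> ln (T / K)" using n K0 by (intro ln_mono divide_right_mono) auto
      then have "real K * (- ln \<eta>) \<le> real K * (ln m + ln (T / K))"
        using ln\<eta> by (intro mult_left_mono) auto
      then show ?thesis by (simp add: distrib_left)
    qed
    ultimately show ?thesis unfolding x2C using C by (simp add: m_def)
  qed
  moreover have "x * (T * x / 4) = 2 * (real T * x\<^sup>2 / 8)" by (simp add: power2_eq_square)
  then have "2 * C = x * (T * x / 4)" by (simp only: x2C)
  ultimately show "(\<Sum>t = 1..T. E t) - (\<Sum>t = 1..T. l t (c t)) \<le> T * x / 4"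
    using x0 by simp
qed

section \<open>Top-k losses, the posterior and the unscaled bound\<close>

text \<open>Every factor is a softmax probability with negative logarithm \<open>ln Z - w j\<close>.
  The normaliser \<open>Z\<close> is at least exp (w j) and at most the batch size times exp (S /
  \<beta>), while \<open>w j\<close> is at least - S / \<beta>.\<close>

lemma topk_loss_bounds:
  fixes g :: "'z \<Rightarrow> real"
  assumes k: "k \<le> length zs" and \<beta>: "0 < \<beta>" and g: "\<And>z. z \<in> set zs \<Longrightarrow> \<bar>g z\<bar> \<le> S"
  shows "0 < topk_likelihood k \<beta> q zs g" "0 \<le> topk_loss k \<beta> q zs g"
    "topk_loss k \<beta> q zs g \<le> loss_bound k (length zs) S \<beta>"
proof -
  define w where "w i = g (ranking q zs ! i) / \<beta>" for i
  define Z where "Z = (\<Sum>i<length zs. exp (w i))"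
  have w: "\<bar>w i\<bar> \<le> S / \<beta>" if "i < length zs" for i
  proof -
    have "ranking q zs ! i \<in> set zs"
      using that nth_mem[of i "ranking q zs"] by (simp add: ranking_def)
    then show ?thesis using g \<beta> by (simp add: w_def divide_right_mono)
  qed
  have Z: "0 < Z" "w j \<le> ln Z" "ln Z \<le> ln (length zs) + S / \<beta>" if "j < k" for j
  proof -
    have jl: "j < length zs" using that k by simp
    have "exp (w j) \<le> Z" unfolding Z_def using jl by (intro member_le_sum) auto
    moreover show Z0: "0 < Z" using calculation exp_gt_zero[of "w j"] by linarith
    ultimately have "ln (exp (w j)) \<le> ln Z" by (intro ln_mono) auto
    then show "w j \<le> ln Z" by simp
    have "Z \<le> (\<Sum>i<length zs. exp (S / \<beta>))"
      unfolding Z_def using w by (intro sum_mono) (auto simp: abs_le_iff)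
    then have "ln Z \<le> ln (length zs * exp (S / \<beta>))" using Z0 by (intro ln_mono) auto
    also have "\<dots> = ln (length zs) + ln (exp (S / \<beta>))" using jl by (intro ln_mult_pos) auto
    finally show "ln Z \<le> ln (length zs) + S / \<beta>" by simp
  qed
  have lik: "topk_likelihood k \<beta> q zs g = (\<Prod>j<k. exp (w j) / Z)"
    by (simp add: topk_likelihood_def w_def Z_def)
  show "0 < topk_likelihood k \<beta> q zs g" unfolding lik using Z(1) by (intro prod_pos) auto
  have "ln (\<Prod>j<k. exp (w j) / Z) = (\<Sum>j<k. ln (exp (w j) / Z))"
    using Z(1) by (intro ln_prod) auto
  also have "\<dots> = (\<Sum>j<k. w j - ln Z)" using Z(1) by (intro sum.cong) (auto simp: ln_div)
  finally have loss: "topk_loss k \<beta> q zs g = (\<Sum>j<k. ln Z - w j)"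
    by (simp add: topk_loss_def lik sum_negf[symmetric])
  show "0 \<le> topk_loss k \<beta> q zs g" unfolding loss using Z(2) by (intro sum_nonneg) auto
  have "ln Z - w j \<le> ln (length zs) + 2 * S / \<beta>" if "j < k" for j
    using Z(3)[OF that] w[of j] that k by (auto simp: abs_le_iff)
  then have "topk_loss k \<beta> q zs g \<le> (\<Sum>j<k. ln (length zs) + 2 * S / \<beta>)"
    unfolding loss by (intro sum_mono) auto
  then show "topk_loss k \<beta> q zs g \<le> loss_bound k (length zs) S \<beta>" by (simp add: loss_bound_def)
qed

text \<open>Serves the rates with x \<ge> 4, where nothing but E \<le> 1 has to be known about the
  update.\<close>

lemma posterior_distribution:
  fixes lik :: "nat \<Rightarrow> 's \<Rightarrow> real"
  assumes A: "finite A" "A \<noteq> {}" and \<alpha>: "0 \<le> \<alpha>" "\<alpha> < 1"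
    and lik: "\<And>t s. 1 \<le> t \<Longrightarrow> t < T \<Longrightarrow> s \<in> A \<Longrightarrow> 0 < lik t s"
  shows "t \<le> T \<Longrightarrow> (\<forall>s\<in>A. 0 < posterior A lr \<alpha> lik t s) \<and> (\<Sum>s\<in>A. posterior A lr \<alpha> lik t s) = 1"
proof (induction t)
  case (Suc t)
  show ?case
  proof (cases t)
    case (Suc t')
    define w where "w s = posterior A lr \<alpha> lik t s * lik t s powr lr" for s
    have w: "0 < w s" if "s \<in> A" for s
      unfolding w_def using Suc.IH Suc.prems lik[of t s] that Suc by (intro mult_pos_pos) auto
    have W: "0 < (\<Sum>s\<in>A. w s)" using A w by (intro sum_pos) auto
    have p: "posterior A lr \<alpha> lik (Suc t) s = \<alpha> / card A + (1 - \<alpha>) * (w s / (\<Sum>s\<in>A. w s))" for s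
      by (simp add: Suc tempered_bayes_def w_def)
    have "0 < posterior A lr \<alpha> lik (Suc t) s" if "s \<in> A" for s
      unfolding p using \<alpha> w[OF that] W by (intro add_nonneg_pos) auto
    moreover have "(\<Sum>s\<in>A. posterior A lr \<alpha> lik (Suc t) s) = 1"
      unfolding p using A W by (simp add: sum.distrib flip: sum_distrib_left sum_divide_distrib)
    ultimately show ?thesis by blast
  qed (use A in \<open>simp add: card_gt_0_iff\<close>)
qed (use A in \<open>simp add: card_gt_0_iff\<close>)

theorem theorem2:
  fixes D :: "'z set"
    and m T K b k :: nat
    and f :: "nat \<Rightarrow> 'z \<Rightarrow> real"
    and B :: "nat \<Rightarrow> 'z list"
    and q :: "nat \<Rightarrow> 'z \<Rightarrow> real"
    and \<beta> S L lr \<alpha> :: real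
    and p loss :: "nat \<Rightarrow> strategy \<Rightarrow> real"
    and c :: "nat \<Rightarrow> strategy"
  assumes "finite D" and "D \<noteq> {}"
    and "even m" and "m \<ge> 2"
    and "T \<ge> 2" and "mixing_rate K T < 1"
    and "1 \<le> k" and "k \<le> b" and "\<beta> > 0"
    and batches: "\<And>t. t \<in> {1..T} \<Longrightarrow> set (B t) \<subseteq> D \<and> length (B t) = b"
    and S: "S = sup_norm D m f"
    and L: "L = loss_bound k b S \<beta>" and "L > 0"
    and lr: "lr = optimal_rate L K m T"
    and \<alpha>: "\<alpha> = mixing_rate K T"
    and loss: "loss = (\<lambda>t s. topk_loss k \<beta> (q t) (B t) (strategy_fun f s))"
    and p: "p = posterior (strategies m) lr \<alpha>
                  (\<lambda>t s. topk_likelihood k \<beta> (q t) (B t) (strategy_fun f s))"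
    and comparator: "\<And>t. t \<in> {1..T} \<Longrightarrow> c t \<in> strategies m"
    and switches: "card {t \<in> {1..T - 1}. c (t + 1) \<noteq> c t} \<le> K"
  shows "(\<Sum>t = 1..T. \<Sum>s\<in>strategies m. p t s * loss t s) - (\<Sum>t = 1..T. loss t (c t))
         \<le> L * sqrt (real T / 2 * complexity K m T)"
proof -
  define A where "A = strategies m"
  define C where "C = complexity K m T"
  define x where "x = lr * L"
  define l where "l t s = loss t s / L" for t s
  define lik where "lik t s = topk_likelihood k \<beta> (q t) (B t) (strategy_fun f s)" for t s
  have A: "card A = m" "finite A" "A \<noteq> {}"
    using \<open>even m\<close> \<open>m \<ge> 2\<close> by (auto simp: A_def strategies_def card_cartesian_product)
  have T: "1 \<le> T" "0 < real T" using \<open>T \<ge> 2\<close> by auto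
  \<comment> \<open>\<open>L\<close> cancels from the tuned rate, so the scaled problem depends on
    the complexity and \<open>T\<close> alone.\<close>
  have x: "x = sqrt (8 * C / T)"
    using \<open>L > 0\<close> by (simp add: x_def lr optimal_rate_def C_def real_sqrt_divide real_sqrt_mult)
  have S_ge: "\<bar>strategy_fun f s z\<bar> \<le> S" if "s \<in> A" "z \<in> D" for s z
  proof -
    have "\<bar>strategy_fun f s z\<bar> = (\<lambda>(s, z). \<bar>strategy_fun f s z\<bar>) (s, z)" by simp
    also have "\<dots> \<le> S"
      unfolding S sup_norm_def using that A \<open>finite D\<close>
      by (intro cSUP_upper bdd_above_finite finite_imageI) (auto simp: A_def)
    finally show ?thesis .
  qed
  have bounds: "0 < lik t s" "0 \<le> loss t s" "loss t s \<le> L" if "t \<in> {1..T}" "s \<in> A" for t s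
  proof -
    have "k \<le> length (B t)" "L = loss_bound k (length (B t)) S \<beta>"
      "\<And>z. z \<in> set (B t) \<Longrightarrow> \<bar>strategy_fun f s z\<bar> \<le> S"
      using batches[OF that(1)] S_ge[OF that(2)] \<open>k \<le> b\<close> L by auto
    from topk_loss_bounds[OF this(1) \<open>\<beta> > 0\<close> this(3), where q = "q t"] this(2)
    show "0 < lik t s" "0 \<le> loss t s" "loss t s \<le> L" by (simp_all add: lik_def loss)
  qed
  have l01: "0 \<le> l t s \<and> l t s \<le> 1" if "t \<in> {1..T}" "s \<in> A" for t s
    using bounds[OF that] \<open>L > 0\<close> by (simp add: l_def)
  have \<alpha>01: "0 \<le> \<alpha>" "\<alpha> < 1" using \<alpha> \<open>mixing_rate K T < 1\<close> T by (auto simp: mixing_rate_def)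
  have p': "p = posterior A lr \<alpha> lik" by (simp add: p A_def lik_def[abs_def])
  have powr: "lik t s powr lr = exp (- x * l t s)" if "t \<in> {1..T}" "s \<in> A" for t s
    using bounds(1)[OF that] \<open>L > 0\<close>
    by (simp add: powr_def x_def l_def loss topk_loss_def lik_def)
  define E where "E t = (\<Sum>s\<in>A. p t s * l t s)" for t
  have main: "(\<Sum>t = 1..T. E t) - (\<Sum>t = 1..T. l t (c t)) \<le> T * x / 4"
  proof (cases "x < 4")
    case True
    show ?thesis unfolding E_def
    proof (rule fixed_share_regret(2)[where x = x and \<alpha> = \<alpha> and K = K])
      show "p (Suc t) s = \<alpha> / card A + (1 - \<alpha>) * (p t s * exp (- x * l t s) / (\<Sum>s\<in>A. p t s * exp (- x * l t s)))"
        if ts: "t \<in> {1..<T}" "s \<in> A" for t s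
      proof -
        obtain t' where t': "t = Suc t'" using ts(1) by (cases t) auto
        have "(\<Sum>s\<in>A. p t s * exp (- x * l t s)) = (\<Sum>s\<in>A. p t s * lik t s powr lr)"
          using ts powr by (intro sum.cong) auto
        moreover have "exp (- x * l t s) = lik t s powr lr" using ts powr[of t s] by simp
        moreover have "p (Suc t) s = \<alpha> / card A + (1 - \<alpha>) * (p t s * lik t s powr lr / (\<Sum>s\<in>A. p t s * lik t s powr lr))"
          unfolding p' t' by (simp add: tempered_bayes_def)
        ultimately show ?thesis by (simp only:)
      qed
      show "p 1 s = 1 / card A" if "s \<in> A" for s by (simp add: p')
      show "\<alpha> = mixing_rate K T" by (rule \<alpha>)
      show "x = sqrt (8 * complexity K (card A) T / T)" by (simp add: x C_def A)
    qed (use A \<open>even m\<close> \<open>m \<ge> 2\<close> \<open>T \<ge> 2\<close> True \<alpha>01 l01 comparator switches in \<open>simp_all add: A_def\<close>)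
  next
    case False
    \<comment> \<open>Here T * x / 4 is at least \<open>T\<close>, which already bounds the total of
      losses scaled to [0, 1].\<close>
    have "E t \<le> 1" if "t \<in> {1..T}" for t
    proof -
      have "(\<forall>s\<in>A. 0 < p t s) \<and> (\<Sum>s\<in>A. p t s) = 1"
        unfolding p' using A \<alpha>01 bounds(1) that by (intro posterior_distribution[where T = T]) auto
      moreover from this have "E t \<le> (\<Sum>s\<in>A. p t s * 1)"
        unfolding E_def using l01[OF that] by (intro sum_mono mult_left_mono) (auto simp: less_imp_le)
      ultimately show ?thesis by simp
    qed
    then have "(\<Sum>t = 1..T. E t) \<le> (\<Sum>t = 1..T. 1)" by (intro sum_mono) auto
    moreover have "0 \<le> (\<Sum>t = 1..T. l t (c t))"
      using l01 comparator by (intro sum_nonneg) (auto simp: A_def)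
    moreover have "real T * 4 \<le> T * x" using False by (intro mult_left_mono) auto
    ultimately show ?thesis by simp
  qed
  have "T * x / 4 = sqrt (T / 2 * C)"
  proof -
    have "T * x / 4 = sqrt ((T / 4)\<^sup>2) * sqrt (8 * C / T)" by (simp add: x)
    also have "\<dots> = sqrt ((T / 4)\<^sup>2 * (8 * C / T))" by (rule real_sqrt_mult[symmetric])
    also have "(T / 4)\<^sup>2 * (8 * C / T) = T / 2 * C" using T by (simp add: power2_eq_square)
    finally show ?thesis .
  qed
  with main have "L * ((\<Sum>t = 1..T. E t) - (\<Sum>t = 1..T. l t (c t))) \<le> L * sqrt (T / 2 * C)"
    using \<open>L > 0\<close> by (intro mult_left_mono) auto
  moreover have "L * (\<Sum>t = 1..T. E t) = (\<Sum>t = 1..T. \<Sum>s\<in>strategies m. p t s * loss t s)"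
    using \<open>L > 0\<close> by (simp add: E_def l_def sum_distrib_left A_def)
  moreover have "L * (\<Sum>t = 1..T. l t (c t)) = (\<Sum>t = 1..T. loss t (c t))"
    using \<open>L > 0\<close> by (simp add: l_def sum_distrib_left)
  ultimately show ?thesis by (simp add: right_diff_distrib C_def)
qed

end
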